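(* Let $m\geq1$ be an integer. The nullspaces of the operators $L_+=|\nabla|-\frac{2m}{1+x^2}$ and $L_-=L_++R$ in $\dot H^{1/2}(\mathbb{R})$ are given by $$\mathcal{N}(L_+)=\mathrm{span}\{f_m,g_m\},\qquad \mathcal{N}(L_-)=\mathrm{span}\{1,f_1,\dots,f_m,g_1,\dots,g_m\}.$$ As a consequence, $\dim\mathcal{N}(L_+)=2$ and $\dim\mathcal{N}(L_-)=2m+1$. In particular, the operators $L_+$ and $L_-$ have a common resonance $\varphi\in\dot H^{1/2}(\mathbb{R})\setminus L^2(\mathbb{R})$ (that is, $L_+\varphi=L_-\varphi=0$), which is given by $$\varphi=\begin{cases} g_m & \text{if } m \text{ is odd},\\ f_m & \text{if } m\text{ is even}.\end{cases}$$
   Context: $|\nabla|=\sqrt{-\Delta}$ on $\mathbb{R}$ (Fourier multiplier $|\xi|$). $\dot H^{1/2}(\mathbb{R})$ is the space of real-valued $f\in L^1_{loc}(\mathbb{R})$ with $\int\frac{|f(x)|}{1+x^2}dx<\infty$ and $\|f\|^2_{\dot H^{1/2}}=\frac1{2\pi}\iint\frac{|f(x)-f(y)|^2}{|x-y|^2}dx\,dy<\infty$ (constants belong to it). For integers $k\ge1$, $$f_k(x)=\mathrm{Re}\left(i\cdot\frac{x-i}{x+i}\right)^k,\qquad g_k(x)=\mathrm{Im}\left(i\cdot\frac{x-i}{x+i}\right)^k.$$ For $m\ge1$ put $\mathbf{Q}_m=(f_m,g_m,0):\mathbb{R}\to\mathbb{S}^2$ (a half-harmonic map of degree $m$, with $|\partial_x\mathbf{Q}_m|=\frac{2m}{1+x^2}$)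 and $$(Rf)(x)=\frac1{2\pi}\int_{\mathbb{R}}\frac{|\mathbf{Q}_m(x)-\mathbf{Q}_m(y)|^2}{|x-y|^2}f(y)\,dy .$$ The nullspaces are $\mathcal{N}(L_\pm)=\{f\in\dot H^{1/2}(\mathbb{R}):L_\pm f=0\}$, the equation being understood in the sense of distributions. *)

theory Defs
  imports "HOL-Analysis.Analysis"
begin

text \<open>Functions on the line modulo equality almost everywhere. Representatives need not be
  measurable; measurability is part of the membership conditions of the spaces below.\<close>

quotient_type ae_fun = "real \<Rightarrow> real" / "\<lambda>f g. AE x in lebesgue. f x = g x"
  morphisms rep_ae_fun ae_class
proof (intro equivpI reflpI sympI transpI)
  fix f g h :: "real \<Rightarrow> real"
  show "AE x in lebesgue. f x = f x"
    by simp
  show "AE x in lebesgue. g x = f x" if "AE x in lebesgue. f x = g x"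
    using that by eventually_elim simp
  show "AE x in lebesgue. f x = h x"
    if "AE x in lebesgue. f x = g x" and "AE x in lebesgue. g x = h x"
    using that by eventually_elim simp
qed

instantiation ae_fun :: real_vector
begin

lift_definition zero_ae_fun :: ae_fun is "\<lambda>_. 0" .

lift_definition plus_ae_fun :: "ae_fun \<Rightarrow> ae_fun \<Rightarrow> ae_fun" is "\<lambda>f g x. f x + g x"
  subgoal premises prems using prems by eventually_elim simp done

lift_definition uminus_ae_fun :: "ae_fun \<Rightarrow> ae_fun" is "\<lambda>f x. - f x"
  subgoal premises prems using prems by eventually_elim simp done

lift_definition minus_ae_fun :: "ae_fun \<Rightarrow> ae_fun \<Rightarrow> ae_fun" is "\<lambda>f g x. f x - g x"
  subgoal premises prems using prems by eventually_elim simp done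

lift_definition scaleR_ae_fun :: "real \<Rightarrow> ae_fun \<Rightarrow> ae_fun" is "\<lambda>c f x. c * f x"
  subgoal premises prems using prems by eventually_elim simp done

instance
  by standard (transfer, simp add: algebra_simps)+

end

lemma AE_eq_lebesgue_measurable:
  fixes f g :: "real \<Rightarrow> 'b::{second_countable_topology, t2_space}"
  assumes "AE x in lebesgue. f x = g x" and "f \<in> borel_measurable lebesgue"
  shows "g \<in> borel_measurable lebesgue"
proof (rule measurableI)
  fix A :: "'b set"
  assume A: "A \<in> sets borel"
  have f: "f -` A \<inter> space lebesgue \<in> sets lebesgue"
    using assms(2) A by (rule measurable_sets)
  have fg: "AE x in lebesgue. x \<in> f -` A \<inter> space lebesgue \<longleftrightarrow> x \<in> g -` A \<inter> space lebesgue"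
    using assms(1) by eventually_elim auto
  show "g -` A \<inter> space lebesgue \<in> sets lebesgue"
    by (rule completion.in_sets_AE[OF fg f]) simp
qed simp

lemma AE_eq_lebesgue_measurable_iff:
  fixes f g :: "real \<Rightarrow> 'b::{second_countable_topology, t2_space}"
  assumes "AE x in lebesgue. f x = g x"
  shows "f \<in> borel_measurable lebesgue \<longleftrightarrow> g \<in> borel_measurable lebesgue"
proof -
  have "AE x in lebesgue. g x = f x"
    using assms by eventually_elim auto
  then show ?thesis
    using AE_eq_lebesgue_measurable assms by blast
qed

lemma AE_eq_lebesgue_integrable_iff:
  fixes f g :: "real \<Rightarrow> 'b::{banach, second_countable_topology}"
  assumes "AE x in lebesgue. f x = g x"
  shows "integrable lebesgue f \<longleftrightarrow> integrable lebesgue g"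
  using AE_eq_lebesgue_measurable_iff[OF assms] integrable_cong_AE[of f lebesgue g] assms
  by (meson borel_measurable_integrable)

lemma AE_eq_lebesgue_integral:
  fixes f g :: "real \<Rightarrow> 'b::{banach, second_countable_topology}"
  assumes "AE x in lebesgue. f x = g x"
  shows "integral\<^sup>L lebesgue f = integral\<^sup>L lebesgue g"
proof (cases "f \<in> borel_measurable lebesgue")
  case True
  then show ?thesis
    using AE_eq_lebesgue_measurable[OF assms] assms by (intro integral_cong_AE) auto
next
  case False
  then have "\<not> integrable lebesgue f" and "\<not> integrable lebesgue g"
    using AE_eq_lebesgue_measurable_iff[OF assms] borel_measurable_integrable by blast+
  then show ?thesis
    by (simp add: not_integrable_integral_eq)
qed

lift_definition L1_loc :: "ae_fun \<Rightarrow> bool" is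
  "\<lambda>f. f \<in> borel_measurable lebesgue \<and> (\<forall>K. compact K \<longrightarrow> set_integrable lebesgue K f)"
proof -
  fix f g :: "real \<Rightarrow> real"
  assume fg: "AE x in lebesgue. f x = g x"
  have "set_integrable lebesgue K f \<longleftrightarrow> set_integrable lebesgue K g" for K
    unfolding set_integrable_def
    by (rule AE_eq_lebesgue_integrable_iff) (use fg in eventually_elim, simp)
  then show "(f \<in> borel_measurable lebesgue \<and> (\<forall>K. compact K \<longrightarrow> set_integrable lebesgue K f)) \<longleftrightarrow>
      (g \<in> borel_measurable lebesgue \<and> (\<forall>K. compact K \<longrightarrow> set_integrable lebesgue K g))"
    using AE_eq_lebesgue_measurable_iff[OF fg] by simp
qed

lift_definition poisson_integrable :: "ae_fun \<Rightarrow> bool" is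
  "\<lambda>f. integrable lebesgue (\<lambda>x. \<bar>f x\<bar> / (1 + x\<^sup>2))"
  by (rule AE_eq_lebesgue_integrable_iff) (erule eventually_mono, simp)

lift_definition Hdot_half_norm2 :: "ae_fun \<Rightarrow> ennreal" is
  "\<lambda>f. ennreal (1 / (2 * pi)) *
     (\<integral>\<^sup>+ x. (\<integral>\<^sup>+ y. ennreal (\<bar>f x - f y\<bar>\<^sup>2 / \<bar>x - y\<bar>\<^sup>2) \<partial>lebesgue) \<partial>lebesgue)"
proof (rule arg_cong[where f = "(*) _"], rule nn_integral_cong_AE)
  fix f g :: "real \<Rightarrow> real"
  assume fg: "AE x in lebesgue. f x = g x"
  then show "AE x in lebesgue.
      (\<integral>\<^sup>+ y. ennreal (\<bar>f x - f y\<bar>\<^sup>2 / \<bar>x - y\<bar>\<^sup>2) \<partial>lebesgue) =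
      (\<integral>\<^sup>+ y. ennreal (\<bar>g x - g y\<bar>\<^sup>2 / \<bar>x - y\<bar>\<^sup>2) \<partial>lebesgue)"
  proof eventually_elim
    case (elim x)
    show ?case
      by (rule nn_integral_cong_AE) (use fg in eventually_elim, simp add: elim)
  qed
qed

definition Hdot_half :: "ae_fun set" where
  "Hdot_half = {f. L1_loc f \<and> poisson_integrable f \<and> Hdot_half_norm2 f < \<infinity>}"

lift_definition square_integrable :: "ae_fun \<Rightarrow> bool" is
  "\<lambda>f. f \<in> borel_measurable lebesgue \<and> integrable lebesgue (\<lambda>x. (f x)\<^sup>2)"
proof -
  fix f g :: "real \<Rightarrow> real"
  assume fg: "AE x in lebesgue. f x = g x"
  have "integrable lebesgue (\<lambda>x. (f x)\<^sup>2) \<longleftrightarrow> integrable lebesgue (\<lambda>x. (g x)\<^sup>2)"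
    by (rule AE_eq_lebesgue_integrable_iff) (use fg in eventually_elim, simp)
  then show "(f \<in> borel_measurable lebesgue \<and> integrable lebesgue (\<lambda>x. (f x)\<^sup>2)) \<longleftrightarrow>
      (g \<in> borel_measurable lebesgue \<and> integrable lebesgue (\<lambda>x. (g x)\<^sup>2))"
    using AE_eq_lebesgue_measurable_iff[OF fg] by simp
qed

definition L2 :: "ae_fun set" where
  "L2 = {f. square_integrable f}"

definition smooth :: "(real \<Rightarrow> complex) \<Rightarrow> bool" where
  "smooth \<phi> \<longleftrightarrow> (\<exists>D :: nat \<Rightarrow> real \<Rightarrow> complex.
     D 0 = \<phi> \<and> (\<forall>n x. (D n has_vector_derivative D (Suc n) x) (at x)))"

definition test_function :: "(real \<Rightarrow> complex) \<Rightarrow> bool" where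
  "test_function \<phi> \<longleftrightarrow> smooth \<phi> \<and> compact (closure {x. \<phi> x \<noteq> 0})"

definition fourier :: "(real \<Rightarrow> complex) \<Rightarrow> real \<Rightarrow> complex" where
  "fourier \<phi> \<xi> = (\<integral>x. exp (- (\<i> * of_real (\<xi> * x))) * \<phi> x \<partial>lebesgue)"

definition abs_nabla :: "(real \<Rightarrow> complex) \<Rightarrow> real \<Rightarrow> complex" where
  "abs_nabla \<phi> x =
     of_real (1 / (2 * pi)) *
       (\<integral>\<xi>. exp (\<i> * of_real (\<xi> * x)) * (of_real \<bar>\<xi>\<bar> * fourier \<phi> \<xi>) \<partial>lebesgue)"

lift_definition pairing :: "ae_fun \<Rightarrow> (real \<Rightarrow> complex) \<Rightarrow> complex" is
  "\<lambda>f \<psi>. \<integral>x. of_real (f x) * \<psi> x \<partial>lebesgue"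
  by (rule ext, rule AE_eq_lebesgue_integral) (erule eventually_mono, simp)

text \<open>The bilinear (not sesquilinear) pairing is used. As the symbol \<open>\<bar>\<xi>\<bar>\<close> is even, \<open>abs_nabla\<close> is its
  own transpose, so the distribution \<open>|\<nabla>| f\<close> acts on test functions by
  \<open>\<phi> \<mapsto> pairing f (abs_nabla \<phi>)\<close>. For a test function \<open>\<phi>\<close>, \<open>abs_nabla \<phi>\<close> is continuous and
  \<open>O(1/x\<^sup>2)\<close>, so the integral converges absolutely when \<open>poisson_integrable f\<close>.\<close>

definition abs_nabla_dist :: "ae_fun \<Rightarrow> (real \<Rightarrow> complex) \<Rightarrow> complex" where
  "abs_nabla_dist f \<phi> = pairing f (abs_nabla \<phi>)"

definition f_k :: "nat \<Rightarrow> real \<Rightarrow> real" where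
  "f_k k x = Re ((\<i> * ((of_real x - \<i>) / (of_real x + \<i>))) ^ k)"

definition g_k :: "nat \<Rightarrow> real \<Rightarrow> real" where
  "g_k k x = Im ((\<i> * ((of_real x - \<i>) / (of_real x + \<i>))) ^ k)"

definition Q :: "nat \<Rightarrow> real \<Rightarrow> real ^ 3" where
  "Q m x = vector [f_k m x, g_k m x, 0]"

lift_definition R :: "nat \<Rightarrow> ae_fun \<Rightarrow> real \<Rightarrow> real" is
  "\<lambda>m f x. 1 / (2 * pi) * (\<integral>y. (norm (Q m x - Q m y))\<^sup>2 / \<bar>x - y\<bar>\<^sup>2 * f y \<partial>lebesgue)"
  by (rule ext, rule arg_cong[where f = "(*) _"], rule AE_eq_lebesgue_integral)
    (erule eventually_mono, simp)

text \<open>\<open>Lplus m f\<close> and \<open>Lminus m f\<close> are distributions, i.e. functionals of a test function \<open>\<phi>\<close>.\<close>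

definition Lplus :: "nat \<Rightarrow> ae_fun \<Rightarrow> (real \<Rightarrow> complex) \<Rightarrow> complex" where
  "Lplus m f \<phi> =
     abs_nabla_dist f \<phi> - pairing f (\<lambda>x. of_real (2 * real m / (1 + x\<^sup>2)) * \<phi> x)"

definition Lminus :: "nat \<Rightarrow> ae_fun \<Rightarrow> (real \<Rightarrow> complex) \<Rightarrow> complex" where
  "Lminus m f \<phi> = Lplus m f \<phi> + (\<integral>x. of_real (R m f x) * \<phi> x \<partial>lebesgue)"

definition zero_dist :: "((real \<Rightarrow> complex) \<Rightarrow> complex) \<Rightarrow> bool" where
  "zero_dist T \<longleftrightarrow> (\<forall>\<phi>. test_function \<phi> \<longrightarrow> T \<phi> = 0)"

definition nullspace :: "(ae_fun \<Rightarrow> (real \<Rightarrow> complex) \<Rightarrow> complex) \<Rightarrow> ae_fun set" where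
  "nullspace L = {f \<in> Hdot_half. zero_dist (L f)}"

end

theory Submission
  imports Defs "HOL-Probability.Sinc_Integral"
begin

text \<open>The Cayley transform \<open>cay x = \<i> (x - \<i>) / (x + \<i>)\<close> maps the line onto the unit circle without the point
\<open>\<i>\<close>, which corresponds to infinity, and \<open>f_k\<close>, \<open>g_k\<close> are the real and imaginary parts of \<open>cay ^ k\<close>. Chords of
the circle satisfy \<open>\<bar>cay x - cay y\<bar>\<^sup>2 = 4 (x - y)\<^sup>2 / ((1 + x\<^sup>2) (1 + y\<^sup>2))\<close>, so the energy
\<open>\<integral>\<integral> \<bar>f x - f y\<bar>\<^sup>2 / (x - y)\<^sup>2\<close> and the kernel of \<open>R\<close> are the corresponding objects on the circle. There everything
is diagonal in Fourier series: up to the weight \<open>2 / (1 + x\<^sup>2)\<close>, the operator \<open>|\<nabla>|\<close> has the multiplier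
\<open>\<bar>n\<bar>\<close>, the kernel of \<open>R\<close> is a Fejer kernel with the multiplier \<open>max 0 (m - \<bar>n\<bar>)\<close>, and hence \<open>L\<^sub>+\<close> and \<open>L\<^sub>-\<close> have
the multipliers \<open>\<bar>n\<bar> - m\<close> and \<open>\<bar>n\<bar> - m + max 0 (m - \<bar>n\<bar>) = max 0 (\<bar>n\<bar> - m)\<close>. These vanish exactly for
\<open>\<bar>n\<bar> = m\<close> and for \<open>\<bar>n\<bar> \<le> m\<close>.

Four facts make this rigorous.

\<^item> \<open>abs_nabla_pairing\<close>: the distribution \<open>|\<nabla>| f\<close>, defined by the Fourier transform of the test function, is
represented by the energy form. The difference quotient of the Poisson semigroup \<open>exp (- s |\<nabla>|)\<close> at \<open>s = 0\<close>
has a regular kernel, for which the identity is Fubini's theorem, and it converges to \<open>|\<nabla>|\<close> with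
a majorant \<open>C / (1 + x\<^sup>2)\<close>.

\<^item> \<open>energy_form_cay\<close>: the energy form is diagonal. The kernels \<open>chord_kernel j\<close> are trigonometric polynomials up to
weights, and their Cesaro means converge to twice the singular kernel \<open>1 / (x - y)\<^sup>2\<close>.

\<^item> \<open>AE_eq_0_if_circ_coeff_eq_0\<close>: a function of finite energy is determined by its Fourier coefficients. If they all
vanish, the same kernels bound \<open>N\<close> times its squared norm by its energy, for every \<open>N\<close>.

\<^item> \<open>energy_form_cutoff_tendsto\<close>: an equation that holds for test functions can be tested with \<open>cay ^ n\<close>, which does
not have compact support. The energy is invariant under dilations, so cut-offs at scale \<open>r\<close> stay bounded in energy as
\<open>r\<close> grows, and bounded sequences that converge almost everywhere converge weakly. It is this step that excludes
distributions supported at infinity, and it uses that the solution has finite energy.\<close>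

section \<open>The Cayley transform\<close>

text \<open>Dominated convergence along the intervals \<open>{-n..n}\<close> extends the fundamental theorem of calculus to the line.\<close>

lemma integral_deriv_line:
  fixes F f :: "real \<Rightarrow> complex"
  assumes F: "\<And>x. (F has_vector_derivative f x) (at x)"
    and f: "continuous_on UNIV f" "integrable lborel f"
    and top: "(F \<longlongrightarrow> B) at_top" and bot: "(F \<longlongrightarrow> A) at_bot"
  shows "(LBINT x. f x) = B - A"
proof (rule LIMSEQ_unique)
  let ?g = "\<lambda>n::nat. \<lambda>x. indicator {- real n .. real n} x *\<^sub>R f x"
  show "(\<lambda>n. LBINT x. ?g n x) \<longlonglongrightarrow> (LBINT x. f x)"
  proof (rule integral_dominated_convergence[where w = "\<lambda>x. norm (f x)"])
    show "AE x in lborel. (\<lambda>n. ?g n x) \<longlonglongrightarrow> f x"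
    proof (rule AE_I2, rule tendsto_eventually)
      fix x :: real
      obtain N :: nat where "\<bar>x\<bar> \<le> real N" using real_arch_simple by blast
      then show "\<forall>\<^sub>F n in sequentially. ?g n x = f x"
        by (intro eventually_sequentiallyI[of N]) (auto simp: indicator_def)
    qed
  qed (use f in \<open>auto simp: indicator_def\<close>)
  have "(LBINT x. ?g n x) = F (real n) - F (- real n)" for n
    by (rule integral_FTC_Icc)
      (auto intro: F[THEN has_vector_derivative_at_within] continuous_on_subset[OF f(1)])
  moreover have "(\<lambda>n. F (real n) - F (- real n)) \<longlonglongrightarrow> B - A"
    by (intro tendsto_diff filterlim_compose[OF top] filterlim_compose[OF bot]
        filterlim_real_sequentially filterlim_compose[OF filterlim_uminus_at_bot_at_top])
  ultimately show "(\<lambda>n. LBINT x. ?g n x) \<longlonglongrightarrow> B - A" by simp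
qed

text \<open>The arc length of the circle is \<open>2 * wt x dx\<close> in the coordinate \<open>x\<close>.\<close>

definition wt :: "real \<Rightarrow> real" where
  "wt x = 1 / (1 + x\<^sup>2)"

lemma one_plus_square_pos: "0 < 1 + (x::real)\<^sup>2"
  by (rule add_pos_nonneg) auto

lemma wt_pos: "0 < wt x"
  by (simp add: wt_def one_plus_square_pos)

lemma wt_nonneg [simp]: "0 \<le> wt x"
  using wt_pos[of x] by simp

lemma wt_measurable [measurable]: "wt \<in> borel_measurable borel"
  unfolding wt_def by measurable

lemma continuous_on_wt [continuous_intros]: "continuous_on A wt"
  unfolding wt_def using one_plus_square_pos by (intro continuous_intros) (metis less_irrefl)

lemma integrable_wt: "integrable lborel wt" and integral_wt: "(LBINT x. wt x) = pi"
proof -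
  have "einterval (- \<infinity>) \<infinity> = UNIV"
    by (auto simp: einterval_def)
  then show "integrable lborel wt" "(LBINT x. wt x) = pi"
    using integrable_inverse_1_plus_square LBINT_inverse_1_plus_square
    by (simp_all add: set_integrable_def interval_lebesgue_integral_def set_lebesgue_integral_def
        wt_def[abs_def] inverse_eq_divide)
qed

definition cay :: "real \<Rightarrow> complex" where
  "cay x = \<i> * ((of_real x - \<i>) / (of_real x + \<i>))"

lemma of_real_plus_ii_nonzero [simp]:
  "complex_of_real x + \<i> \<noteq> 0" "complex_of_real x - \<i> \<noteq> 0" "\<i> + complex_of_real x \<noteq> 0"
  "complex_of_real x \<noteq> \<i>"
  by (auto simp: complex_eq_iff)

lemma norm_cay [simp]: "cmod (cay x) = 1"
proof -
  have "cmod (of_real x - \<i>) = cmod (of_real x + \<i>)"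
    by (simp add: cmod_def)
  then show ?thesis by (simp add: cay_def norm_mult norm_divide)
qed

lemma cay_nonzero [simp]: "cay x \<noteq> 0"
  using norm_cay[of x] by (metis norm_zero zero_neq_one)

lemma cnj_cay: "cnj (cay x) = inverse (cay x)"
  using complex_norm_square[of "cay x"] by (simp add: field_simps)

lemma cay_diff: "cay x - cay y = - 2 * of_real (x - y) / ((of_real x + \<i>) * (of_real y + \<i>))"
proof -
  have eq: "cay t = \<i> + 2 / (of_real t + \<i>)" for t
    by (simp add: cay_def divide_simps) (simp add: algebra_simps)
  show ?thesis unfolding eq[of x] eq[of y] by (simp add: divide_simps) (simp add: algebra_simps)
qed

lemma wt_complex: "complex_of_real (wt x) = 1 / ((of_real x + \<i>) * (of_real x - \<i>))"
  by (simp add: wt_def power2_eq_square algebra_simps)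

lemma norm_of_real_plus_ii: "(cmod (of_real x + \<i>))\<^sup>2 = 1 + x\<^sup>2"
  by (simp add: cmod_def)

text \<open>Conformal invariance in the form used throughout: chords of the circle are distances on the line, up to
the weights at the two end points.\<close>

lemma norm_cay_diff: "(cmod (cay x - cay y))\<^sup>2 = 4 * wt x * wt y * (x - y)\<^sup>2"
proof -
  have "(cmod (cay x - cay y))\<^sup>2
      = (2 * \<bar>x - y\<bar>)\<^sup>2 / ((cmod (of_real x + \<i>))\<^sup>2 * (cmod (of_real y + \<i>))\<^sup>2)"
    unfolding cay_diff norm_mult norm_divide norm_of_real
    by (simp add: power_divide power_mult_distrib norm_mult)
  then show ?thesis
    unfolding norm_of_real_plus_ii by (simp add: wt_def power_mult_distrib)
qed

lemma cay_deriv: "(cay has_vector_derivative (2 * \<i> * of_real (wt x) * cay x)) (at x)"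
proof -
  have "((\<lambda>z. \<i> * ((z - \<i>) / (z + \<i>))) has_field_derivative
      2 * \<i> * of_real (wt x) * cay x) (at (of_real x))"
    by (rule derivative_eq_intros refl | simp)+
      (simp add: wt_complex cay_def divide_simps power2_eq_square)
  then show ?thesis
    unfolding cay_def[abs_def] by (rule has_vector_derivative_real_field)
qed

text \<open>A power of \<open>cay\<close> times \<open>wt\<close> is again a derivative, which is what makes its integral computable.\<close>

lemma cay_powi_deriv:
  "((\<lambda>x. cay x powi k) has_vector_derivative (2 * \<i> * of_int k * of_real (wt x) * cay x powi k)) (at x)"
proof -
  have "((\<lambda>z. z powi k) has_field_derivative (of_int k * cay x powi (k - 1))) (at (cay x))"
    by (rule derivative_eq_intros | simp)+
  from field_vector_diff_chain_at[OF cay_deriv this]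
  show ?thesis
    by (simp add: o_def power_int_diff mult_ac)
qed

lemma continuous_on_cay [continuous_intros]: "continuous_on A cay"
  by (meson cay_deriv continuous_at_imp_continuous_on has_vector_derivative_continuous)

lemma cay_measurable [measurable]: "cay \<in> borel_measurable borel"
  by (intro borel_measurable_continuous_onI continuous_intros)

lemma cay_powi_measurable [measurable]: "(\<lambda>x. cay x powi k) \<in> borel_measurable borel"
  by (intro borel_measurable_continuous_onI continuous_intros) auto

lemma wt_tendsto: "(wt \<longlongrightarrow> 0) at_top" "(wt \<longlongrightarrow> 0) at_bot"
proof -
  have "filterlim (\<lambda>x::real. 1 + x\<^sup>2) at_top at_top"
    by (intro filterlim_tendsto_add_at_top[OF tendsto_const] filterlim_pow_at_top filterlim_ident) simp
  then show *: "(wt \<longlongrightarrow> 0) at_top"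
    unfolding wt_def[abs_def] by (intro tendsto_divide_0[OF tendsto_const] filterlim_at_top_imp_at_infinity)
  have "wt = (\<lambda>x. wt (- x))" by (auto simp: wt_def)
  with filterlim_compose[OF * filterlim_uminus_at_top_at_bot] show "(wt \<longlongrightarrow> 0) at_bot" by simp
qed

lemma cay_tendsto: "(cay \<longlongrightarrow> \<i>) at_top" "(cay \<longlongrightarrow> \<i>) at_bot"
proof -
  have eq: "cmod (cay x - \<i>) = 2 * sqrt (wt x)" for x
  proof -
    have "cay x - \<i> = 2 / (of_real x + \<i>)"
      by (simp add: cay_def divide_simps) (simp add: algebra_simps)
    then have "(cmod (cay x - \<i>))\<^sup>2 = 4 * wt x"
      by (simp add: norm_divide power_divide norm_of_real_plus_ii wt_def)
    then show ?thesis
      by (metis norm_ge_zero real_sqrt_four real_sqrt_mult real_sqrt_unique)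
  qed
  have "(cay \<longlongrightarrow> \<i>) F" if "(wt \<longlongrightarrow> 0) F" for F
  proof (rule Lim_null[THEN iffD2], rule tendsto_norm_zero_cancel)
    show "((\<lambda>x. cmod (cay x - \<i>)) \<longlongrightarrow> 0) F"
      unfolding eq using that by (auto intro!: tendsto_eq_intros)
  qed
  then show "(cay \<longlongrightarrow> \<i>) at_top" "(cay \<longlongrightarrow> \<i>) at_bot"
    using wt_tendsto by auto
qed

section \<open>Fourier coefficients on the circle\<close>

text \<open>The factor is \<open>cay powi k\<close> and not its conjugate, so with \<open>cay x = exp (\<i> \<theta>)\<close> this is half of the
integral of \<open>f\<close> against \<open>exp (\<i> k \<theta>)\<close> over the circle. The total mass is \<open>pi\<close>.\<close>

definition circ_coeff :: "(real \<Rightarrow> complex) \<Rightarrow> int \<Rightarrow> complex" where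
  "circ_coeff f k = (LBINT x. f x * cay x powi k * of_real (wt x))"

lemma integrable_mult_bounded:
  fixes f g :: "'a \<Rightarrow> complex"
  assumes "integrable M f" "g \<in> borel_measurable M" "\<And>x. cmod (g x) \<le> B"
  shows "integrable M (\<lambda>x. f x * g x)"
proof (rule Bochner_Integration.integrable_bound)
  show "integrable M (\<lambda>x. B *\<^sub>R f x)" using assms by auto
  have "cmod (f x) * cmod (g x) \<le> \<bar>B\<bar> * cmod (f x)" for x
    using assms(3)[of x] mult_right_mono[of "cmod (g x)" "\<bar>B\<bar>" "cmod (f x)"] by (simp add: mult.commute)
  then show "AE x in M. norm (f x * g x) \<le> norm (B *\<^sub>R f x)"
    by (auto simp: norm_mult)
qed (use assms in auto)

definition wt_integrable :: "(real \<Rightarrow> complex) \<Rightarrow> bool" where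
  "wt_integrable f \<longleftrightarrow> f \<in> borel_measurable borel \<and> integrable lborel (\<lambda>x. f x * of_real (wt x))"

lemma wt_integrableD [measurable_dest]: "wt_integrable f \<Longrightarrow> f \<in> borel_measurable borel"
  by (simp add: wt_integrable_def)

lemma wt_integrable_mult_bounded:
  assumes "wt_integrable f" "g \<in> borel_measurable borel" "\<And>x. cmod (g x) \<le> B"
  shows "wt_integrable (\<lambda>x. f x * g x)"
  using integrable_mult_bounded[of lborel "\<lambda>x. f x * of_real (wt x)" g B] assms
  by (auto simp: wt_integrable_def mult_ac)

lemma wt_integrable_const: "wt_integrable (\<lambda>_. c)"
  using integrable_wt by (auto simp: wt_integrable_def)

lemma wt_integrable_bounded:
  assumes "g \<in> borel_measurable borel" "\<And>x. cmod (g x) \<le> B"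
  shows "wt_integrable g"
  using wt_integrable_mult_bounded[OF wt_integrable_const[of 1] assms] by simp

lemma wt_integrable_add:
  "wt_integrable f \<Longrightarrow> wt_integrable g \<Longrightarrow> wt_integrable (\<lambda>x. f x + g x)"
  by (auto simp: wt_integrable_def algebra_simps)

lemma wt_integrable_cmult: "wt_integrable f \<Longrightarrow> wt_integrable (\<lambda>x. c * f x)"
  by (auto simp: wt_integrable_def mult.assoc)

lemma wt_integrable_coeff:
  assumes "wt_integrable f"
  shows "integrable lborel (\<lambda>x. f x * cay x powi k * of_real (wt x))"
  using wt_integrable_mult_bounded[OF assms, of "\<lambda>x. cay x powi k" 1]
  by (simp add: wt_integrable_def norm_power_int)

text \<open>For \<open>k \<noteq> 0\<close> the primitive \<open>cay powi k / (2 \<i> k)\<close> has the same limit at both ends of the line.\<close>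

lemma integral_cay_powi: "(LBINT x. cay x powi k * of_real (wt x)) = (if k = 0 then of_real pi else 0)"
proof (cases "k = 0")
  case True
  then show ?thesis by (simp add: integral_wt)
next
  case False
  have "(LBINT x. cay x powi k * of_real (wt x)) = \<i> powi k / (2 * \<i> * of_int k) - \<i> powi k / (2 * \<i> * of_int k)"
  proof (rule integral_deriv_line)
    show "((\<lambda>x. cay x powi k / (2 * \<i> * of_int k)) has_vector_derivative
        cay x powi k * of_real (wt x)) (at x)" for x
      using has_vector_derivative_mult_right[OF cay_powi_deriv, of "1 / (2 * \<i> * of_int k)" k x] False
      by (simp add: mult_ac)
    show "integrable lborel (\<lambda>x. cay x powi k * of_real (wt x))"
      using wt_integrable_coeff[OF wt_integrable_const[of 1]] by simp
    show "continuous_on UNIV (\<lambda>x. cay x powi k * of_real (wt x))"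
      by (intro continuous_intros) auto
  qed (use False in \<open>auto intro!: tendsto_intros cay_tendsto\<close>)
  then show ?thesis using False by simp
qed

lemma circ_coeff_cay: "circ_coeff (\<lambda>x. cay x powi n) k = (if k = - n then of_real pi else 0)"
  using integral_cay_powi[of "n + k"] by (simp add: circ_coeff_def power_int_add add_eq_0_iff)

section \<open>The chordal kernel\<close>

text \<open>For \<open>j = m\<close> this is \<open>2 pi\<close> times the kernel of \<open>R\<close>. Divided by \<open>4 * wt x * wt y\<close> it is \<open>j\<close> times the Fejer
kernel of order \<open>j\<close>.
On the diagonal the division gives \<open>0\<close>, which matters on a null set only.\<close>

definition chord_kernel :: "nat \<Rightarrow> real \<Rightarrow> real \<Rightarrow> real" where
  "chord_kernel j x y = (cmod (cay x ^ j - cay y ^ j))\<^sup>2 / (x - y)\<^sup>2"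

lemma chord_kernel_nonneg [simp]: "0 \<le> chord_kernel j x y"
  by (simp add: chord_kernel_def)

lemma chord_kernel_commute: "chord_kernel j x y = chord_kernel j y x"
  by (simp add: chord_kernel_def norm_minus_commute power2_commute)

lemma chord_kernel_measurable [measurable]:
  "(\<lambda>p. chord_kernel j (fst p) (snd p)) \<in> borel_measurable (borel \<Otimes>\<^sub>M borel)"
  "chord_kernel j x \<in> borel_measurable borel"
  unfolding chord_kernel_def by measurable

lemma chord_kernel_le: "chord_kernel j x y \<le> 4 * (real j)\<^sup>2 * wt x * wt y"
proof (cases "x = y")
  case False
  have "cmod (cay x ^ j - cay y ^ j) \<le> real j * cmod (cay x - cay y)"
    by (rule norm_power_diff) auto
  then have "(cmod (cay x ^ j - cay y ^ j))\<^sup>2 \<le> (real j * cmod (cay x - cay y))\<^sup>2"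
    by (rule power_mono) simp
  also have "\<dots> = 4 * (real j)\<^sup>2 * wt x * wt y * (x - y)\<^sup>2"
    by (simp add: power_mult_distrib norm_cay_diff)
  finally show ?thesis
    using False by (simp add: chord_kernel_def divide_le_eq)
qed (simp add: chord_kernel_def)

text \<open>Dividing \<open>z ^ j - w ^ j\<close> by \<open>z - w\<close> leaves a geometric sum, whose squared modulus is a trigonometric
polynomial in \<open>z / w\<close>.\<close>

lemma chord_kernel_expand:
  assumes "x \<noteq> y"
  shows "complex_of_real (chord_kernel j x y) = 4 * of_real (wt x) * of_real (wt y) *
    (\<Sum>a<j. \<Sum>b<j. cay x powi (int a - int b) * cay y powi (int b - int a))"
proof (cases j)
  case (Suc n)
  let ?X = "\<Sum>a<j. cay x ^ a * cay y ^ (n - a)"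
  have "cay x ^ j - cay y ^ j = (cay x - cay y) * ?X"
    unfolding Suc by (rule diff_power_eq_sum)
  then have "chord_kernel j x y = (cmod (cay x - cay y))\<^sup>2 * (cmod ?X)\<^sup>2 / (x - y)\<^sup>2"
    by (simp add: chord_kernel_def norm_mult power_mult_distrib)
  also have "\<dots> = 4 * wt x * wt y * (cmod ?X)\<^sup>2"
    unfolding norm_cay_diff using assms by simp
  finally have "complex_of_real (chord_kernel j x y) = 4 * of_real (wt x) * of_real (wt y) * (?X * cnj ?X)"
    by (simp add: complex_norm_square del: of_real_power)
  also have "?X * cnj ?X = (\<Sum>a<j. \<Sum>b<j. cay x powi (int a - int b) * cay y powi (int b - int a))"
    unfolding cnj_sum sum_product
  proof (intro sum.cong refl)
    fix a b assume "a \<in> {..<j}" "b \<in> {..<j}"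
    then have le: "a \<le> n" "b \<le> n" using Suc by auto
    have "cay x ^ a * cay y ^ (n - a) * cnj (cay x ^ b * cay y ^ (n - b))
       = cay x powi int a * cay y powi int (n - a) * (cay x powi (- int b) * cay y powi (- int (n - b)))"
      by (simp add: cnj_cay power_int_minus power_inverse)
    also have "\<dots> = cay x powi (int a + (- int b)) * cay y powi (int (n - a) + (- int (n - b)))"
      by (subst (1 2) power_int_add) auto
    also have "int (n - a) + (- int (n - b)) = int b - int a" using le by linarith
    finally show "cay x ^ a * cay y ^ (n - a) * cnj (cay x ^ b * cay y ^ (n - b)) =
       cay x powi (int a - int b) * cay y powi (int b - int a)" by simp
  qed
  finally show ?thesis .
qed (simp add: chord_kernel_def)

lemma chord_kernel_apply:
  assumes g: "wt_integrable g"
  shows "integrable lborel (\<lambda>y. of_real (chord_kernel j x y) * g y)" (is ?I)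
    and "(LBINT y. of_real (chord_kernel j x y) * g y) = 4 * of_real (wt x) *
      (\<Sum>a<j. \<Sum>b<j. cay x powi (int a - int b) * circ_coeff g (int b - int a))" (is ?E)
proof -
  let ?h = "\<lambda>y. 4 * of_real (wt x) *
      (\<Sum>a<j. \<Sum>b<j. cay x powi (int a - int b) * (g y * cay y powi (int b - int a) * of_real (wt y)))"
  have ae: "AE y in lborel. of_real (chord_kernel j x y) * g y = ?h y"
    using AE_lborel_singleton[of x]
    by eventually_elim (auto simp: chord_kernel_expand sum_distrib_left mult_ac)
  have [measurable]: "g \<in> borel_measurable borel" using g by (rule wt_integrableD)
  have h: "integrable lborel ?h"
    by (intro integrable_mult_right Bochner_Integration.integrable_sum wt_integrable_coeff g)
  show ?I
    using h by (subst integrable_cong_AE[OF _ _ ae]) auto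
  have "(LBINT y. of_real (chord_kernel j x y) * g y) = (LBINT y. ?h y)"
    by (rule integral_cong_AE[OF _ _ ae]) auto
  also have "\<dots> = 4 * of_real (wt x) *
      (\<Sum>a<j. \<Sum>b<j. cay x powi (int a - int b) * circ_coeff g (int b - int a))"
    unfolding circ_coeff_def
    by (subst integral_mult_right_zero, subst Bochner_Integration.integral_sum,
        intro Bochner_Integration.integrable_sum integrable_mult_right wt_integrable_coeff g,
        subst Bochner_Integration.integral_sum,
        intro integrable_mult_right wt_integrable_coeff g,
        subst integral_mult_right_zero, rule refl)
  finally show ?E .
qed

text \<open>Orthogonality leaves the pairs \<open>a, b < j\<close> with \<open>a - b = n\<close>. There are \<open>j - n\<close> of them for \<open>n \<le> j\<close> and none beyond,
so the truncated subtraction is the Fejer multiplier.\<close>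

lemma chord_kernel_cay:
  "(LBINT y. of_real (chord_kernel j x y) * cay y ^ n) = 4 * of_real pi * of_real (wt x) * of_nat (j - n) * cay x ^ n"
proof -
  have "wt_integrable (\<lambda>y. cay y powi int n)"
    by (rule wt_integrable_bounded[of _ 1]) (auto simp: norm_power)
  note chord_kernel_apply(2)[OF this, of j x]
  also have "(\<Sum>a<j. \<Sum>b<j. cay x powi (int a - int b) * circ_coeff (\<lambda>y. cay y powi int n) (int b - int a))
      = (\<Sum>a<j. if n \<le> a then of_real pi * cay x ^ n else 0)"
  proof (rule sum.cong[OF refl])
    fix a assume a: "a \<in> {..<j}"
    have "(\<Sum>b<j. cay x powi (int a - int b) * circ_coeff (\<lambda>y. cay y powi int n) (int b - int a))
        = (\<Sum>b<j. if b = a - n \<and> n \<le> a then of_real pi * cay x ^ n else 0)"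
      unfolding circ_coeff_cay by (intro sum.cong refl) (auto simp: of_nat_diff)
    also have "\<dots> = (if n \<le> a then of_real pi * cay x ^ n else 0)"
      using a by (cases "n \<le> a") auto
    finally show "(\<Sum>b<j. cay x powi (int a - int b) * circ_coeff (\<lambda>y. cay y powi int n) (int b - int a))
      = (if n \<le> a then of_real pi * cay x ^ n else 0)" .
  qed
  also have "\<dots> = of_nat (card {a \<in> {..<j}. n \<le> a}) * (of_real pi * cay x ^ n)"
    by (subst sum.inter_filter[symmetric]) auto
  also have "{a \<in> {..<j}. n \<le> a} = {n..<j}" by auto
  finally show ?thesis by (simp add: mult_ac)
qed

section \<open>The energy form\<close>

abbreviation plane :: "(real \<times> real) measure" where
  "plane \<equiv> lborel \<Otimes>\<^sub>M lborel"

lemma integrable_plane_product: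
  fixes u v :: "real \<Rightarrow> complex"
  assumes u: "integrable lborel u" and v: "integrable lborel v"
  shows "integrable plane (\<lambda>p. u (fst p) * v (snd p))"
proof (rule lborel_pair.Fubini_integrable)
  have [measurable]: "u \<in> borel_measurable borel" "v \<in> borel_measurable borel"
    using u v by auto
  show "(\<lambda>p. u (fst p) * v (snd p)) \<in> borel_measurable plane" by measurable
  show "integrable lborel (\<lambda>x. LBINT y. norm (u (fst (x, y)) * v (snd (x, y))))"
    using u by (simp add: norm_mult)
qed (use v in auto)

text \<open>The terms with \<open>f x\<close> and \<open>f y\<close> contribute equally. Separating them requires that one of them is integrable on its own,
which fails for the singular kernel \<open>1 / (x - y)\<^sup>2\<close>; the lemma therefore serves for its regular approximations.\<close>

lemma integral_symmetrize:
  fixes k :: "real \<Rightarrow> real \<Rightarrow> complex" and f g :: "real \<Rightarrow> complex"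
  assumes sym: "\<And>x y. k x y = k y x"
    and int: "integrable plane (\<lambda>p. k (fst p) (snd p) * (f (fst p) * (g (fst p) - g (snd p))))"
  shows "(\<integral>p. k (fst p) (snd p) * ((f (fst p) - f (snd p)) * (g (fst p) - g (snd p))) \<partial>plane)
       = 2 * (LBINT x. f x * (LBINT y. k x y * (g x - g y)))"
proof -
  let ?h = "\<lambda>p. k (fst p) (snd p) * (f (fst p) * (g (fst p) - g (snd p)))"
  have int': "integrable plane (\<lambda>(x, y). ?h (y, x))"
    by (rule lborel_pair.integrable_product_swap[OF int])
  have "(\<integral>p. k (fst p) (snd p) * ((f (fst p) - f (snd p)) * (g (fst p) - g (snd p))) \<partial>plane)
      = (\<integral>p. ?h p + (case p of (x, y) \<Rightarrow> ?h (y, x)) \<partial>plane)"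
    by (rule arg_cong[where f = "integral\<^sup>L plane"], rule ext, clarsimp)
      (subst sym, simp add: algebra_simps)
  also have "\<dots> = (\<integral>p. ?h p \<partial>plane) + (\<integral>p. (case p of (x, y) \<Rightarrow> ?h (y, x)) \<partial>plane)"
    by (rule Bochner_Integration.integral_add[OF int int'])
  also have "(\<integral>p. (case p of (x, y) \<Rightarrow> ?h (y, x)) \<partial>plane) = (\<integral>p. ?h p \<partial>plane)"
    by (rule lborel_pair.integral_product_swap) (use int in auto)
  also have "(\<integral>p. ?h p \<partial>plane) = (LBINT x. (LBINT y. ?h (x, y)))"
    by (rule lborel_pair.integral_fst'[symmetric, OF int])
  also have "\<dots> = (LBINT x. f x * (LBINT y. k x y * (g x - g y)))"
    by (simp add: mult.left_commute[of _ "f _"])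
  finally show ?thesis by simp
qed

text \<open>With this quotient the energy is a squared \<open>L\<^sup>2\<close> norm on the plane.\<close>

definition dquot :: "(real \<Rightarrow> complex) \<Rightarrow> real \<times> real \<Rightarrow> complex" where
  "dquot f p = (f (fst p) - f (snd p)) / of_real (fst p - snd p)"

definition finite_energy :: "(real \<Rightarrow> complex) \<Rightarrow> bool" where
  "finite_energy f \<longleftrightarrow> wt_integrable f \<and> integrable plane (\<lambda>p. (cmod (dquot f p))\<^sup>2)"

text \<open>Bilinear, without conjugation. It is \<open>2 pi\<close> times the form of \<open>|\<nabla>|\<close>.\<close>

definition energy_form :: "(real \<Rightarrow> complex) \<Rightarrow> (real \<Rightarrow> complex) \<Rightarrow> complex" where
  "energy_form f g = (\<integral>p. dquot f p * dquot g p \<partial>plane)"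

lemma energy_form_commute: "energy_form f g = energy_form g f"
  by (simp add: energy_form_def mult.commute)

lemma dquot_measurable [measurable]:
  assumes [measurable]: "f \<in> borel_measurable borel"
  shows "dquot f \<in> borel_measurable plane"
  unfolding dquot_def[abs_def] by measurable

lemma finite_energyD:
  assumes "finite_energy f"
  shows "wt_integrable f" "f \<in> borel_measurable borel" "integrable plane (\<lambda>p. (cmod (dquot f p))\<^sup>2)"
  using assms by (auto simp: finite_energy_def wt_integrable_def)

lemma dquot_add: "dquot (\<lambda>x. f x + g x) p = dquot f p + dquot g p"
  by (simp add: dquot_def add_divide_distrib[symmetric] algebra_simps)

lemma dquot_cmult: "dquot (\<lambda>x. c * f x) p = c * dquot f p"
  by (simp add: dquot_def algebra_simps)

lemma norm_add_square_le:
  fixes a b :: "'a::real_normed_vector"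
  shows "(norm (a + b))\<^sup>2 \<le> 2 * (norm a)\<^sup>2 + 2 * (norm b)\<^sup>2"
proof -
  have "(norm (a + b))\<^sup>2 \<le> (norm a + norm b)\<^sup>2"
    by (rule power_mono[OF norm_triangle_ineq]) simp
  also have "\<dots> \<le> 2 * (norm a)\<^sup>2 + 2 * (norm b)\<^sup>2"
    using sum_squares_bound[of "norm a" "norm b"] by (simp add: power2_sum)
  finally show ?thesis .
qed

lemma finite_energy_add:
  assumes f: "finite_energy f" and g: "finite_energy g"
  shows "finite_energy (\<lambda>x. f x + g x)"
proof -
  note [measurable] = finite_energyD(2)[OF f] finite_energyD(2)[OF g]
  have "integrable plane (\<lambda>p. (cmod (dquot (\<lambda>x. f x + g x) p))\<^sup>2)"
  proof (rule Bochner_Integration.integrable_bound)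
    show "integrable plane (\<lambda>p. 2 * (cmod (dquot f p))\<^sup>2 + 2 * (cmod (dquot g p))\<^sup>2)"
      using finite_energyD(3)[OF f] finite_energyD(3)[OF g] by auto
  qed (auto simp: dquot_add intro!: AE_I2 norm_add_square_le order_trans[OF norm_add_square_le])
  then show ?thesis
    using f g by (auto simp: finite_energy_def wt_integrable_add)
qed

lemma finite_energy_cmult:
  assumes f: "finite_energy f"
  shows "finite_energy (\<lambda>x. c * f x)"
  using assms by (auto simp: finite_energy_def wt_integrable_cmult dquot_cmult norm_mult power_mult_distrib)

lemma integrable_dquot_mult:
  assumes f: "finite_energy f" and g: "finite_energy g"
  shows "integrable plane (\<lambda>p. dquot f p * dquot g p)"
proof (rule Bochner_Integration.integrable_bound)
  show "integrable plane (\<lambda>p. (cmod (dquot f p))\<^sup>2 + (cmod (dquot g p))\<^sup>2)"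
    using finite_energyD(3)[OF f] finite_energyD(3)[OF g] by auto
  have "cmod a * cmod b \<le> (cmod a)\<^sup>2 + (cmod b)\<^sup>2" for a b
    using sum_squares_bound[of "cmod a" "cmod b"] mult_nonneg_nonneg[OF norm_ge_zero norm_ge_zero, of a b]
    unfolding mult.assoc by linarith
  then show "AE p in plane. norm (dquot f p * dquot g p) \<le> norm ((cmod (dquot f p))\<^sup>2 + (cmod (dquot g p))\<^sup>2)"
    by (auto simp: norm_mult)
  note [measurable] = finite_energyD(2)[OF f] finite_energyD(2)[OF g]
  show "(\<lambda>p. dquot f p * dquot g p) \<in> borel_measurable plane" by measurable
qed

lemma AE_off_diagonal: "AE p in plane. fst p \<noteq> snd p"
proof -
  have *: "Measurable.pred plane (\<lambda>p. fst p \<noteq> snd p)" by measurable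
  have "AE y in lborel. x \<noteq> y" for x :: real
    using AE_lborel_singleton[of x] by eventually_elim auto
  then have "AE x in lborel. AE y in lborel. fst (x, y) \<noteq> (snd (x, y) :: real)"
    by simp
  then show ?thesis
    by (rule lborel_pair.AE_pair_measure[rotated]) (use * in \<open>simp add: pred_def\<close>)
qed

text \<open>Dividing the assumption by \<open>(x - y)\<^sup>2\<close> leaves the integrable product \<open>wt x * wt y\<close>. The condition says
that \<open>f\<close> is Lipschitz as a function on the circle, up to the point at infinity.\<close>

lemma finite_energy_if_chord_lipschitz:
  assumes [measurable]: "f \<in> borel_measurable borel" and B: "\<And>x. cmod (f x) \<le> B"
    and C: "\<And>x y. (cmod (f x - f y))\<^sup>2 \<le> C * (wt x * wt y * (x - y)\<^sup>2)"
  shows "finite_energy f"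
proof -
  have "integrable plane (\<lambda>p. (cmod (dquot f p))\<^sup>2)"
  proof (rule Bochner_Integration.integrable_bound)
    show "integrable plane (\<lambda>p. of_real C * (complex_of_real (wt (fst p)) * of_real (wt (snd p))))" (is "integrable _ ?G")
      by (intro integrable_mult_right integrable_plane_product integrable_of_real integrable_wt)
    show "AE p in plane. norm ((cmod (dquot f p))\<^sup>2) \<le> norm (?G p)"
      using AE_off_diagonal
    proof eventually_elim
      case (elim p)
      have "(cmod (dquot f p))\<^sup>2 = (cmod (f (fst p) - f (snd p)))\<^sup>2 / (fst p - snd p)\<^sup>2"
        by (simp add: dquot_def norm_divide power_divide del: of_real_diff)
      also have "\<dots> \<le> C * (wt (fst p) * wt (snd p))"
        using C[of "fst p" "snd p"] elim by (simp add: divide_le_eq mult_ac)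
      also have "\<dots> \<le> \<bar>C\<bar> * (wt (fst p) * wt (snd p))"
        by (intro mult_right_mono) auto
      finally show ?case by (simp add: norm_mult)
    qed
  qed measurable
  then show ?thesis
    using wt_integrable_bounded[OF assms(1) B] by (simp add: finite_energy_def)
qed

lemma finite_energy_cay: "finite_energy (\<lambda>x. cay x ^ n)"
proof (rule finite_energy_if_chord_lipschitz)
  fix x y
  show "(cmod (cay x ^ n - cay y ^ n))\<^sup>2 \<le> 4 * (real n)\<^sup>2 * (wt x * wt y * (x - y)\<^sup>2)"
    using mult_right_mono[OF chord_kernel_le[of n x y], of "(x - y)\<^sup>2"]
    by (cases "x = y") (simp_all add: chord_kernel_def mult_ac)
qed (auto simp: norm_power)

lemma wt_integrable_cay: "wt_integrable (\<lambda>x. cay x ^ n)"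
  by (rule finite_energyD(1)[OF finite_energy_cay])

section \<open>Diagonalization of the energy form\<close>

text \<open>By symmetry only the action of the kernel on \<open>cay ^ 0\<close> and on \<open>cay ^ n\<close> enters, with the multipliers \<open>j\<close> and \<open>j - n\<close>.
Their difference is \<open>min j n\<close>.\<close>

lemma chord_kernel_form_cay:
  assumes f: "wt_integrable f"
  shows "(\<integral>p. of_real (chord_kernel j (fst p) (snd p)) *
        ((f (fst p) - f (snd p)) * (cay (fst p) ^ n - cay (snd p) ^ n)) \<partial>plane)
      = 8 * of_real pi * of_nat (min j n) * circ_coeff f (int n)"
proof -
  have [measurable]: "f \<in> borel_measurable borel" using f by (rule wt_integrableD)
  let ?g = "\<lambda>x. cay x ^ n"
  have inner: "(LBINT y. of_real (chord_kernel j x y) * (?g x - ?g y)) = 4 * of_real pi * of_nat (min j n) * (of_real (wt x) * ?g x)" for x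
  proof -
    have "(LBINT y. of_real (chord_kernel j x y) * (?g x - ?g y))
        = (LBINT y. of_real (chord_kernel j x y) * cay y ^ 0 * ?g x - of_real (chord_kernel j x y) * ?g y)"
      by (simp add: algebra_simps)
    also have "\<dots> = (LBINT y. of_real (chord_kernel j x y) * cay y ^ 0 * ?g x) - (LBINT y. of_real (chord_kernel j x y) * ?g y)"
      by (intro Bochner_Integration.integral_diff integrable_mult_left chord_kernel_apply(1) wt_integrable_cay)
    also have "\<dots> = 4 * of_real pi * of_real (wt x) * of_nat j * ?g x - 4 * of_real pi * of_real (wt x) * of_nat (j - n) * ?g x"
      unfolding integral_mult_left_zero chord_kernel_cay by simp
    also have "of_nat (j - n) = (of_nat j - of_nat (min j n) :: complex)"
      by (cases "n \<le> j") (auto simp: of_nat_diff)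
    finally show ?thesis by (simp add: algebra_simps)
  qed
  have "integrable plane (\<lambda>p. complex_of_real (chord_kernel j (fst p) (snd p)) * (f (fst p) * (?g (fst p) - ?g (snd p))))"
    (is "integrable _ ?F")
  proof (rule Bochner_Integration.integrable_bound)
    show "integrable plane (\<lambda>p. of_real (8 * (real j)\<^sup>2) * (f (fst p) * of_real (wt (fst p)) * of_real (wt (snd p))))"
      (is "integrable _ ?G")
      using f by (intro integrable_mult_right integrable_plane_product integrable_of_real integrable_wt)
        (auto simp: wt_integrable_def)
    have "\<bar>chord_kernel j x y\<bar> * cmod (f x) * cmod (?g x - ?g y) \<le> (4 * (real j)\<^sup>2 * wt x * wt y) * cmod (f x) * 2" for x y
    proof (intro mult_mono)
      show "cmod (?g x - ?g y) \<le> 2"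
        using norm_triangle_ineq4[of "?g x" "?g y"] by (simp add: norm_power)
    qed (use chord_kernel_le in auto)
    then show "AE p in plane. norm (?F p) \<le> norm (?G p)"
      by (auto simp: norm_mult norm_power mult_ac)
  qed measurable
  from integral_symmetrize[OF _ this]
  have "(\<integral>p. of_real (chord_kernel j (fst p) (snd p)) * ((f (fst p) - f (snd p)) * (?g (fst p) - ?g (snd p))) \<partial>plane)
      = 2 * (LBINT x. f x * (LBINT y. of_real (chord_kernel j x y) * (?g x - ?g y)))"
    by (metis chord_kernel_commute)
  also have "\<dots> = 2 * (LBINT x. f x * (4 * of_real pi * of_nat (min j n) * (of_real (wt x) * ?g x)))"
    by (simp only: inner)
  also have "(LBINT x. f x * (4 * of_real pi * of_nat (min j n) * (of_real (wt x) * ?g x)))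
      = 4 * of_real pi * of_nat (min j n) * (LBINT x. f x * cay x powi int n * of_real (wt x))"
    by (subst integral_mult_right_zero[symmetric]) (simp add: mult_ac)
  finally show ?thesis by (simp add: circ_coeff_def)
qed

lemma mean_geometric_tendsto_0:
  fixes q :: complex
  assumes q: "cmod q = 1" "q \<noteq> 1"
  shows "(\<lambda>N. (\<Sum>j<N. q ^ j) / of_nat N) \<longlonglongrightarrow> 0"
proof (rule Lim_null_comparison)
  have "cmod ((\<Sum>j<N. q ^ j) / of_nat N) \<le> 2 / cmod (q - 1) * (1 / real N)" for N
  proof -
    have "cmod (q ^ N - 1) \<le> 2"
      using norm_triangle_ineq4[of "q ^ N" 1] q by (simp add: norm_power)
    then show ?thesis
      using q by (simp add: geometric_sum norm_divide norm_mult divide_right_mono)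
  qed
  then show "\<forall>\<^sub>F N in sequentially. cmod ((\<Sum>j<N. q ^ j) / of_nat N) \<le> 2 / cmod (q - 1) * (1 / real N)"
    by simp
  show "(\<lambda>N. 2 / cmod (q - 1) * (1 / real N)) \<longlonglongrightarrow> 0"
    by (rule tendsto_mult_right_zero) (rule lim_1_over_n)
qed

text \<open>Divided by \<open>(x - y)\<^sup>2\<close>, this is a mean of chordal kernels.\<close>

definition mean_chord :: "nat \<Rightarrow> real \<times> real \<Rightarrow> real" where
  "mean_chord N p = (\<Sum>j<N. (cmod (cay (fst p) ^ j - cay (snd p) ^ j))\<^sup>2) / real N"

text \<open>A squared chord is \<open>2 - 2 * Re (q ^ j)\<close> with \<open>q\<close> on the unit circle, and \<open>q \<noteq> 1\<close> off the diagonal, so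
the oscillating part has mean \<open>0\<close>.\<close>

lemma mean_chord_tendsto:
  assumes "fst p \<noteq> snd p"
  shows "(\<lambda>N. mean_chord N p) \<longlonglongrightarrow> 2"
proof -
  \<comment> \<open>the quotient of the two points, written as a product\<close>
  define q where "q = cay (fst p) * cnj (cay (snd p))"
  have "cay (fst p) \<noteq> cay (snd p)"
    using norm_cay_diff[of "fst p" "snd p"] assms wt_pos[of "fst p"] wt_pos[of "snd p"] by auto
  then have q: "cmod q = 1" "q \<noteq> 1"
    by (auto simp: q_def norm_mult norm_inverse cnj_cay field_simps)
      (simp add: norm_divide)?
  have "(cmod (cay (fst p) ^ j - cay (snd p) ^ j))\<^sup>2 = 2 - 2 * Re (q ^ j)" for j
  proof -
    have "(cmod (a - b))\<^sup>2 = (cmod a)\<^sup>2 + (cmod b)\<^sup>2 - 2 * Re (a * cnj b)" for a b :: complex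
      unfolding cmod_power2 by (simp add: power2_eq_square algebra_simps)
    from this[of "cay (fst p) ^ j" "cay (snd p) ^ j"] show ?thesis
      by (simp add: q_def norm_power power_mult_distrib flip: complex_cnj_power)
  qed
  then have "mean_chord N p = 2 - 2 * Re ((\<Sum>j<N. q ^ j) / of_nat N)" if "N > 0" for N
    using that unfolding mean_chord_def
    by (simp add: sum_subtractf sum_distrib_left[symmetric] divide_simps Re_divide_of_nat)
  then have "\<forall>\<^sub>F N in sequentially. 2 - 2 * Re ((\<Sum>j<N. q ^ j) / of_nat N) = mean_chord N p"
    by (intro eventually_sequentiallyI[of 1]) auto
  moreover have "(\<lambda>N. 2 - 2 * Re ((\<Sum>j<N. q ^ j) / of_nat N)) \<longlonglongrightarrow> 2 - 2 * Re 0"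
    by (intro tendsto_intros mean_geometric_tendsto_0 q)
  ultimately show ?thesis
    by (simp add: tendsto_cong)
qed

lemma norm_chord_le: "(cmod (cay x ^ j - cay y ^ j))\<^sup>2 \<le> 4"
proof -
  have "cmod (cay x ^ j - cay y ^ j) \<le> 2"
    using norm_triangle_ineq4[of "cay x ^ j" "cay y ^ j"] by (simp add: norm_power)
  from power_mono[OF this, of 2] show ?thesis by simp
qed

lemma mean_chord_le: "\<bar>mean_chord N p\<bar> \<le> 4"
proof -
  have "(\<Sum>j<N. (cmod (cay (fst p) ^ j - cay (snd p) ^ j))\<^sup>2) \<le> (\<Sum>j<N. 4)"
    by (rule sum_mono) (rule norm_chord_le)
  then show ?thesis
    unfolding mean_chord_def by (cases "N = 0") (auto simp: sum_nonneg divide_le_eq)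
qed

lemma mean_min_tendsto: "(\<lambda>N. (\<Sum>j<N. real (min j n)) / real N) \<longlonglongrightarrow> real n"
proof -
  have eq: "(\<Sum>j<N. real (min j n)) = real n * real N - (\<Sum>j<n. real n - real j)" if "N \<ge> n" for N
    using that
  proof (induction N rule: dec_induct)
    case base
    then show ?case by (simp add: sum_subtractf algebra_simps min_def)
  next
    case (step N)
    then show ?case by (simp add: algebra_simps)
  qed
  have "\<forall>\<^sub>F N in sequentially. real n - (\<Sum>j<n. real n - real j) * (1 / real N) = (\<Sum>j<N. real (min j n)) / real N"
    by (rule eventually_sequentiallyI[of "Suc n"]) (simp add: eq field_simps)
  moreover have "(\<lambda>N. real n - (\<Sum>j<n. real n - real j) * (1 / real N)) \<longlonglongrightarrow> real n - (\<Sum>j<n. real n - real j) * 0"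
    by (intro tendsto_intros lim_1_over_n)
  ultimately show ?thesis by (simp add: tendsto_cong)
qed

text \<open>The means of the chordal kernels are at most four times the singular kernel and converge to twice this kernel. On the other
side the multiplier becomes the mean of \<open>min j n\<close>, which tends to \<open>n\<close>.\<close>

lemma energy_form_cay:
  assumes f: "finite_energy f"
  shows "energy_form f (\<lambda>x. cay x ^ n) = 4 * of_real pi * of_nat n * circ_coeff f (int n)"
proof -
  let ?D = "\<lambda>p. dquot f p * dquot (\<lambda>x. cay x ^ n) p"
  note [measurable] = finite_energyD(2)[OF f]
  have D: "integrable plane ?D"
    by (rule integrable_dquot_mult[OF f finite_energy_cay])
  have "(\<lambda>N. \<integral>p. of_real (mean_chord N p) * ?D p \<partial>plane) \<longlonglongrightarrow> (\<integral>p. of_real 2 * ?D p \<partial>plane)"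
  proof (rule integral_dominated_convergence[where w = "\<lambda>p. 4 * cmod (?D p)"])
    show "AE p in plane. (\<lambda>N. of_real (mean_chord N p) * ?D p) \<longlonglongrightarrow> of_real 2 * ?D p"
      using AE_off_diagonal by eventually_elim (intro tendsto_intros mean_chord_tendsto)
    show "AE p in plane. cmod (of_real (mean_chord N p) * ?D p) \<le> 4 * cmod (?D p)" for N
      using mult_right_mono[OF mean_chord_le] by (auto simp: norm_mult)
    show "integrable plane (\<lambda>p. 4 * cmod (?D p))" using D by auto
    show "(\<lambda>p. of_real (mean_chord N p) * ?D p) \<in> borel_measurable plane" for N
      unfolding mean_chord_def by measurable
  qed measurable
  moreover have "(\<integral>p. of_real (mean_chord N p) * ?D p \<partial>plane)
      = 8 * of_real pi * circ_coeff f (int n) * of_real ((\<Sum>j<N. real (min j n)) / real N)" for N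
  proof -
    have int: "integrable plane (\<lambda>p. of_real ((cmod (cay (fst p) ^ j - cay (snd p) ^ j))\<^sup>2) * ?D p)" for j
    proof -
      have "integrable plane (\<lambda>p. ?D p * of_real ((cmod (cay (fst p) ^ j - cay (snd p) ^ j))\<^sup>2))"
        using norm_chord_le by (intro integrable_mult_bounded[OF D]) (auto simp del: of_real_power)
      then show ?thesis by (simp add: mult.commute)
    qed
    have j: "(\<integral>p. of_real ((cmod (cay (fst p) ^ j - cay (snd p) ^ j))\<^sup>2) * ?D p \<partial>plane)
        = 8 * of_real pi * of_nat (min j n) * circ_coeff f (int n)" for j
      unfolding chord_kernel_form_cay[OF finite_energyD(1)[OF f], symmetric]
      by (rule arg_cong[where f = "integral\<^sup>L plane"])
        (auto simp: chord_kernel_def dquot_def power2_eq_square divide_simps)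
    have "(\<integral>p. of_real (mean_chord N p) * ?D p \<partial>plane)
       = (\<integral>p. (\<Sum>j<N. of_real ((cmod (cay (fst p) ^ j - cay (snd p) ^ j))\<^sup>2) * ?D p) / of_nat N \<partial>plane)"
      by (simp add: mean_chord_def sum_distrib_right[symmetric])
    also have "\<dots> = (\<Sum>j<N. 8 * of_real pi * of_nat (min j n) * circ_coeff f (int n)) / of_nat N"
      using int by (simp only: integral_divide_zero Bochner_Integration.integral_sum j)
    finally show ?thesis
      by (simp add: sum_distrib_left[symmetric] sum_distrib_right[symmetric] mult_ac)
  qed
  moreover have "(\<lambda>N. 8 * of_real pi * circ_coeff f (int n) * of_real ((\<Sum>j<N. real (min j n)) / real N))
      \<longlonglongrightarrow> 8 * of_real pi * circ_coeff f (int n) * of_real (real n)"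
    by (intro tendsto_intros mean_min_tendsto)
  ultimately have "(\<integral>p. of_real 2 * ?D p \<partial>plane) = 8 * of_real pi * circ_coeff f (int n) * of_real (real n)"
    by (simp only:) (rule LIMSEQ_unique)
  then show ?thesis
    unfolding integral_mult_right_zero energy_form_def by simp
qed

section \<open>Uniqueness of Fourier coefficients\<close>

text \<open>Chords have length at most \<open>2\<close>, so for almost every fixed \<open>y\<close> the energy controls the norm of \<open>f - f y\<close>.\<close>

lemma finite_energy_square_integrable:
  assumes f: "finite_energy f"
  shows "integrable lborel (\<lambda>x. (cmod (f x))\<^sup>2 * wt x)"
proof -
  note [measurable] = finite_energyD(2)[OF f]
  have "AE y in lborel. integrable lborel (\<lambda>x. (cmod (dquot f (y, x)))\<^sup>2)"
    using lborel_pair.AE_integrable_fst'[OF finite_energyD(3)[OF f]] by simp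
  moreover have "\<not> (AE y in (lborel :: real measure). False)"
    by (subst AE_iff_measurable[of UNIV]) auto
  ultimately obtain y where y: "integrable lborel (\<lambda>x. (cmod (dquot f (y, x)))\<^sup>2)"
    by (metis (mono_tags, lifting) eventually_mono)
  have bnd: "(cmod (f x - f y))\<^sup>2 * wt x \<le> (cmod (dquot f (y, x)))\<^sup>2 / wt y" for x
  proof (cases "x = y")
    case False
    have "4 * (wt x * wt y * (x - y)\<^sup>2) \<le> 4 * 1"
      using norm_chord_le[of x 1 y] by (simp add: norm_cay_diff mult_ac)
    then have "(cmod (f x - f y))\<^sup>2 * (wt x * wt y * (x - y)\<^sup>2) \<le> (cmod (f x - f y))\<^sup>2 * 1"
      by (intro mult_left_mono) auto
    then show ?thesis
      using wt_pos[of y] False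
      by (simp add: dquot_def norm_divide power_divide divide_simps norm_minus_commute power2_commute mult_ac
          del: of_real_diff)
  qed simp
  show ?thesis
  proof (rule Bochner_Integration.integrable_bound)
    show "integrable lborel (\<lambda>x. 2 * ((cmod (dquot f (y, x)))\<^sup>2 / wt y) + 2 * ((cmod (f y))\<^sup>2 * wt x))" (is "integrable _ ?G")
      using y integrable_wt by auto
    show "AE x in lborel. norm ((cmod (f x))\<^sup>2 * wt x) \<le> norm (?G x)"
    proof (rule AE_I2, goal_cases)
      case (1 x)
      have "(cmod (f x))\<^sup>2 * wt x \<le> (2 * (cmod (f x - f y))\<^sup>2 + 2 * (cmod (f y))\<^sup>2) * wt x"
        using norm_add_square_le[of "f x - f y" "f y"] by (intro mult_right_mono) auto
      also have "\<dots> \<le> 2 * ((cmod (dquot f (y, x)))\<^sup>2 / wt y) + 2 * ((cmod (f y))\<^sup>2 * wt x)"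
        using bnd[of x] by (simp add: algebra_simps)
      finally show ?case
        by simp
    qed
  qed measurable
qed

lemma chord_kernel_total:
  "integrable lborel (chord_kernel j x)" "(LBINT y. chord_kernel j x y) = 4 * pi * real j * wt x"
proof -
  show "integrable lborel (chord_kernel j x)"
    using integrable_Re[OF chord_kernel_apply(1)[OF wt_integrable_const[of 1], of j x]] by simp
  have "complex_of_real (LBINT y. chord_kernel j x y) = of_real (4 * pi * real j * wt x)"
    using chord_kernel_cay[of j x 0] by (simp flip: integral_complex_of_real add: mult_ac)
  then show "(LBINT y. chord_kernel j x y) = 4 * pi * real j * wt x"
    by (simp only: of_real_eq_iff)
qed

text \<open>If all coefficients vanish, the kernel of order \<open>N\<close> annihilates \<open>f\<close>, and integrating \<open>\<bar>f x - f y\<bar>\<^sup>2\<close> against it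
leaves only the diagonal terms \<open>8 pi N \<integral> \<bar>f\<bar>\<^sup>2 wt\<close>. Since chords have length at most \<open>2\<close>, the same integral is at most
four times the energy, whatever \<open>N\<close> is.\<close>

lemma AE_eq_0_if_circ_coeff_eq_0:
  assumes f: "finite_energy f" and zero: "\<And>k. circ_coeff f k = 0"
  shows "AE x in lborel. f x = 0"
proof -
  note [measurable] = finite_energyD(2)[OF f]
  have [measurable]: "(\<lambda>x. cnj (f x)) \<in> borel_measurable borel"
    by (rule measurable_compose[OF _ borel_measurable_continuous_onI[OF continuous_on_cnj]])
      (auto intro: continuous_intros)
  define I where "I = (LBINT x. (cmod (f x))\<^sup>2 * wt x)"
  define E where "E = (\<integral>p. (cmod (dquot f p))\<^sup>2 \<partial>plane)"
  note sq = finite_energy_square_integrable[OF f]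
  \<comment> \<open>the kernel is paired with \<open>cnj f\<close> and \<open>f\<close>, so that the inner integral involves the coefficients of \<open>f\<close>\<close>
  have bound: "8 * pi * real N * I \<le> 4 * E" for N
  proof -
    let ?k = "\<lambda>p. complex_of_real (chord_kernel N (fst p) (snd p))"
    let ?w = "\<lambda>x. f x * complex_of_real (wt x)"
    have w: "integrable lborel ?w"
      using finite_energyD(1)[OF f] by (simp add: wt_integrable_def)
    have int: "integrable plane (\<lambda>p. ?k p * (cnj (f (fst p)) * (f (fst p) - f (snd p))))" (is "integrable _ ?F")
    proof (rule Bochner_Integration.integrable_bound)
      show "integrable plane (\<lambda>p. of_real (4 * (real N)\<^sup>2) * (of_real ((cmod (f (fst p)))\<^sup>2 * wt (fst p)) * of_real (wt (snd p)))
          + of_real (4 * (real N)\<^sup>2) * (of_real (cmod (?w (fst p))) * complex_of_real (cmod (?w (snd p)))))"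
        (is "integrable _ ?G")
        by (intro Bochner_Integration.integrable_add integrable_mult_right integrable_plane_product integrable_of_real
            integrable_norm sq w integrable_wt)
      have "chord_kernel N x y * (cmod (f x) * cmod (f x - f y)) \<le>
          (4 * (real N)\<^sup>2 * wt x * wt y) * (cmod (f x) * (cmod (f x) + cmod (f y)))" for x y
        by (intro mult_mono chord_kernel_le norm_triangle_ineq4 mult_nonneg_nonneg add_nonneg_nonneg) auto
      then have *: "chord_kernel N x y * (cmod (f x) * cmod (f x - f y)) \<le>
          4 * (real N)\<^sup>2 * ((cmod (f x))\<^sup>2 * wt x * wt y) + 4 * (real N)\<^sup>2 * (cmod (f x) * wt x * (cmod (f y) * wt y))" for x y
        by (simp add: algebra_simps power2_eq_square)
      show "AE p in plane. norm (?F p) \<le> norm (?G p)"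
      proof (rule AE_I2, goal_cases)
        case (1 p)
        show ?case
          unfolding of_real_mult[symmetric] of_real_add[symmetric] norm_of_real
          using *[of "fst p" "snd p"] by (auto simp: norm_mult intro: order_trans[OF _ abs_ge_self])
      qed
    qed measurable
    have inner: "(LBINT y. of_real (chord_kernel N x y) * (f x - f y)) = 4 * of_real pi * of_nat N * of_real (wt x) * f x" for x
    proof -
      have "(LBINT y. of_real (chord_kernel N x y) * (f x - f y))
        = (LBINT y. of_real (chord_kernel N x y) * f x - of_real (chord_kernel N x y) * f y)"
        by (simp add: algebra_simps)
      also have "\<dots> = (LBINT y. of_real (chord_kernel N x y) * f x) - (LBINT y. of_real (chord_kernel N x y) * f y)"
        by (intro Bochner_Integration.integral_diff integrable_mult_left integrable_of_real
            chord_kernel_total chord_kernel_apply(1) finite_energyD(1)[OF f])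
      also have "\<dots> = 4 * of_real pi * of_nat N * of_real (wt x) * f x"
        unfolding chord_kernel_apply(2)[OF finite_energyD(1)[OF f]] integral_mult_left_zero integral_complex_of_real
          chord_kernel_total(2) zero by simp
      finally show ?thesis .
    qed
    have sq_eq: "(cnj a - cnj b) * (a - b) = of_real ((cmod (a - b))\<^sup>2)" for a b
      by (simp add: complex_norm_square mult.commute del: of_real_power)
    have "of_real (\<integral>p. (cmod (cay (fst p) ^ N - cay (snd p) ^ N))\<^sup>2 * (cmod (dquot f p))\<^sup>2 \<partial>plane)
        = (\<integral>p. ?k p * ((cnj (f (fst p)) - cnj (f (snd p))) * (f (fst p) - f (snd p))) \<partial>plane)"
      unfolding integral_complex_of_real[symmetric]
      by (rule arg_cong[where f = "integral\<^sup>L plane"])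
        (simp add: sq_eq chord_kernel_def dquot_def norm_divide power_divide del: of_real_diff)
    also have "\<dots> = 2 * (LBINT x. cnj (f x) * (4 * of_real pi * of_nat N * of_real (wt x) * f x))"
      using integral_symmetrize[OF _ int] by (simp add: chord_kernel_commute inner)
    also have "\<dots> = 2 * (LBINT x. of_real (4 * pi * real N * ((cmod (f x))\<^sup>2 * wt x)))"
      by (simp add: complex_norm_square mult_ac del: of_real_power)
    also have "\<dots> = of_real (8 * pi * real N * I)"
      unfolding integral_complex_of_real by (simp add: I_def)
    finally have "(\<integral>p. (cmod (cay (fst p) ^ N - cay (snd p) ^ N))\<^sup>2 * (cmod (dquot f p))\<^sup>2 \<partial>plane) = 8 * pi * real N * I"
      by (simp only: of_real_eq_iff)
    moreover have "(\<integral>p. (cmod (cay (fst p) ^ N - cay (snd p) ^ N))\<^sup>2 * (cmod (dquot f p))\<^sup>2 \<partial>plane) \<le> (\<integral>p. 4 * (cmod (dquot f p))\<^sup>2 \<partial>plane)"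
    proof (rule integral_mono_AE')
      show "integrable plane (\<lambda>p. 4 * (cmod (dquot f p))\<^sup>2)"
        using finite_energyD(3)[OF f] by auto
    qed (auto intro!: mult_right_mono norm_chord_le)
    ultimately show ?thesis by (simp add: E_def)
  qed
  have "I \<le> 0"
  proof (rule ccontr)
    assume "\<not> I \<le> 0"
    then have "I > 0" by simp
    obtain N :: nat where "4 * E / (8 * pi * I) < real N" using reals_Archimedean2 by blast
    then have "4 * E < 8 * pi * real N * I"
      using \<open>I > 0\<close> by (simp add: divide_less_eq mult_ac)
    with bound[of N] show False by simp
  qed
  moreover have "I \<ge> 0" unfolding I_def by (rule integral_nonneg_AE) simp
  ultimately have "I = 0" by simp
  then have "AE x in lborel. (cmod (f x))\<^sup>2 * wt x = 0"
    unfolding I_def using integral_nonneg_eq_0_iff_AE[OF sq] by auto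
  then show ?thesis
    by eventually_elim (use wt_pos in \<open>auto simp: less_le\<close>)
qed

section \<open>Fourier transforms of test functions\<close>

lemma continuous_compact_support:
  fixes g :: "real \<Rightarrow> complex"
  assumes g: "continuous_on UNIV g" and M: "\<And>x. \<bar>x\<bar> > M \<Longrightarrow> g x = 0"
  shows "integrable lborel g" and "\<exists>B. \<forall>x. cmod (g x) \<le> B"
proof -
  have "integrable lborel (\<lambda>x. indicator {-M..M} x *\<^sub>R g x)"
    by (rule borel_integrable_compact) (auto intro: continuous_on_subset[OF g])
  also have "(\<lambda>x. indicator {-M..M} x *\<^sub>R g x) = g"
    using M by (auto simp: fun_eq_iff indicator_def abs_less_iff not_le abs_if)
  finally show "integrable lborel g" .
  have "compact (g ` {-M..M})"
    by (intro compact_continuous_image continuous_on_subset[OF g]) auto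
  then obtain B where B: "\<forall>y\<in>g ` {-M..M}. cmod y \<le> B"
    using compact_imp_bounded bounded_iff by metis
  have "cmod (g x) \<le> max B 0" for x
    using B M[of x] by (cases "\<bar>x\<bar> \<le> M") (auto simp: abs_le_iff le_max_iff_disj)
  then show "\<exists>B. \<forall>x. cmod (g x) \<le> B" by blast
qed

lemma test_function_support:
  assumes "test_function \<phi>"
  shows "\<exists>M>0. \<forall>x. \<bar>x\<bar> > M \<longrightarrow> \<phi> x = 0"
proof -
  have "bounded (closure {x. \<phi> x \<noteq> 0})"
    using assms by (intro compact_imp_bounded) (simp add: test_function_def)
  then have "bounded {x. \<phi> x \<noteq> 0}"
    by (rule bounded_subset[OF _ closure_subset])
  then obtain M where "M > 0" "\<And>x. \<phi> x \<noteq> 0 \<Longrightarrow> \<bar>x\<bar> \<le> M"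
    unfolding bounded_pos by auto
  then show ?thesis by (intro exI[of _ M]) force
qed

lemma test_function_derivs:
  assumes "test_function \<phi>"
  shows "\<exists>D M. D 0 = \<phi> \<and> (\<forall>n x. (D n has_vector_derivative D (Suc n) x) (at x)) \<and>
    (\<forall>n. continuous_on UNIV (D n)) \<and> M > 0 \<and> (\<forall>n x. \<bar>x\<bar> > M \<longrightarrow> D n x = 0)"
proof -
  obtain D where D: "D 0 = \<phi>" "\<And>n x. (D n has_vector_derivative D (Suc n) x) (at x)"
    using assms by (auto simp: test_function_def smooth_def)
  obtain M where M: "M > 0" "\<forall>x. \<bar>x\<bar> > M \<longrightarrow> \<phi> x = 0"
    using test_function_support[OF assms] by blast
  have zero: "D n x = 0" if "\<bar>x\<bar> > M" for n x
    using that
  proof (induction n arbitrary: x)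
    case 0
    then show ?case unfolding D(1) using M(2) by blast
  next
    case (Suc n)
    let ?U = "{x::real. \<bar>x\<bar> > M}"
    have "open ?U" by (intro open_Collect_less continuous_intros)
    have "((\<lambda>_. 0) has_vector_derivative D (Suc n) x) (at x)"
      by (rule has_vector_derivative_transform_within_open[OF D(2) \<open>open ?U\<close>]) (use Suc in auto)
    from vector_derivative_unique_at[OF this has_vector_derivative_const] show ?case .
  qed
  have "continuous_on UNIV (D n)" for n
    using has_vector_derivative_continuous[OF D(2)[of n]] by (simp add: continuous_at_imp_continuous_on)
  with D M(1) zero show ?thesis by (intro exI[of _ D] exI[of _ M]) simp
qed

lemma test_function_basics:
  assumes "test_function \<phi>"
  shows test_function_continuous: "continuous_on UNIV \<phi>"
    and test_function_integrable: "integrable lborel \<phi>"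
    and test_function_bounded: "\<exists>B. \<forall>x. cmod (\<phi> x) \<le> B"
proof -
  obtain D where D: "D 0 = \<phi>" "\<And>n x. (D n has_vector_derivative D (Suc n) x) (at x)"
    using assms by (auto simp: test_function_def smooth_def)
  show c: "continuous_on UNIV \<phi>"
    using has_vector_derivative_continuous[OF D(2)[of 0]] by (simp add: D(1) continuous_at_imp_continuous_on)
  obtain M where z: "\<bar>x\<bar> > M \<Longrightarrow> \<phi> x = 0" for x
    using test_function_support[OF assms] by blast
  show "integrable lborel \<phi>" "\<exists>B. \<forall>x. cmod (\<phi> x) \<le> B"
    by (rule continuous_compact_support[OF c z], assumption)+
qed

lemma test_function_measurable [measurable_dest]: "test_function \<phi> \<Longrightarrow> \<phi> \<in> borel_measurable borel"
  by (rule borel_measurable_continuous_onI) (rule test_function_continuous)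

lemma integral_lebesgue_eq_lborel:
  fixes f :: "real \<Rightarrow> 'b::{banach, second_countable_topology}"
  assumes "f \<in> borel_measurable borel"
  shows "integral\<^sup>L lebesgue f = integral\<^sup>L lborel f"
  by (rule integral_completion) (use assms in simp)

lemma fourier_lborel:
  assumes [measurable]: "\<phi> \<in> borel_measurable borel"
  shows "fourier \<phi> \<xi> = (LBINT x. exp (- (\<i> * of_real (\<xi> * x))) * \<phi> x)"
  unfolding fourier_def by (rule integral_lebesgue_eq_lborel) measurable

lemma norm_exp_ii [simp]:
  "cmod (exp (\<i> * of_real a)) = 1" "cmod (exp (- (\<i> * of_real a))) = 1"
  by (simp_all add: norm_exp_eq_Re)

lemma norm_exp_ii_mult [simp]:
  "cmod (exp (\<i> * (of_real a * of_real b))) = 1" "cmod (exp (- (\<i> * (of_real a * of_real b)))) = 1"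
  by (simp_all add: norm_exp_eq_Re)

lemma integrable_exp_mult:
  fixes \<phi> :: "real \<Rightarrow> complex"
  assumes "integrable lborel \<phi>"
  shows "integrable lborel (\<lambda>x. exp (- (\<i> * of_real (\<xi> * x))) * \<phi> x)"
  using integrable_mult_bounded[OF assms, of "\<lambda>x. exp (- (\<i> * of_real (\<xi> * x)))" 1]
  by (simp add: mult.commute)

lemma fourier_measurable:
  assumes [measurable]: "\<phi> \<in> borel_measurable borel"
  shows "fourier \<phi> \<in> borel_measurable borel"
  unfolding fourier_lborel[OF assms, abs_def] by measurable

lemma norm_fourier_le:
  assumes "integrable lborel \<phi>"
  shows "cmod (fourier \<phi> \<xi>) \<le> (LBINT x. cmod (\<phi> x))"
proof -
  have "cmod (fourier \<phi> \<xi>) \<le> (LBINT x. cmod (exp (- (\<i> * of_real (\<xi> * x))) * \<phi> x))"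
    using assms by (subst fourier_lborel) (auto intro!: integral_norm_bound)
  then show ?thesis by (simp add: norm_mult)
qed

lemma fourier_deriv:
  fixes F F' :: "real \<Rightarrow> complex"
  assumes F: "\<And>x. (F has_vector_derivative F' x) (at x)" and cont: "continuous_on UNIV F'"
    and M: "\<And>x. \<bar>x\<bar> > M \<Longrightarrow> F x = 0" "\<And>x. \<bar>x\<bar> > M \<Longrightarrow> F' x = 0"
  shows "fourier F' \<xi> = \<i> * of_real \<xi> * fourier F \<xi>"
proof -
  let ?e = "\<lambda>x. exp (- (\<i> * of_real (\<xi> * x)))"
  have contF: "continuous_on UNIV F"
    by (meson F continuous_at_imp_continuous_on has_vector_derivative_continuous)
  have int: "integrable lborel F'" "integrable lborel F"
    by (rule continuous_compact_support(1)[OF cont M(2)], assumption)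
      (rule continuous_compact_support(1)[OF contF M(1)], assumption)
  note int' = int[THEN integrable_exp_mult, of \<xi>]
  have e: "(?e has_vector_derivative (- (\<i> * of_real \<xi>) * ?e x)) (at x)" for x
  proof -
    have "((\<lambda>z. exp (- (\<i> * (of_real \<xi> * z)))) has_field_derivative (- (\<i> * of_real \<xi>) * ?e x)) (at (of_real x))"
      by (auto intro!: derivative_eq_intros)
    from has_vector_derivative_real_field[OF this] show ?thesis by simp
  qed
  have "(LBINT x. ?e x * F' x + - (\<i> * of_real \<xi>) * ?e x * F x) = 0 - 0"
  proof (rule integral_deriv_line)
    show "((\<lambda>x. ?e x * F x) has_vector_derivative (?e x * F' x + - (\<i> * of_real \<xi>) * ?e x * F x)) (at x)" for x
      by (rule has_vector_derivative_mult[OF e F])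
    show "continuous_on UNIV (\<lambda>x. ?e x * F' x + - (\<i> * of_real \<xi>) * ?e x * F x)"
      by (intro continuous_intros cont contF)
    show "integrable lborel (\<lambda>x. ?e x * F' x + - (\<i> * of_real \<xi>) * ?e x * F x)"
      unfolding mult.assoc by (intro Bochner_Integration.integrable_add integrable_mult_right int')
    show "((\<lambda>x. ?e x * F x) \<longlongrightarrow> 0) at_top"
      by (rule tendsto_eventually, rule eventually_mono[OF eventually_gt_at_top[of "\<bar>M\<bar>"]]) (use M in auto)
    show "((\<lambda>x. ?e x * F x) \<longlongrightarrow> 0) at_bot"
      by (rule tendsto_eventually, rule eventually_mono[OF eventually_gt_at_bot[of "- \<bar>M\<bar>"]]) (use M in auto)
  qed
  also have "(LBINT x. ?e x * F' x + - (\<i> * of_real \<xi>) * ?e x * F x)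
      = (LBINT x. ?e x * F' x) + - (\<i> * of_real \<xi>) * (LBINT x. ?e x * F x)"
    unfolding mult.assoc
    by (subst Bochner_Integration.integral_add) (intro int' integrable_mult_right integral_mult_right_zero | simp)+
  finally show ?thesis
    using int by (simp add: fourier_lborel)
qed

lemma integrable_if_le_wt:
  fixes g :: "real \<Rightarrow> complex"
  assumes "g \<in> borel_measurable borel" "\<And>x. cmod (g x) \<le> C * wt x"
  shows "integrable lborel g"
proof (rule Bochner_Integration.integrable_bound)
  show "integrable lborel (\<lambda>x. C * wt x)" using integrable_wt by auto
  show "AE x in lborel. norm (g x) \<le> norm (C * wt x)"
    using assms(2) by (auto intro: order_trans[OF _ abs_ge_self])
qed (use assms in auto)

text \<open>The third derivative is integrable, so \<open>\<xi> ^ 3\<close> times the transform is bounded; together with the lower orders this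
gives a majorant \<open>C * wt \<xi>\<close> even after multiplication by \<open>\<xi>\<close>.\<close>

lemma test_function_fourier_decay:
  assumes "test_function \<phi>"
  shows "integrable lborel (fourier \<phi>)" "integrable lborel (\<lambda>\<xi>. of_real \<bar>\<xi>\<bar> * fourier \<phi> \<xi>)"
proof -
  obtain D M where D: "D 0 = \<phi>" "\<forall>n x. (D n has_vector_derivative D (Suc n) x) (at x)"
    "\<forall>n. continuous_on UNIV (D n)" "M > 0" "\<forall>n x. \<bar>x\<bar> > M \<longrightarrow> D n x = 0"
    using test_function_derivs[OF assms] by (elim exE conjE)
  note D = D(1) D(2-)[rule_format]
  note [measurable] = fourier_measurable[OF test_function_measurable[OF assms]]
  define C where "C n = (LBINT x. cmod (D n x))" for n
  have pow: "fourier (D n) \<xi> = (\<i> * of_real \<xi>) ^ n * fourier \<phi> \<xi>" for n \<xi>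
    by (induction n) (simp_all add: D(1) fourier_deriv[OF D(2,3,5,5)] mult_ac)
  have bound: "\<bar>\<xi>\<bar> ^ n * cmod (fourier \<phi> \<xi>) \<le> C n" for n \<xi>
    using norm_fourier_le[of "D n" \<xi>] continuous_compact_support(1)[OF D(3,5)]
    by (simp add: pow C_def norm_mult norm_power)
  have wt: "t \<le> (C n + C (Suc (Suc n))) * wt \<xi>" if "t = \<bar>\<xi>\<bar> ^ n * cmod (fourier \<phi> \<xi>)" for n t \<xi>
    using bound[of \<xi> n] bound[of \<xi> "Suc (Suc n)"] one_plus_square_pos[of \<xi>] that
    by (simp add: wt_def le_divide_eq algebra_simps power2_eq_square abs_if split: if_splits)
  show "integrable lborel (fourier \<phi>)"
    by (rule integrable_if_le_wt[OF _ wt[of _ _ 0]]) auto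
  show "integrable lborel (\<lambda>\<xi>. of_real \<bar>\<xi>\<bar> * fourier \<phi> \<xi>)"
    by (rule integrable_if_le_wt[OF _ wt[of _ _ 1]]) (auto simp: norm_mult)
qed

section \<open>The Poisson semigroup\<close>

lemma exp_abs_integrable:
  assumes "s > 0"
  shows "integrable lborel (\<lambda>\<xi>. complex_of_real (exp (- (s * \<bar>\<xi>\<bar>))))"
proof (rule integrable_if_le_wt)
  fix \<xi> :: real
  have "1 + \<xi>\<^sup>2 \<le> (1 + 2 / s\<^sup>2) * (1 + (s * \<bar>\<xi>\<bar>)\<^sup>2 / 2)"
  proof -
    have "(1 + 2 / s\<^sup>2) * (1 + (s * \<bar>\<xi>\<bar>)\<^sup>2 / 2) = 1 + \<xi>\<^sup>2 + (2 / s\<^sup>2 + s\<^sup>2 * \<xi>\<^sup>2 / 2)"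
      using assms by (simp add: field_simps)
    moreover have "0 \<le> 2 / s\<^sup>2 + s\<^sup>2 * \<xi>\<^sup>2 / 2" by simp
    ultimately show ?thesis by linarith
  qed
  also have "\<dots> \<le> (1 + 2 / s\<^sup>2) * exp (s * \<bar>\<xi>\<bar>)"
    using exp_lower_Taylor_quadratic[of "s * \<bar>\<xi>\<bar>"] assms
    by (intro mult_left_mono) (auto intro: order_trans[rotated])
  finally have "1 + \<xi>\<^sup>2 \<le> (1 + 2 / s\<^sup>2) * exp (s * \<bar>\<xi>\<bar>)" .
  moreover have "1 / E \<le> K / W" if "W \<le> K * E" "E > 0" "W > 0" for E K W :: real
    using that by (simp add: field_simps)
  ultimately have "1 / exp (s * \<bar>\<xi>\<bar>) \<le> (1 + 2 / s\<^sup>2) / (1 + \<xi>\<^sup>2)"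
    using one_plus_square_pos[of \<xi>] by (metis exp_gt_zero)
  then show "cmod (complex_of_real (exp (- (s * \<bar>\<xi>\<bar>)))) \<le> (1 + 2 / s\<^sup>2) * wt \<xi>"
    unfolding norm_of_real by (simp add: wt_def exp_minus inverse_eq_divide)
qed measurable

lemma integral_exp_half_line:
  fixes c :: complex
  assumes c: "Re c > 0" and int: "integrable lborel (\<lambda>x::real. indicator {0..} x *\<^sub>R exp (- c * of_real x))"
  shows "(LBINT x. indicator {0..} x *\<^sub>R exp (- c * of_real x)) = 1 / c"
proof (rule LIMSEQ_unique)
  let ?f = "\<lambda>x. indicator {0..} x *\<^sub>R exp (- c * of_real x)"
  let ?g = "\<lambda>n::nat. \<lambda>x. indicator {0 .. real n} x *\<^sub>R exp (- c * of_real x)"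
  have "c \<noteq> 0" using c by auto
  show "(\<lambda>n. LBINT x. ?g n x) \<longlonglongrightarrow> (LBINT x. ?f x)"
  proof (rule integral_dominated_convergence[where w = "\<lambda>x. norm (?f x)"])
    show "AE x in lborel. (\<lambda>n. ?g n x) \<longlonglongrightarrow> ?f x"
    proof (rule AE_I2, rule tendsto_eventually)
      fix x :: real
      obtain N :: nat where "\<bar>x\<bar> \<le> real N" using real_arch_simple by blast
      then show "\<forall>\<^sub>F n in sequentially. ?g n x = ?f x"
        by (intro eventually_sequentiallyI[of N]) (auto simp: indicator_def)
    qed
    show "integrable lborel (\<lambda>x. norm (?f x))" using int by (rule integrable_norm)
    show "AE x in lborel. norm (?g n x) \<le> norm (?f x)" for n
      by (auto simp: indicator_def)
  qed auto
  have "(LBINT x. ?g n x) = - exp (- c * of_real (real n)) / c - - exp (- c * of_real 0) / c" for n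
  proof (rule integral_FTC_Icc)
    show "((\<lambda>x. - exp (- c * of_real x) / c) has_vector_derivative exp (- c * of_real x)) (at x within {0..real n})" for x
    proof (rule has_vector_derivative_real_field)
      show "((\<lambda>z. - exp (- c * z) / c) has_field_derivative exp (- c * of_real x)) (at (of_real x))"
        using \<open>c \<noteq> 0\<close> by (auto intro!: derivative_eq_intros)
    qed
  qed (auto intro!: continuous_intros)
  then have "(LBINT x. ?g n x) = 1 / c - exp (- c) ^ n / c" for n
    by (simp add: exp_of_nat_mult[symmetric] mult.commute)
  moreover have "(\<lambda>n. 1 / c - exp (- c) ^ n / c) \<longlonglongrightarrow> 1 / c - 0 / c"
    using c by (intro tendsto_intros LIMSEQ_power_zero) (auto simp: norm_exp_eq_Re \<open>c \<noteq> 0\<close>)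
  ultimately show "(\<lambda>n. LBINT x. ?g n x) \<longlonglongrightarrow> 1 / c" by simp
qed

lemma integral_exp_abs:
  assumes s: "s > 0"
  shows "(LBINT \<xi>. exp (\<i> * of_real (\<xi> * t)) * of_real (exp (- (s * \<bar>\<xi>\<bar>)))) = of_real (2 * s / (s\<^sup>2 + t\<^sup>2))"
proof -
  define g where "g t \<xi> = exp (\<i> * of_real (\<xi> * t)) * complex_of_real (exp (- (s * \<bar>\<xi>\<bar>)))" for t \<xi> :: real
  have int: "integrable lborel (g t)" for t
    using integrable_mult_bounded[OF exp_abs_integrable[OF s], of "\<lambda>\<xi>. exp (\<i> * of_real (\<xi> * t))" 1]
    by (simp add: g_def[abs_def] mult.commute)
  have half_eq: "indicator {0..} \<xi> *\<^sub>R g t \<xi> = indicator {0..} \<xi> *\<^sub>R exp (- (of_real s - \<i> * of_real t) * of_real \<xi>)" for t \<xi> :: real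
    by (auto simp: indicator_def g_def exp_of_real[symmetric] mult_exp_exp algebra_simps)
  have half_int: "integrable lborel (\<lambda>\<xi>. indicator {0..} \<xi> *\<^sub>R g t \<xi>)" for t
    by (rule integrable_mult_indicator[OF _ int]) simp
  have half: "(LBINT \<xi>. indicator {0..} \<xi> *\<^sub>R g t \<xi>) = 1 / (of_real s - \<i> * of_real t)" for t
    using integral_exp_half_line[of "of_real s - \<i> * of_real t"] half_int[of t] s unfolding half_eq by simp
  have "(LBINT \<xi>. g t \<xi>) = (LBINT \<xi>. indicator {0..} \<xi> *\<^sub>R g t \<xi> + indicator {..<0} \<xi> *\<^sub>R g t \<xi>)"
    by (rule arg_cong[where f = "integral\<^sup>L lborel"]) (auto simp: indicator_def)
  also have "\<dots> = (LBINT \<xi>. indicator {0..} \<xi> *\<^sub>R g t \<xi>) + (LBINT \<xi>. indicator {..<0} \<xi> *\<^sub>R g t \<xi>)"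
    by (intro Bochner_Integration.integral_add half_int integrable_mult_indicator[OF _ int]) simp
  also have "(LBINT \<xi>. indicator {..<0} \<xi> *\<^sub>R g t \<xi>) = (LBINT \<xi>. indicator {..<0} (0 + (-1) * \<xi>) *\<^sub>R g t (0 + (-1) * \<xi>))"
    using lborel_integral_real_affine[of "-1" "\<lambda>\<xi>. indicator {..<0} \<xi> *\<^sub>R g t \<xi>" 0] by simp
  also have "\<dots> = (LBINT \<xi>. indicator {0..} \<xi> *\<^sub>R g (- t) \<xi>)"
  proof (rule integral_cong_AE)
    show "AE \<xi> in lborel. indicator {..<0} (0 + (-1) * \<xi>) *\<^sub>R g t (0 + (-1) * \<xi>) = indicator {0..} \<xi> *\<^sub>R g (- t) \<xi>"
      using AE_lborel_singleton[of 0] by eventually_elim (auto simp: indicator_def g_def)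
  qed (auto simp: g_def)
  also have "(LBINT \<xi>. indicator {0..} \<xi> *\<^sub>R g t \<xi>) + \<dots> = 1 / (of_real s - \<i> * of_real t) + 1 / (of_real s + \<i> * of_real t)"
    unfolding half by simp
  also have "\<dots> = of_real (2 * s / (s\<^sup>2 + t\<^sup>2))"
  proof -
    have "s\<^sup>2 + t\<^sup>2 > 0" using s by (simp add: add_pos_nonneg)
    moreover have "complex_of_real s - \<i> * of_real t \<noteq> 0" "complex_of_real s + \<i> * of_real t \<noteq> 0"
      using s by (auto simp: complex_eq_iff)
    moreover have "(complex_of_real s - \<i> * of_real t) * (of_real s + \<i> * of_real t) = of_real (s\<^sup>2 + t\<^sup>2)"
      by (simp add: power2_eq_square algebra_simps)
    ultimately show ?thesis by (simp add: add_frac_eq)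
  qed
  finally show ?thesis by (simp add: g_def)
qed

text \<open>The convolution kernel of \<open>exp (- s |\<nabla>|)\<close>.\<close>

definition poisson :: "real \<Rightarrow> real \<Rightarrow> real" where
  "poisson s t = s / (pi * (s\<^sup>2 + t\<^sup>2))"

lemma poisson_measurable [measurable]: "poisson s \<in> borel_measurable borel"
  unfolding poisson_def[abs_def] by measurable

lemma poisson_scale: "s > 0 \<Longrightarrow> s * poisson s (s * t) = wt t / pi"
proof -
  assume s: "s > 0"
  have "s\<^sup>2 + (s * t)\<^sup>2 = s * s * (1 + t\<^sup>2)"
    by (simp add: power2_eq_square algebra_simps)
  with s show ?thesis
    by (simp add: poisson_def wt_def)
qed

lemma poisson_minus [simp]: "poisson s (- t) = poisson s t"
  by (simp add: poisson_def)

lemma poisson_convolution_scale: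
  fixes \<phi> :: "real \<Rightarrow> complex"
  assumes s: "s > 0"
  shows "(LBINT y. of_real (poisson s (x - y)) * \<phi> y) = (LBINT t. of_real (wt t / pi) * \<phi> (x + s * t))"
proof -
  have "(LBINT y. of_real (poisson s (x - y)) * \<phi> y)
      = \<bar>s\<bar> *\<^sub>R (LBINT t. of_real (poisson s (x - (x + s * t))) * \<phi> (x + s * t))"
    using s by (intro lborel_integral_real_affine) auto
  also have "\<dots> = (LBINT t. of_real (s * poisson s (s * t)) * \<phi> (x + s * t))"
    using s by (simp add: scaleR_conv_of_real mult.assoc del: of_real_mult flip: integral_mult_right_zero)
      (simp add: mult.assoc)
  finally show ?thesis using s by (simp add: poisson_scale del: of_real_mult of_real_divide)
qed

lemma poisson_integrable_line:
  assumes s: "s > 0"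
  shows "integrable lborel (\<lambda>y. complex_of_real (poisson s (x - y)))" "(LBINT y. complex_of_real (poisson s (x - y))) = 1"
proof -
  show 1: "(LBINT y. complex_of_real (poisson s (x - y))) = 1"
    using poisson_convolution_scale[OF s, of x "\<lambda>_. 1"] by (simp add: integral_wt flip: of_real_divide)
  show "integrable lborel (\<lambda>y. complex_of_real (poisson s (x - y)))"
  proof (rule ccontr)
    assume "\<not> ?thesis"
    from not_integrable_integral_eq[OF this] 1 show False by simp
  qed
qed

text \<open>The factor \<open>exp (- s \<bar>\<xi>\<bar>)\<close> makes the double integral absolutely convergent, so that the order of integration can be
exchanged.\<close>

lemma poisson_semigroup:
  assumes \<phi>: "test_function \<phi>" and s: "s > 0"
  shows "(LBINT \<xi>. exp (\<i> * of_real (\<xi> * x)) * (of_real (exp (- (s * \<bar>\<xi>\<bar>))) * fourier \<phi> \<xi>))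
       = of_real (2 * pi) * (LBINT y. of_real (poisson s (x - y)) * \<phi> y)"
proof -
  note [measurable] = test_function_measurable[OF \<phi>]
  let ?h = "\<lambda>\<xi> y. exp (\<i> * of_real (\<xi> * (x - y))) * (of_real (exp (- (s * \<bar>\<xi>\<bar>))) * \<phi> y)"
  have "integrable plane (\<lambda>p. complex_of_real (exp (- (s * \<bar>fst p\<bar>))) * \<phi> (snd p))"
    by (intro integrable_plane_product exp_abs_integrable s test_function_integrable \<phi>)
  from integrable_mult_bounded[OF this, of "\<lambda>p. exp (\<i> * of_real (fst p * (x - snd p)))" 1]
  have int: "integrable plane (\<lambda>(\<xi>, y). ?h \<xi> y)"
    by (simp add: mult.commute case_prod_beta' norm_exp_eq_Re)
  have "(LBINT \<xi>. exp (\<i> * of_real (\<xi> * x)) * (of_real (exp (- (s * \<bar>\<xi>\<bar>))) * fourier \<phi> \<xi>))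
      = (LBINT \<xi>. (LBINT y. ?h \<xi> y))"
  proof (rule arg_cong[where f = "integral\<^sup>L lborel"], rule ext)
    fix \<xi>
    show "exp (\<i> * of_real (\<xi> * x)) * (of_real (exp (- (s * \<bar>\<xi>\<bar>))) * fourier \<phi> \<xi>) = (LBINT y. ?h \<xi> y)"
      by (simp add: fourier_lborel right_diff_distrib exp_diff exp_minus field_simps
          flip: integral_mult_right_zero)
  qed
  also have "\<dots> = (LBINT y. (LBINT \<xi>. ?h \<xi> y))"
    by (rule lborel_pair.Fubini_integral[OF int, symmetric])
  also have "(\<lambda>y. LBINT \<xi>. ?h \<xi> y) = (\<lambda>y. of_real (2 * pi) * (of_real (poisson s (x - y)) * \<phi> y))"
  proof
    fix y
    have "(LBINT \<xi>. ?h \<xi> y) = (LBINT \<xi>. exp (\<i> * of_real (\<xi> * (x - y))) * of_real (exp (- (s * \<bar>\<xi>\<bar>))) * \<phi> y)"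
      by (simp add: mult.assoc)
    also have "\<dots> = of_real (2 * s / (s\<^sup>2 + (x - y)\<^sup>2)) * \<phi> y"
      unfolding integral_mult_left_zero integral_exp_abs[OF s] ..
    finally show "(LBINT \<xi>. ?h \<xi> y) = of_real (2 * pi) * (of_real (poisson s (x - y)) * \<phi> y)"
      by (simp add: poisson_def)
  qed
  finally show ?thesis by (simp only: integral_mult_right_zero)
qed

lemma one_over_Suc_tendsto_0: "(\<lambda>n. 1 / real (Suc n)) \<longlonglongrightarrow> 0"
  using LIMSEQ_Suc[OF lim_1_over_n] by simp

lemma poisson_approximate_identity:
  assumes \<phi>: "test_function \<phi>"
  shows "(\<lambda>n. LBINT y. of_real (poisson (1 / real (Suc n)) (x - y)) * \<phi> y) \<longlonglongrightarrow> \<phi> x"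
proof -
  note [measurable] = test_function_measurable[OF \<phi>]
  obtain B where B: "\<And>x. cmod (\<phi> x) \<le> B" using test_function_bounded[OF \<phi>] by blast
  have "(\<lambda>n. LBINT t. of_real (wt t / pi) * \<phi> (x + 1 / real (Suc n) * t)) \<longlonglongrightarrow> (LBINT t. of_real (wt t / pi) * \<phi> x)"
  proof (rule integral_dominated_convergence[where w = "\<lambda>t. wt t / pi * B"])
    show "AE t in lborel. (\<lambda>n. of_real (wt t / pi) * \<phi> (x + 1 / real (Suc n) * t)) \<longlonglongrightarrow> of_real (wt t / pi) * \<phi> x"
    proof (rule AE_I2, goal_cases)
      case (1 t)
      have "(\<lambda>n. x + 1 / real (Suc n) * t) \<longlonglongrightarrow> x + 0 * t"
        by (intro tendsto_intros one_over_Suc_tendsto_0)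
      then have "(\<lambda>n. \<phi> (x + 1 / real (Suc n) * t)) \<longlonglongrightarrow> \<phi> x"
        using continuous_on_tendsto_compose[OF test_function_continuous[OF \<phi>]] by simp
      then show ?case
        by (intro tendsto_intros)
    qed
    show "AE t in lborel. norm (of_real (wt t / pi) * \<phi> (x + 1 / real (Suc n) * t)) \<le> wt t / pi * B" for n
      by (rule AE_I2) (simp add: norm_mult norm_divide B divide_right_mono mult_left_mono)
  qed (use integrable_wt in auto)
  also have "(LBINT t. of_real (wt t / pi) * \<phi> x) = \<phi> x"
    unfolding integral_mult_left_zero integral_complex_of_real by (simp add: integral_wt)
  finally show ?thesis by (simp add: poisson_convolution_scale)
qed

text \<open>Both sides of the formula for the Poisson semigroup converge as \<open>s\<close> tends to \<open>0\<close>.\<close>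

lemma fourier_inversion:
  assumes \<phi>: "test_function \<phi>"
  shows "(LBINT \<xi>. exp (\<i> * of_real (\<xi> * x)) * fourier \<phi> \<xi>) = of_real (2 * pi) * \<phi> x"
proof (rule LIMSEQ_unique)
  note [measurable] = fourier_measurable[OF test_function_measurable[OF \<phi>]]
  let ?g = "\<lambda>n \<xi>. exp (\<i> * of_real (\<xi> * x)) * (of_real (exp (- (1 / real (Suc n) * \<bar>\<xi>\<bar>))) * fourier \<phi> \<xi>)"
  show "(\<lambda>n. LBINT \<xi>. ?g n \<xi>) \<longlonglongrightarrow> (LBINT \<xi>. exp (\<i> * of_real (\<xi> * x)) * fourier \<phi> \<xi>)"
  proof (rule integral_dominated_convergence[where w = "\<lambda>\<xi>. cmod (fourier \<phi> \<xi>)"])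
    show "AE \<xi> in lborel. (\<lambda>n. ?g n \<xi>) \<longlonglongrightarrow> exp (\<i> * of_real (\<xi> * x)) * fourier \<phi> \<xi>"
    proof (rule AE_I2, goal_cases)
      case (1 \<xi>)
      have "(\<lambda>n. ?g n \<xi>) \<longlonglongrightarrow> exp (\<i> * of_real (\<xi> * x)) * (of_real (exp (- (0 * \<bar>\<xi>\<bar>))) * fourier \<phi> \<xi>)"
        by (intro tendsto_intros one_over_Suc_tendsto_0)
      then show ?case by simp
    qed
    show "AE \<xi> in lborel. norm (?g n \<xi>) \<le> cmod (fourier \<phi> \<xi>)" for n
      by (rule AE_I2) (simp add: norm_mult mult_left_le_one_le)
  qed (use test_function_fourier_decay(1)[OF \<phi>] in auto)
  have "(\<lambda>n. of_real (2 * pi) * (LBINT y. of_real (poisson (1 / real (Suc n)) (x - y)) * \<phi> y)) \<longlonglongrightarrow> of_real (2 * pi) * \<phi> x"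
    by (intro tendsto_intros poisson_approximate_identity \<phi>)
  then show "(\<lambda>n. LBINT \<xi>. ?g n \<xi>) \<longlonglongrightarrow> of_real (2 * pi) * \<phi> x"
    by (subst poisson_semigroup[OF \<phi>]) auto
qed

text \<open>The difference quotient \<open>(\<phi> - exp (- s |\<nabla>|) \<phi>) / s\<close>, written with the kernel so that it applies to differences of \<open>\<phi>\<close>
(the Poisson kernel has integral \<open>1\<close>).\<close>

definition pquot :: "(real \<Rightarrow> complex) \<Rightarrow> real \<Rightarrow> real \<Rightarrow> complex" where
  "pquot \<phi> s x = (LBINT y. of_real (poisson s (x - y) / s) * (\<phi> x - \<phi> y))"

lemma pquot_fourier:
  assumes \<phi>: "test_function \<phi>" and s: "s > 0"
  shows "pquot \<phi> s x = of_real (1 / (2 * pi)) *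
    (LBINT \<xi>. exp (\<i> * of_real (\<xi> * x)) * (of_real ((1 - exp (- (s * \<bar>\<xi>\<bar>))) / s) * fourier \<phi> \<xi>))"
proof -
  note [measurable] = fourier_measurable[OF test_function_measurable[OF \<phi>]] test_function_measurable[OF \<phi>]
  obtain B where B: "\<And>x. cmod (\<phi> x) \<le> B" using test_function_bounded[OF \<phi>] by blast
  let ?P = "\<integral>y. of_real (poisson s (x - y)) * \<phi> y \<partial>lborel"
  have "pquot \<phi> s x = (LBINT y. of_real (1 / s) * (of_real (poisson s (x - y)) * \<phi> x - of_real (poisson s (x - y)) * \<phi> y))"
    by (simp add: pquot_def algebra_simps diff_divide_distrib)
  also have "\<dots> = of_real (1 / s) * (\<phi> x - ?P)"
  proof -
    have "(LBINT y. of_real (poisson s (x - y)) * \<phi> x) = \<phi> x"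
      by (simp only: integral_mult_left_zero poisson_integrable_line(2)[OF s] mult_1_left)
    then show ?thesis
      unfolding integral_mult_right_zero
      by (subst Bochner_Integration.integral_diff)
        (auto simp: B intro!: integrable_mult_bounded[of _ _ _ B] poisson_integrable_line(1)[OF s]
          simp del: integral_mult_left_zero)
  qed
  finally have 1: "pquot \<phi> s x = of_real (1 / s) * (\<phi> x - ?P)" .
  let ?e = "\<lambda>\<xi>. exp (\<i> * of_real (\<xi> * x))"
  have int: "integrable lborel (\<lambda>\<xi>. ?e \<xi> * fourier \<phi> \<xi>)"
    using integrable_mult_bounded[OF test_function_fourier_decay(1)[OF \<phi>], of ?e 1] by (simp add: mult.commute)
  have int': "integrable lborel (\<lambda>\<xi>. ?e \<xi> * (of_real (exp (- (s * \<bar>\<xi>\<bar>))) * fourier \<phi> \<xi>))"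
    using integrable_mult_bounded[OF int, of "\<lambda>\<xi>. of_real (exp (- (s * \<bar>\<xi>\<bar>)))" 1] s by (simp add: mult_ac)
  have "(LBINT \<xi>. ?e \<xi> * (of_real ((1 - exp (- (s * \<bar>\<xi>\<bar>))) / s) * fourier \<phi> \<xi>))
      = (LBINT \<xi>. of_real (1 / s) * (?e \<xi> * fourier \<phi> \<xi> - ?e \<xi> * (of_real (exp (- (s * \<bar>\<xi>\<bar>))) * fourier \<phi> \<xi>)))"
    by (simp add: algebra_simps diff_divide_distrib)
  also have "\<dots> = of_real (1 / s) * (of_real (2 * pi) * \<phi> x - of_real (2 * pi) * ?P)"
    unfolding integral_mult_right_zero
    by (subst Bochner_Integration.integral_diff[OF int int'])
      (simp only: fourier_inversion[OF \<phi>] poisson_semigroup[OF \<phi> s])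
  finally show ?thesis
    unfolding 1 using s by (simp add: right_diff_distrib)
qed

lemma abs_nabla_lborel:
  assumes \<phi>: "test_function \<phi>"
  shows "abs_nabla \<phi> x = of_real (1 / (2 * pi)) * (LBINT \<xi>. exp (\<i> * of_real (\<xi> * x)) * (of_real \<bar>\<xi>\<bar> * fourier \<phi> \<xi>))"
proof -
  note [measurable] = fourier_measurable[OF test_function_measurable[OF \<phi>]]
  show ?thesis
    unfolding abs_nabla_def by (subst integral_lebesgue_eq_lborel) auto
qed

lemma one_minus_exp_le:
  fixes a s :: real
  assumes "s > 0" "a \<ge> 0"
  shows "\<bar>(1 - exp (- (s * a))) / s\<bar> \<le> a"
proof -
  have "exp (- (s * a)) \<le> 1" using assms by simp
  moreover have "1 - exp (- (s * a)) \<le> s * a"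
    using exp_ge_add_one_self[of "- (s * a)"] by simp
  ultimately have "0 \<le> (1 - exp (- (s * a))) / s" "(1 - exp (- (s * a))) / s \<le> a"
    using assms by (auto simp: divide_le_eq mult.commute)
  then show ?thesis by simp
qed

text \<open>On the Fourier side the multiplier \<open>(1 - exp (- s \<bar>\<xi>\<bar>)) / s\<close> increases to \<open>\<bar>\<xi>\<bar>\<close> as \<open>s\<close> decreases to \<open>0\<close>.\<close>

lemma pquot_tendsto:
  assumes \<phi>: "test_function \<phi>"
  shows "(\<lambda>n. pquot \<phi> (1 / real (Suc n)) x) \<longlonglongrightarrow> abs_nabla \<phi> x"
proof -
  note [measurable] = fourier_measurable[OF test_function_measurable[OF \<phi>]]
  let ?s = "\<lambda>n. 1 / real (Suc n)"
  let ?g = "\<lambda>n \<xi>. exp (\<i> * of_real (\<xi> * x)) * (of_real ((1 - exp (- (?s n * \<bar>\<xi>\<bar>))) / ?s n) * fourier \<phi> \<xi>)"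
  have "(\<lambda>n. LBINT \<xi>. ?g n \<xi>) \<longlonglongrightarrow> (LBINT \<xi>. exp (\<i> * of_real (\<xi> * x)) * (of_real \<bar>\<xi>\<bar> * fourier \<phi> \<xi>))"
  proof (rule integral_dominated_convergence[where w = "\<lambda>\<xi>. cmod (of_real \<bar>\<xi>\<bar> * fourier \<phi> \<xi>)"])
    show "AE \<xi> in lborel. (\<lambda>n. ?g n \<xi>) \<longlonglongrightarrow> exp (\<i> * of_real (\<xi> * x)) * (of_real \<bar>\<xi>\<bar> * fourier \<phi> \<xi>)"
    proof (rule AE_I2, goal_cases)
      case (1 \<xi>)
      have "((\<lambda>s. 1 - exp (- (s * \<bar>\<xi>\<bar>))) has_real_derivative \<bar>\<xi>\<bar>) (at 0)"
        by (auto intro!: derivative_eq_intros)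
      then have "((\<lambda>s. (1 - exp (- (s * \<bar>\<xi>\<bar>))) / s) \<longlongrightarrow> \<bar>\<xi>\<bar>) (at 0)"
        by (simp add: has_field_derivative_iff)
      moreover have "filterlim ?s (at 0) sequentially"
        using one_over_Suc_tendsto_0 by (auto simp: filterlim_at)
      ultimately have "(\<lambda>n. (1 - exp (- (?s n * \<bar>\<xi>\<bar>))) / ?s n) \<longlonglongrightarrow> \<bar>\<xi>\<bar>"
        by (rule filterlim_compose)
      then show ?case
        by (intro tendsto_intros)
    qed
    show "AE \<xi> in lborel. norm (?g n \<xi>) \<le> cmod (of_real \<bar>\<xi>\<bar> * fourier \<phi> \<xi>)" for n
      unfolding norm_mult norm_of_real using one_minus_exp_le[of "?s n"]
      by (intro AE_I2) (auto intro!: mult_right_mono)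
  qed (use test_function_fourier_decay(2)[OF \<phi>] in auto)
  then have "(\<lambda>n. of_real (1 / (2 * pi)) * (LBINT \<xi>. ?g n \<xi>)) \<longlonglongrightarrow> abs_nabla \<phi> x"
    unfolding abs_nabla_lborel[OF \<phi>] by (rule tendsto_mult_left)
  then show ?thesis
    by (subst pquot_fourier[OF \<phi>]) auto
qed

lemma abs_nabla_measurable:
  assumes \<phi>: "test_function \<phi>"
  shows "abs_nabla \<phi> \<in> borel_measurable borel"
proof (rule borel_measurable_LIMSEQ_metric)
  note [measurable] = test_function_measurable[OF \<phi>]
  show "(\<lambda>x. pquot \<phi> (1 / real (Suc n)) x) \<in> borel_measurable borel" for n
    unfolding pquot_def poisson_def by measurable
qed (rule pquot_tendsto[OF \<phi>])

text \<open>On a bounded interval the Fourier representation gives a bound that is uniform in \<open>s\<close>. Away from the support \<open>\<phi> x = 0\<close>,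
and only the tail \<open>O(1 / x\<^sup>2)\<close> of the Poisson kernel divided by \<open>s\<close> remains.\<close>

lemma pquot_le_wt:
  assumes \<phi>: "test_function \<phi>"
  obtains C where "\<And>s x. s > 0 \<Longrightarrow> cmod (pquot \<phi> s x) \<le> C * wt x"
proof -
  note [measurable] = fourier_measurable[OF test_function_measurable[OF \<phi>]] test_function_measurable[OF \<phi>]
  obtain M where M: "M > 0" "\<forall>x. \<bar>x\<bar> > M \<longrightarrow> \<phi> x = 0"
    using test_function_support[OF \<phi>] by blast
  note M = M(1) M(2)[rule_format]
  define A where "A = (LBINT \<xi>. cmod (of_real \<bar>\<xi>\<bar> * fourier \<phi> \<xi>))"
  define K where "K = (LBINT y. cmod (\<phi> y))"
  have "A \<ge> 0" "K \<ge> 0" unfolding A_def K_def by auto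
  have near: "cmod (pquot \<phi> s x) \<le> A" if s: "s > 0" for s x
  proof -
    let ?e = "\<lambda>\<xi>. exp (\<i> * of_real (\<xi> * x)) * (of_real ((1 - exp (- (s * \<bar>\<xi>\<bar>))) / s) * fourier \<phi> \<xi>)"
    have "cmod (LBINT \<xi>. ?e \<xi>) \<le> A"
      unfolding A_def
    proof (rule Bochner_Integration.integral_norm_bound_integral)
      show "integrable lborel (\<lambda>\<xi>. cmod (of_real \<bar>\<xi>\<bar> * fourier \<phi> \<xi>))"
        using test_function_fourier_decay(2)[OF \<phi>] by auto
      show le: "norm (?e \<xi>) \<le> cmod (of_real \<bar>\<xi>\<bar> * fourier \<phi> \<xi>)" for \<xi>
        using mult_right_mono[OF one_minus_exp_le[OF s, of "\<bar>\<xi>\<bar>"], of "cmod (fourier \<phi> \<xi>)"]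
        by (simp add: norm_mult norm_divide del: of_real_diff)
      show "integrable lborel ?e"
        by (rule Bochner_Integration.integrable_bound[OF test_function_fourier_decay(2)[OF \<phi>]]) (use le in auto)
    qed
    moreover have "1 / (2 * pi) \<le> 1" using pi_gt3 by simp
    ultimately show ?thesis
      unfolding pquot_fourier[OF \<phi> s] norm_mult norm_of_real
      using mult_mono[of "\<bar>1 / (2 * pi)\<bar>" 1] \<open>A \<ge> 0\<close> by simp
  qed
  have far: "cmod (pquot \<phi> s x) \<le> 4 * K / x\<^sup>2" if s: "s > 0" and x: "\<bar>x\<bar> > 2 * M" for s x
  proof -
    have "cmod (pquot \<phi> s x) \<le> (LBINT y. 4 / x\<^sup>2 * cmod (\<phi> y))"
      unfolding pquot_def
    proof (rule Bochner_Integration.integral_norm_bound_integral)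
      show int: "integrable lborel (\<lambda>y. 4 / x\<^sup>2 * cmod (\<phi> y))"
        using test_function_integrable[OF \<phi>] by auto
      show le: "norm (of_real (poisson s (x - y) / s) * (\<phi> x - \<phi> y)) \<le> 4 / x\<^sup>2 * cmod (\<phi> y)" for y
      proof (cases "\<bar>y\<bar> > M")
        case False
        then have xy: "\<bar>x\<bar> / 2 \<le> \<bar>x - y\<bar>" "x \<noteq> 0" using x M by linarith+
        have "(\<bar>x\<bar> / 2)\<^sup>2 \<le> (x - y)\<^sup>2"
          using xy(1) by (subst power2_abs[of "x - y", symmetric], intro power_mono) auto
        then have "x\<^sup>2 / 4 \<le> (x - y)\<^sup>2" by (simp add: power_divide)
        also have "\<dots> \<le> 1 * (s\<^sup>2 + (x - y)\<^sup>2)" by simp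
        also have "\<dots> \<le> pi * (s\<^sup>2 + (x - y)\<^sup>2)"
          using pi_gt3 by (intro mult_right_mono) auto
        finally have *: "x\<^sup>2 / 4 \<le> pi * (s\<^sup>2 + (x - y)\<^sup>2)" .
        have "poisson s (x - y) / s = 1 / (pi * (s\<^sup>2 + (x - y)\<^sup>2))"
          using s by (simp add: poisson_def)
        also have "\<dots> \<le> 1 / (x\<^sup>2 / 4)"
          using xy(2) s by (intro divide_left_mono *) (auto intro!: mult_pos_pos add_pos_nonneg)
        finally have "poisson s (x - y) / s \<le> 4 / x\<^sup>2" by simp
        moreover have "0 \<le> poisson s (x - y) / s" using s by (simp add: poisson_def)
        moreover have "\<phi> x = 0" using M(2)[of x] x M(1) by simp
        ultimately show ?thesis
          by (simp only: norm_mult norm_of_real abs_of_nonneg diff_0 norm_minus_cancel mult_right_mono norm_ge_zero)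
      qed (use M x in simp)
      show "integrable lborel (\<lambda>y. of_real (poisson s (x - y) / s) * (\<phi> x - \<phi> y))"
        by (rule Bochner_Integration.integrable_bound[OF int]) (use le in auto)
    qed
    then show ?thesis by (simp add: K_def)
  qed
  define C where "C = A * (1 + (2 * M)\<^sup>2) + 4 * K * (1 + 1 / (2 * M)\<^sup>2)"
  have "cmod (pquot \<phi> s x) \<le> C * wt x" if s: "s > 0" for s x
  proof -
    have "cmod (pquot \<phi> s x) * (1 + x\<^sup>2) \<le> C"
    proof (cases "\<bar>x\<bar> > 2 * M")
      case True
      then have "(2 * M)\<^sup>2 \<le> x\<^sup>2" and x0: "0 < x\<^sup>2"
        using M(1) power_mono[of "2 * M" "\<bar>x\<bar>" 2] by auto
      then have "1 / x\<^sup>2 \<le> 1 / (2 * M)\<^sup>2"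
        using M(1) by (intro divide_left_mono) auto
      have "cmod (pquot \<phi> s x) * (1 + x\<^sup>2) \<le> 4 * K / x\<^sup>2 * (1 + x\<^sup>2)"
        using far[OF s True] by (intro mult_right_mono) auto
      also have "\<dots> = 4 * K * (1 + 1 / x\<^sup>2)" using x0 by (simp add: field_simps)
      also have "\<dots> \<le> 4 * K * (1 + 1 / (2 * M)\<^sup>2)"
        using \<open>1 / x\<^sup>2 \<le> 1 / (2 * M)\<^sup>2\<close> \<open>K \<ge> 0\<close> by (intro mult_left_mono) auto
      also have "\<dots> \<le> C" using \<open>A \<ge> 0\<close> by (simp add: C_def)
      finally show ?thesis .
    next
      case False
      then have "x\<^sup>2 \<le> (2 * M)\<^sup>2"
        using power_mono[of "\<bar>x\<bar>" "2 * M" 2] by auto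
      then have "cmod (pquot \<phi> s x) * (1 + x\<^sup>2) \<le> A * (1 + (2 * M)\<^sup>2)"
        using near[OF s, of x] \<open>A \<ge> 0\<close> by (intro mult_mono) auto
      also have "\<dots> \<le> C" using \<open>K \<ge> 0\<close> by (simp add: C_def)
      finally show ?thesis .
    qed
    then show ?thesis
      using one_plus_square_pos[of x] by (simp add: wt_def le_divide_eq)
  qed
  then show ?thesis using that by blast
qed

section \<open>The energy form represents \<open>|\<nabla>|\<close>\<close>

lemma wt_ge: "\<bar>x\<bar> \<le> M \<Longrightarrow> 1 / (1 + M\<^sup>2) \<le> wt x"
  using one_plus_square_pos[of x] power_mono[of "\<bar>x\<bar>" M 2]
  unfolding wt_def by (intro divide_left_mono) auto

text \<open>On a bounded interval the weights are bounded below and \<open>\<phi>\<close> is Lipschitz. If one of the points is far away, then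
\<open>\<phi>\<close> vanishes there, and the chord to any point of the support is bounded below.\<close>

lemma finite_energy_test_function:
  assumes \<phi>: "test_function \<phi>"
  shows "finite_energy \<phi>"
proof -
  obtain D M where D: "D 0 = \<phi>" "\<forall>n x. (D n has_vector_derivative D (Suc n) x) (at x)"
    "\<forall>n. continuous_on UNIV (D n)" "M > 0" "\<forall>n x. \<bar>x\<bar> > M \<longrightarrow> D n x = 0"
    using test_function_derivs[OF \<phi>] by (elim exE conjE)
  note D = D(1) D(2-)[rule_format]
  have \<phi>0: "\<phi> x = 0" if "\<bar>x\<bar> > M" for x using D(5)[of x 0] that by (simp add: D(1))
  obtain B where B: "cmod (\<phi> x) \<le> B" for x using test_function_bounded[OF \<phi>] by blast
  have "\<exists>L. \<forall>x. cmod (D 1 x) \<le> L"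
    by (rule continuous_compact_support(2)[OF D(3,5)], assumption)
  then obtain L where L: "cmod (D 1 x) \<le> L" for x by blast
  have lip: "cmod (\<phi> x - \<phi> y) \<le> L * \<bar>x - y\<bar>" for x y
  proof -
    have "onorm (\<lambda>h. h *\<^sub>R D 1 x) \<le> L" for x
      using L[of x] by (intro onorm_le) (simp add: mult.commute[of L] mult_left_mono)
    then show ?thesis
      using differentiable_bound[of UNIV \<phi> "\<lambda>x h. h *\<^sub>R D 1 x" L x y] D(2)[of 0]
      by (simp add: D(1) has_vector_derivative_def norm_minus_commute abs_minus_commute)
  qed
  \<comment> \<open>beyond \<open>2 * N\<close> a point is at least as far from the support as half of its distance from \<open>0\<close>\<close>
  define N where "N = max M 1"
  define W where "W = 1 + (2 * N)\<^sup>2"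
  have "W > 0" by (auto simp: W_def add_pos_nonneg)
  have wtW: "1 \<le> W * wt x" if "\<bar>x\<bar> \<le> 2 * N" for x
    using wt_ge[OF that] \<open>W > 0\<close> by (simp add: W_def divide_le_eq mult.commute)
  have B2: "(cmod (\<phi> y))\<^sup>2 \<le> B\<^sup>2" for y by (rule power_mono) (auto simp: B)
  have far: "(cmod (\<phi> x - \<phi> y))\<^sup>2 \<le> 5 * B\<^sup>2 * W * (wt x * wt y * (x - y)\<^sup>2)" if x: "\<bar>x\<bar> > 2 * N" for x y
  proof (cases "\<bar>y\<bar> > M")
    case True
    then show ?thesis using \<phi>0[of x] \<phi>0[of y] x \<open>W > 0\<close> by (auto simp: N_def)
  next
    case False
    have xN: "\<bar>x\<bar> > 2 * M" "\<bar>x\<bar> \<ge> 2" "N \<ge> M" using x by (auto simp: N_def)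
    have "\<bar>x\<bar> / 2 \<le> \<bar>x - y\<bar>" using xN False by linarith
    then have "(\<bar>x\<bar> / 2)\<^sup>2 \<le> \<bar>x - y\<bar>\<^sup>2" by (rule power_mono) simp
    moreover have "2\<^sup>2 \<le> \<bar>x\<bar>\<^sup>2" using xN by (intro power_mono) auto
    ultimately have "1 + x\<^sup>2 \<le> 5 * (x - y)\<^sup>2" by (simp add: power_divide)
    then have 1: "1 \<le> 5 * (wt x * (x - y)\<^sup>2)"
      using one_plus_square_pos[of x] by (simp add: wt_def)
    have 2: "1 \<le> W * wt y" using wtW[of y] False xN D(4) by auto
    have "(cmod (\<phi> x - \<phi> y))\<^sup>2 \<le> B\<^sup>2"
      using B2[of y] \<phi>0[of x] xN D(4) by simp
    also have "\<dots> \<le> B\<^sup>2 * ((5 * (wt x * (x - y)\<^sup>2)) * (W * wt y))"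
      using mult_mono[OF 1 2] 1 mult_left_mono[of 1 "(5 * (wt x * (x - y)\<^sup>2)) * (W * wt y)" "B\<^sup>2"] by simp
    finally show ?thesis by (simp add: mult_ac)
  qed
  show ?thesis
  proof (rule finite_energy_if_chord_lipschitz[OF test_function_measurable[OF \<phi>] B])
    fix x y
    let ?T = "wt x * wt y * (x - y)\<^sup>2"
    have T: "0 \<le> ?T" by simp
    have "0 \<le> L\<^sup>2 * W\<^sup>2 * ?T" "0 \<le> 5 * B\<^sup>2 * W * ?T" using \<open>W > 0\<close> by (intro mult_nonneg_nonneg; simp)+
    moreover have "(cmod (\<phi> x - \<phi> y))\<^sup>2 \<le> L\<^sup>2 * W\<^sup>2 * ?T \<or> (cmod (\<phi> x - \<phi> y))\<^sup>2 \<le> 5 * B\<^sup>2 * W * ?T"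
    proof -
      consider "\<bar>x\<bar> > 2 * N" | "\<bar>y\<bar> > 2 * N" | "\<bar>x\<bar> \<le> 2 * N" "\<bar>y\<bar> \<le> 2 * N" by linarith
      then show ?thesis
      proof cases
        case 1
        then show ?thesis using far by blast
      next
        case 2
        from far[OF this, of x] show ?thesis
          by (simp add: norm_minus_commute power2_commute mult_ac)
      next
        case 3
        have "(cmod (\<phi> x - \<phi> y))\<^sup>2 \<le> (L * \<bar>x - y\<bar>)\<^sup>2" by (rule power_mono[OF lip]) simp
        also have "\<dots> = L\<^sup>2 * (x - y)\<^sup>2 * 1" by (simp add: power_mult_distrib)
        also have "\<dots> \<le> L\<^sup>2 * (x - y)\<^sup>2 * ((W * wt x) * (W * wt y))"
          using mult_mono[OF wtW[OF 3(1)] wtW[OF 3(2)]] wtW[OF 3(1)] by (intro mult_left_mono) auto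
        finally show ?thesis by (simp add: mult_ac power2_eq_square)
      qed
    qed
    ultimately show "(cmod (\<phi> x - \<phi> y))\<^sup>2 \<le> (L\<^sup>2 * W\<^sup>2 + 5 * B\<^sup>2 * W) * ?T"
      unfolding distrib_right by linarith
  qed
qed

text \<open>One power of the weight is spent on the Poisson kernel, by the next lemma, and the other one is left for integrability.\<close>

lemma test_function_le_wt_square:
  assumes \<phi>: "test_function \<phi>"
  shows "\<exists>C. \<forall>x. cmod (\<phi> x) \<le> C * (wt x)\<^sup>2"
proof -
  obtain M where "\<forall>x. \<bar>x\<bar> > M \<longrightarrow> \<phi> x = 0"
    using test_function_support[OF \<phi>] by blast
  then have "\<phi> x / (of_real (wt x))\<^sup>2 = 0" if "\<bar>x\<bar> > M" for x using that by simp
  moreover have "continuous_on UNIV (\<lambda>x. \<phi> x / (of_real (wt x))\<^sup>2)"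
    using wt_pos by (intro continuous_intros test_function_continuous \<phi>) (metis less_irrefl of_real_eq_0_iff power_eq_0_iff)
  ultimately have "\<exists>C. \<forall>x. cmod (\<phi> x / (of_real (wt x))\<^sup>2) \<le> C"
    by (intro continuous_compact_support(2)) auto
  then obtain C where C: "cmod (\<phi> x / (of_real (wt x))\<^sup>2) \<le> C" for x by blast
  have "cmod (\<phi> x) \<le> C * (wt x)\<^sup>2" for x
    using C[of x] wt_pos[of x] by (simp add: norm_divide norm_power divide_le_eq)
  then show ?thesis by blast
qed

text \<open>A Peetre type inequality: translation by \<open>x - y\<close> changes the weight by a factor of at most \<open>2 (1 + (x - y)\<^sup>2)\<close>, and
the kernel pays for this factor.\<close>

lemma poisson_quotient_le:
  assumes s: "s > 0"
  shows "\<exists>K. \<forall>x y. poisson s (x - y) / s * wt y \<le> K * wt x"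
proof -
  \<comment> \<open>then \<open>m * (1 + t\<^sup>2) \<le> s\<^sup>2 + t\<^sup>2\<close> for all \<open>t\<close>\<close>
  define m where "m = min 1 (s\<^sup>2)"
  have m: "m > 0" "m \<le> 1" "m \<le> s\<^sup>2" using s by (auto simp: m_def)
  have "poisson s (x - y) / s * wt y \<le> 2 / m * wt x" for x y
  proof -
    let ?d = "s\<^sup>2 + (x - y)\<^sup>2"
    have d: "?d > 0" using s by (auto intro: add_pos_nonneg)
    have "x\<^sup>2 \<le> 2 * y\<^sup>2 + 2 * (x - y)\<^sup>2"
      using norm_add_square_le[of "x - y" y] by simp
    moreover have "1 + X \<le> 2 * (1 + Y) * (1 + Z)" if "X \<le> 2 * Y + 2 * Z" "0 \<le> Y" "0 \<le> Z" for X Y Z :: real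
    proof -
      have "2 * (1 + Y) * (1 + Z) = 2 + 2 * Y + 2 * Z + 2 * (Y * Z)" by (simp add: algebra_simps)
      moreover have "0 \<le> Y * Z" using that by simp
      ultimately show ?thesis using that by linarith
    qed
    ultimately have "1 + x\<^sup>2 \<le> 2 * (1 + y\<^sup>2) * (1 + (x - y)\<^sup>2)" by simp
    then have "m * (1 + x\<^sup>2) \<le> m * (2 * (1 + y\<^sup>2) * (1 + (x - y)\<^sup>2))"
      using m by (intro mult_left_mono) auto
    also have "\<dots> = 2 * (1 + y\<^sup>2) * (m * 1 + m * (x - y)\<^sup>2)"
      by (simp add: algebra_simps)
    also have "\<dots> \<le> 2 * (1 + y\<^sup>2) * ?d"
      using m mult_right_mono[OF m(2), of "(x - y)\<^sup>2"] by (intro mult_left_mono add_mono) auto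
    also have "\<dots> \<le> 2 * (1 + y\<^sup>2) * (pi * ?d)"
      using mult_right_mono[of 1 pi ?d] d pi_gt3 by (intro mult_left_mono) auto
    finally have *: "m * (1 + x\<^sup>2) \<le> 2 * ((1 + y\<^sup>2) * (pi * ?d))" by (simp only: mult.assoc)
    have **: "1 / P \<le> 2 / m * (1 / X)" if "m * X \<le> 2 * P" "P > 0" "X > 0" for P X :: real
      using that m by (simp add: field_simps)
    have "poisson s (x - y) / s * wt y = 1 / ((1 + y\<^sup>2) * (pi * ?d))"
      using s by (simp add: poisson_def wt_def mult_ac)
    also have "\<dots> \<le> 2 / m * wt x"
      unfolding wt_def using * d one_plus_square_pos[of x] one_plus_square_pos[of y]
      by (intro **) auto
    finally show ?thesis .
  qed
  then show ?thesis by blast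
qed

lemma poisson_commute: "poisson s (x - y) = poisson s (y - x)"
  by (simp add: poisson_def power2_commute)

text \<open>For \<open>s > 0\<close> the kernel is regular enough for symmetrization, even though \<open>f\<close> is integrable against \<open>wt\<close> only.\<close>

lemma pquot_pairing:
  assumes f: "finite_energy f" and \<phi>: "test_function \<phi>" and s: "s > 0"
  shows "2 * (LBINT x. f x * pquot \<phi> s x) =
    (\<integral>p. of_real ((fst p - snd p)\<^sup>2 / (pi * (s\<^sup>2 + (fst p - snd p)\<^sup>2))) * (dquot f p * dquot \<phi> p) \<partial>plane)"
proof -
  note [measurable] = finite_energyD(2)[OF f] test_function_measurable[OF \<phi>]
  let ?k = "\<lambda>x y. poisson s (x - y) / s"
  obtain C where C: "cmod (\<phi> x) \<le> C * (wt x)\<^sup>2" for x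
    using test_function_le_wt_square[OF \<phi>] by blast
  obtain K where K: "?k x y * wt y \<le> K * wt x" for x y
    using poisson_quotient_le[OF s] by blast
  have C0: "C \<ge> 0" using order_trans[OF norm_ge_zero C[of 0]] wt_pos[of 0]
    by (simp add: zero_le_mult_iff)
  have k0: "?k x y \<ge> 0" for x y using s by (simp add: poisson_def)
  have "integrable plane (\<lambda>p. complex_of_real (?k (fst p) (snd p)) * (f (fst p) * (\<phi> (fst p) - \<phi> (snd p))))"
    (is "integrable _ ?F")
  proof (rule Bochner_Integration.integrable_bound)
    show "integrable plane (\<lambda>p. of_real (2 * K * C) * (f (fst p) * of_real (wt (fst p)) * of_real (wt (snd p))))"
      (is "integrable _ ?G")
      using finite_energyD(1)[OF f] by (intro integrable_mult_right integrable_plane_product integrable_of_real integrable_wt)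
        (auto simp: wt_integrable_def)
    have "?k x y * (cmod (f x) * cmod (\<phi> x - \<phi> y)) \<le> 2 * K * C * (cmod (f x) * wt x * wt y)" for x y
    proof -
      have "?k x y * cmod (\<phi> x - \<phi> y) \<le> ?k x y * (C * (wt x)\<^sup>2 + C * (wt y)\<^sup>2)"
        using k0 by (intro mult_left_mono order_trans[OF norm_triangle_ineq4] add_mono C) auto
      also have "\<dots> = C * wt x * (?k y x * wt x) + C * wt y * (?k x y * wt y)"
        by (simp add: poisson_commute[of s x y] algebra_simps power2_eq_square)
      also have "\<dots> \<le> C * wt x * (K * wt y) + C * wt y * (K * wt x)"
        using C0 by (intro add_mono mult_left_mono K) auto
      finally have "?k x y * cmod (\<phi> x - \<phi> y) \<le> 2 * K * C * (wt x * wt y)" by (simp add: mult_ac)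
      from mult_left_mono[OF this, of "cmod (f x)"] show ?thesis by (simp add: mult_ac)
    qed
    then show "AE p in plane. norm (?F p) \<le> norm (?G p)"
      unfolding norm_mult norm_of_real abs_of_nonneg[OF k0] abs_of_nonneg[OF wt_nonneg]
      by (intro AE_I2 order_trans[OF _ mult_right_mono[OF abs_ge_self]]) auto
  qed measurable
  from integral_symmetrize[OF _ this]
  have "2 * (LBINT x. f x * pquot \<phi> s x)
      = (\<integral>p. of_real (?k (fst p) (snd p)) * ((f (fst p) - f (snd p)) * (\<phi> (fst p) - \<phi> (snd p))) \<partial>plane)"
    unfolding pquot_def by (metis poisson_commute)
  also have "\<dots> = (\<integral>p. of_real ((fst p - snd p)\<^sup>2 / (pi * (s\<^sup>2 + (fst p - snd p)\<^sup>2))) * (dquot f p * dquot \<phi> p) \<partial>plane)"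
  proof (rule arg_cong[where f = "integral\<^sup>L plane"], rule ext)
    fix p :: "real \<times> real"
    have "?k (fst p) (snd p) = 1 / (pi * (s\<^sup>2 + (fst p - snd p)\<^sup>2))"
      using s by (simp add: poisson_def)
    then show "of_real (?k (fst p) (snd p)) * ((f (fst p) - f (snd p)) * (\<phi> (fst p) - \<phi> (snd p))) =
      of_real ((fst p - snd p)\<^sup>2 / (pi * (s\<^sup>2 + (fst p - snd p)\<^sup>2))) * (dquot f p * dquot \<phi> p)"
      by (cases "fst p = snd p") (simp_all add: dquot_def power2_eq_square del: of_real_diff)
  qed
  finally show ?thesis .
qed

text \<open>In the limit \<open>s \<rightarrow> 0\<close> the left side is dominated by \<open>C * cmod (f x) * wt x\<close>. On the right the regularized kernel is at most
the singular one, for which the integrand is a product of two square integrable functions.\<close>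

lemma abs_nabla_pairing:
  assumes f: "finite_energy f" and \<phi>: "test_function \<phi>"
  shows "(LBINT x. f x * abs_nabla \<phi> x) = energy_form f \<phi> / (2 * pi)"
proof -
  note [measurable] = finite_energyD(2)[OF f] test_function_measurable[OF \<phi>] abs_nabla_measurable[OF \<phi>]
  obtain C where C: "\<And>s x. s > 0 \<Longrightarrow> cmod (pquot \<phi> s x) \<le> C * wt x"
    using pquot_le_wt[OF \<phi>] by blast
  let ?s = "\<lambda>n. 1 / real (Suc n)"
  have meas [measurable]: "(\<lambda>x. pquot \<phi> s x) \<in> borel_measurable borel" for s
    unfolding pquot_def by measurable
  have left: "(\<lambda>n. LBINT x. f x * pquot \<phi> (?s n) x) \<longlonglongrightarrow> (LBINT x. f x * abs_nabla \<phi> x)"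
  proof (rule integral_dominated_convergence[where w = "\<lambda>x. C * cmod (f x * of_real (wt x))"])
    show "AE x in lborel. (\<lambda>n. f x * pquot \<phi> (?s n) x) \<longlonglongrightarrow> f x * abs_nabla \<phi> x"
      by (intro AE_I2 tendsto_intros pquot_tendsto \<phi>)
    show "integrable lborel (\<lambda>x. C * cmod (f x * of_real (wt x)))"
      using finite_energyD(1)[OF f] by (intro integrable_mult_right integrable_norm) (simp add: wt_integrable_def)
    show "AE x in lborel. norm (f x * pquot \<phi> (?s n) x) \<le> C * cmod (f x * of_real (wt x))" for n
    proof (rule AE_I2, goal_cases)
      case (1 x)
      show ?case
        using mult_left_mono[OF C[of "?s n" x], of "cmod (f x)"] by (simp add: norm_mult mult_ac)
    qed
  qed measurable
  let ?r = "\<lambda>s p. (fst p - snd p)\<^sup>2 / (pi * (s\<^sup>2 + (fst p - snd p)\<^sup>2)) :: real"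
  let ?D = "\<lambda>p. dquot f p * dquot \<phi> p"
  have D: "integrable plane ?D"
    by (rule integrable_dquot_mult[OF f finite_energy_test_function[OF \<phi>]])
  have "(\<lambda>n. \<integral>p. of_real (?r (?s n) p) * ?D p \<partial>plane) \<longlonglongrightarrow> (\<integral>p. of_real (1 / pi) * ?D p \<partial>plane)"
  proof (rule integral_dominated_convergence[where w = "\<lambda>p. cmod (?D p)"])
    show "AE p in plane. (\<lambda>n. of_real (?r (?s n) p) * ?D p) \<longlonglongrightarrow> of_real (1 / pi) * ?D p"
      using AE_off_diagonal
    proof eventually_elim
      case (elim p)
      have "(\<lambda>n. ?r (?s n) p) \<longlonglongrightarrow> (fst p - snd p)\<^sup>2 / (pi * (0\<^sup>2 + (fst p - snd p)\<^sup>2))"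
        using elim by (intro tendsto_intros one_over_Suc_tendsto_0) auto
      then have "(\<lambda>n. ?r (?s n) p) \<longlonglongrightarrow> 1 / pi" using elim by simp
      then show ?case by (intro tendsto_mult tendsto_of_real tendsto_const)
    qed
    have "?r s p \<le> 1" for s p
    proof -
      have "(fst p - snd p)\<^sup>2 \<le> 1 * (s\<^sup>2 + (fst p - snd p)\<^sup>2)" by simp
      also have "\<dots> \<le> pi * (s\<^sup>2 + (fst p - snd p)\<^sup>2)" using pi_gt3 by (intro mult_right_mono) auto
      finally have le: "(fst p - snd p)\<^sup>2 \<le> pi * (s\<^sup>2 + (fst p - snd p)\<^sup>2)" .
      have "a / b \<le> 1" if "a \<le> b" "0 \<le> a" for a b :: real
        using that by (cases "b = 0") (auto simp: divide_le_eq_1)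
      from this[OF le] show ?thesis by simp
    qed
    then have "\<bar>?r s p\<bar> * cmod (?D p) \<le> 1 * cmod (?D p)" for s p
      by (intro mult_right_mono) (auto simp: abs_le_iff intro: order_trans[of _ 0])
    then show "AE p in plane. norm (of_real (?r (?s n) p) * ?D p) \<le> cmod (?D p)" for n
      unfolding norm_mult norm_of_real by (intro AE_I2) simp
  qed (use D in auto)
  moreover have "(\<lambda>n. 2 * (LBINT x. f x * pquot \<phi> (?s n) x)) \<longlonglongrightarrow> 2 * (LBINT x. f x * abs_nabla \<phi> x)"
    by (intro tendsto_intros left)
  ultimately have "2 * (LBINT x. f x * abs_nabla \<phi> x) = of_real (1 / pi) * energy_form f \<phi>"
    unfolding pquot_pairing[OF f \<phi> zero_less_divide_1_iff[THEN iffD2, OF of_nat_0_less_iff[THEN iffD2, OF zero_less_Suc]]]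
      energy_form_def integral_mult_right_zero
    by (intro LIMSEQ_unique) auto
  then show ?thesis by (simp add: field_simps)
qed

section \<open>Cut-offs of the modes\<close>

text \<open>Fix \<open>l > 0\<close>. Where \<open>cmod (G n x) \<le> l * cmod (F x)\<close> the product is dominated by \<open>l * (cmod (F x))\<^sup>2\<close>. Elsewhere it is at most
\<open>(cmod (G n x))\<^sup>2 / l\<close>, whose integral is at most \<open>K / l\<close>.\<close>

lemma integral_mult_tendsto_0_if_L2_bounded:
  fixes F :: "'a \<Rightarrow> complex" and G :: "nat \<Rightarrow> 'a \<Rightarrow> complex"
  assumes [measurable]: "F \<in> borel_measurable M" "\<And>n. G n \<in> borel_measurable M"
    and F: "integrable M (\<lambda>x. (cmod (F x))\<^sup>2)" and G: "\<And>n. integrable M (\<lambda>x. (cmod (G n x))\<^sup>2)"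
    and K: "\<And>n. (\<integral>x. (cmod (G n x))\<^sup>2 \<partial>M) \<le> K"
    and null: "AE x in M. (\<lambda>n. G n x) \<longlonglongrightarrow> 0"
  shows "(\<lambda>n. \<integral>x. F x * G n x \<partial>M) \<longlonglongrightarrow> 0"
proof (rule LIMSEQ_I)
  fix e :: real
  assume e: "e > 0"
  have K0: "0 \<le> K" by (rule order_trans[OF _ K[of 0]]) simp
  \<comment> \<open>chosen such that \<open>(K + 1) / l = e / 2\<close>; the summand \<open>1\<close> keeps \<open>l\<close> positive\<close>
  define l where "l = 2 * (K + 1) / e"
  have l: "l > 0" using e K0 by (simp add: l_def)
  define H where "H n x = cmod (F x) * min (cmod (G n x)) (l * cmod (F x))" for n x
  have Hm [measurable]: "H n \<in> borel_measurable M" for n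
    unfolding H_def by measurable
  have Hb: "norm (H n x) \<le> l * (cmod (F x))\<^sup>2" for n x
  proof -
    have "norm (H n x) \<le> cmod (F x) * (l * cmod (F x))"
      using l by (auto simp: H_def abs_mult intro!: mult_left_mono)
    then show ?thesis by (simp add: power2_eq_square mult_ac)
  qed
  have lF: "integrable M (\<lambda>x. l * (cmod (F x))\<^sup>2)" using F by simp
  have "(\<lambda>n. \<integral>x. H n x \<partial>M) \<longlonglongrightarrow> (\<integral>x. 0 \<partial>M)"
  proof (rule integral_dominated_convergence[OF _ _ lF])
    show "AE x in M. (\<lambda>n. H n x) \<longlonglongrightarrow> 0"
      using null
    proof eventually_elim
      case (elim x)
      have "(\<lambda>n. H n x) \<longlonglongrightarrow> cmod (F x) * min (cmod 0) (l * cmod (F x))"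
        unfolding H_def by (intro tendsto_intros elim)
      then show ?case using l by (simp add: min_def split: if_splits)
    qed
  qed (use Hb in auto)
  then obtain N where N: "\<bar>\<integral>x. H n x \<partial>M\<bar> < e / 2" if "n \<ge> N" for n
    using LIMSEQ_D[of "\<lambda>n. \<integral>x. H n x \<partial>M" "\<integral>x. 0 \<partial>M" "e / 2"] e by auto
  have "cmod ((\<integral>x. F x * G n x \<partial>M) - 0) < e" if "n \<ge> N" for n
  proof -
    have H: "integrable M (H n)"
      by (rule Bochner_Integration.integrable_bound[OF lF]) (use Hb[of n] in \<open>auto intro: order_trans[OF _ abs_ge_self]\<close>)
    have le: "cmod (F x * G n x) \<le> H n x + (cmod (G n x))\<^sup>2 / l" for x
    proof (cases "cmod (G n x) \<le> l * cmod (F x)")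
      case True
      then show ?thesis using l by (simp add: H_def norm_mult)
    next
      case False
      then have "cmod (F x) \<le> cmod (G n x) / l" using l by (simp add: field_simps)
      from mult_right_mono[OF this norm_ge_zero] have "cmod (F x * G n x) \<le> (cmod (G n x))\<^sup>2 / l"
        by (simp add: norm_mult power2_eq_square)
      moreover have "H n x \<ge> 0" using l by (simp add: H_def)
      ultimately show ?thesis by linarith
    qed
    have int: "integrable M (\<lambda>x. H n x + (cmod (G n x))\<^sup>2 / l)" using H G by auto
    have "cmod (\<integral>x. F x * G n x \<partial>M) \<le> (\<integral>x. H n x + (cmod (G n x))\<^sup>2 / l \<partial>M)"
    proof (rule order_trans[OF integral_norm_bound integral_mono[OF integrable_norm int le]])
      show "integrable M (\<lambda>x. F x * G n x)"
        by (rule Bochner_Integration.integrable_bound[OF int]) (use le in \<open>auto intro: order_trans[OF _ abs_ge_self]\<close>)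
    qed
    also have "\<dots> = (\<integral>x. H n x \<partial>M) + (\<integral>x. (cmod (G n x))\<^sup>2 \<partial>M) / l"
      using H G by (subst Bochner_Integration.integral_add) auto
    also have "\<dots> < e / 2 + (K + 1) / l"
      using N[OF that] K[of n] l by (intro add_strict_mono divide_strict_right_mono) auto
    also have "(K + 1) / l = e / 2"
    proof -
      have "a / (2 * a / e) = e / 2" if "a > 0" for a using that e by simp
      from this[of "K + 1"] show ?thesis using K0 by (simp add: l_def)
    qed
    finally show ?thesis by simp
  qed
  then show "\<exists>N. \<forall>n\<ge>N. cmod ((\<integral>x. F x * G n x \<partial>M) - 0) < e" by blast
qed

text \<open>A class of functions that is closed under differentiation consists of smooth functions.\<close>

lemma smooth_coinduct:
  assumes "P \<phi>" and step: "\<And>h. P h \<Longrightarrow> \<exists>h'. P h' \<and> (\<forall>x. (h has_vector_derivative h' x) (at x))"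
  shows "smooth \<phi>"
proof -
  define D where "D n = ((\<lambda>h. SOME h'. P h' \<and> (\<forall>x. (h has_vector_derivative h' x) (at x))) ^^ n) \<phi>" for n
  have S: "D (Suc n) = (SOME h'. P h' \<and> (\<forall>x. (D n has_vector_derivative h' x) (at x)))" for n
    by (simp add: D_def)
  have P: "P (D n)" for n
  proof (induction n)
    case 0
    then show ?case using assms(1) by (simp add: D_def)
  next
    case (Suc n)
    then show ?case using someI_ex[OF step[OF Suc]] unfolding S by blast
  qed
  then have "\<forall>x. (D n has_vector_derivative D (Suc n) x) (at x)" for n
    using someI_ex[OF step[OF P]] unfolding S by blast
  moreover have "D 0 = \<phi>" by (simp add: D_def)
  ultimately show ?thesis unfolding smooth_def by blast
qed

text \<open>The standard bump \<open>exp (1 - r\<^sup>2 / (r\<^sup>2 - x\<^sup>2))\<close>, with value \<open>1\<close> at the origin.\<close>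

definition cutoff :: "real \<Rightarrow> real \<Rightarrow> real" where
  "cutoff r x = (if \<bar>x\<bar> < r then exp (- (x\<^sup>2 / (r\<^sup>2 - x\<^sup>2))) else 0)"

text \<open>A family that contains \<open>cay ^ n\<close> times the cut-off and is closed under differentiation.\<close>

definition cutoff_frac :: "real \<Rightarrow> complex poly \<Rightarrow> nat \<Rightarrow> nat \<Rightarrow> real \<Rightarrow> complex" where
  "cutoff_frac r p j k x =
    poly p (of_real x) * (1 / (of_real x + \<i>) ^ j) * (1 / of_real (r\<^sup>2 - x\<^sup>2) ^ k) * of_real (cutoff r x)"

lemma square_less_if_abs_less: "\<bar>x\<bar> < r \<Longrightarrow> x\<^sup>2 < (r::real)\<^sup>2"
  using power_strict_mono[of "\<bar>x\<bar>" r 2] by simp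

lemma DERIV_one_over_power:
  assumes g: "(g has_field_derivative g') (at (z::complex))" and nz: "g z \<noteq> 0"
  shows "((\<lambda>z. 1 / g z ^ k) has_field_derivative (- of_nat k * g' / g z ^ Suc k)) (at z)"
proof (cases k)
  case (Suc l)
  have "((\<lambda>z. 1 / g z ^ k) has_field_derivative
      (- (of_nat k * (g' * g z ^ (k - 1))) / (g z ^ k * g z ^ k))) (at z)"
    using nz by (auto intro!: derivative_eq_intros g)
  also have "- (of_nat k * (g' * g z ^ (k - 1))) / (g z ^ k * g z ^ k) = - of_nat k * g' / g z ^ Suc k"
    using nz by (simp add: Suc field_simps)
  finally show ?thesis .
qed simp

text \<open>The new numerator after the four terms of the product rule are brought to a common denominator.\<close>

definition cutoff_deriv_poly :: "real \<Rightarrow> complex poly \<Rightarrow> nat \<Rightarrow> nat \<Rightarrow> complex poly" where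
  "cutoff_deriv_poly r p j k = pderiv p * [:\<i>, 1:] * [:of_real r ^ 2, 0, -1:] ^ 2 - smult (of_nat j) (p * [:of_real r ^ 2, 0, -1:] ^ 2)
      + smult (2 * of_nat k) (p * [:0, 1:] * [:\<i>, 1:] * [:of_real r ^ 2, 0, -1:])
      - smult (2 * of_real r ^ 2) (p * [:0, 1:] * [:\<i>, 1:])"

lemma cutoff_frac_deriv_inside:
  assumes x: "\<bar>x\<bar> < r"
  shows "(cutoff_frac r p j k has_vector_derivative cutoff_frac r (cutoff_deriv_poly r p j k) (Suc j) (k + 2) x) (at x)"
proof -
  define q where "q = cutoff_deriv_poly r p j k"
  let ?z = "complex_of_real x"
  define u where "u = ?z + \<i>"
  define d where "d = of_real r ^ 2 - ?z ^ 2"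
  define E where "E = exp (- (?z ^ 2 / d))"
  have u0: "u \<noteq> 0" by (simp add: u_def)
  have d_real: "d = of_real (r\<^sup>2 - x\<^sup>2)" by (simp add: d_def)
  have d0: "d \<noteq> 0" unfolding d_real of_real_eq_0_iff using square_less_if_abs_less[OF x] by simp
  let ?A = "poly (pderiv p) ?z" and ?P = "poly p ?z"
  let ?B = "- of_nat j * 1 / u ^ Suc j" and ?U = "1 / u ^ j"
  let ?C = "- of_nat k * (- 2 * ?z) / d ^ Suc k" and ?V = "1 / d ^ k"
  let ?E = "E * (- (2 * ?z * of_real r ^ 2) / d ^ 2)"
  let ?G = "\<lambda>z. poly p z * (1 / (z + \<i>) ^ j) * (1 / (of_real r ^ 2 - z ^ 2) ^ k) * exp (- (z ^ 2 / (of_real r ^ 2 - z ^ 2)))"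
  have dp: "((\<lambda>z. poly p z) has_field_derivative ?A) (at ?z)" by (rule poly_DERIV)
  have du: "((\<lambda>z. 1 / (z + \<i>) ^ j) has_field_derivative ?B) (at ?z)"
    unfolding u_def by (rule DERIV_one_over_power) (auto intro!: derivative_eq_intros)
  have dd: "((\<lambda>z. 1 / (of_real r ^ 2 - z ^ 2) ^ k) has_field_derivative ?C) (at ?z)"
    unfolding d_def by (rule DERIV_one_over_power) (use d0 in \<open>auto intro!: derivative_eq_intros simp: d_def\<close>)
  have de: "((\<lambda>z. exp (- (z ^ 2 / (of_real r ^ 2 - z ^ 2)))) has_field_derivative ?E) (at ?z)"
  proof -
    have "((\<lambda>z. exp (- (z ^ 2 / (of_real r ^ 2 - z ^ 2)))) has_field_derivative
        E * (- ((2 * ?z * d - ?z ^ 2 * (- (2 * ?z))) / (d * d)))) (at ?z)"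
      unfolding E_def d_def by (rule derivative_eq_intros refl | use d0 in \<open>simp add: d_def\<close>)+
    also have "2 * ?z * d - ?z ^ 2 * (- (2 * ?z)) = 2 * ?z * of_real r ^ 2"
      by (simp add: d_def algebra_simps power2_eq_square)
    finally show ?thesis by (simp add: power2_eq_square)
  qed
  have "(?G has_field_derivative
     (((?A * ?U + ?B * ?P) * ?V + ?C * (?P * ?U)) * E + ?E * (?P * ?U * ?V))) (at ?z)"
    using DERIV_mult[OF DERIV_mult[OF DERIV_mult[OF dp du] dd] de] unfolding u_def d_def E_def .
  moreover have "((?A * ?U + ?B * ?P) * ?V + ?C * (?P * ?U)) * E + ?E * (?P * ?U * ?V)
    = (?A * u * d ^ 2 - of_nat j * (?P * d ^ 2) + 2 * of_nat k * (?P * ?z * u * d) - 2 * of_real r ^ 2 * (?P * ?z * u))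
      * (1 / u ^ Suc j) * (1 / d ^ (k + 2)) * E"
    using u0 d0 by (simp add: field_simps power2_eq_square)
  moreover have "poly q ?z = ?A * u * d ^ 2 - of_nat j * (?P * d ^ 2) + 2 * of_nat k * (?P * ?z * u * d) - 2 * of_real r ^ 2 * (?P * ?z * u)"
    by (simp add: q_def cutoff_deriv_poly_def u_def d_def algebra_simps power2_eq_square)
  moreover have "E = of_real (cutoff r x)"
    using x by (simp add: E_def cutoff_def d_def exp_of_real[symmetric])
  ultimately have "(?G has_field_derivative cutoff_frac r q (Suc j) (k + 2) x) (at ?z)"
    by (simp add: cutoff_frac_def u_def d_def)
  from has_vector_derivative_real_field[OF this]
  show ?thesis
    unfolding q_def[symmetric]
  proof (rule has_vector_derivative_transform_within_open)
    show "open {-r<..<r}" by simp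
    show "?G (of_real y) = cutoff_frac r p j k y" if "y \<in> {-r<..<r}" for y
      using that by (auto simp: cutoff_frac_def cutoff_def exp_of_real[symmetric] abs_if)
  qed (use x in auto)
qed

lemma has_vector_derivative_0_if_quadratic:
  fixes h :: "real \<Rightarrow> complex"
  assumes C: "\<And>y. cmod (h y - h x) \<le> C * (y - x)\<^sup>2"
  shows "(h has_vector_derivative 0) (at x)"
proof -
  have "((\<lambda>y. cmod (h y - h x) / \<bar>y - x\<bar>) \<longlongrightarrow> 0) (at x)"
  proof (rule tendsto_sandwich[OF _ _ tendsto_const])
    show "\<forall>\<^sub>F y in at x. 0 \<le> cmod (h y - h x) / \<bar>y - x\<bar>" by simp
    show "\<forall>\<^sub>F y in at x. cmod (h y - h x) / \<bar>y - x\<bar> \<le> C * \<bar>y - x\<bar>"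
      using C by (auto simp: eventually_at_filter divide_le_eq power2_eq_square mult.assoc abs_mult_self_eq)
    have "((\<lambda>y. C * \<bar>y - x\<bar>) \<longlongrightarrow> C * \<bar>x - x\<bar>) (at x)" by (intro tendsto_intros)
    then show "((\<lambda>y. C * \<bar>y - x\<bar>) \<longlongrightarrow> 0) (at x)" by simp
  qed
  then show ?thesis
    by (simp add: has_vector_derivative_def has_derivative_iff_norm)
qed

text \<open>This is \<open>exp (- t) \<le> (m / t) ^ m\<close> for \<open>t = r\<^sup>2 / (r\<^sup>2 - y\<^sup>2)\<close>.\<close>

lemma cutoff_flat:
  assumes y: "\<bar>y\<bar> < r" and m: "m > 0"
  shows "cutoff r y \<le> exp 1 * (real m / r\<^sup>2) ^ m * (r\<^sup>2 - y\<^sup>2) ^ m"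
proof -
  define t where "t = r\<^sup>2 / (r\<^sup>2 - y\<^sup>2)"
  have d: "r\<^sup>2 - y\<^sup>2 > 0" using square_less_if_abs_less[OF y] by simp
  have "r \<noteq> 0" using y by auto
  then have t: "t > 0" using d by (simp add: t_def)
  have "t / real m \<le> exp (t / real m)" using exp_ge_add_one_self[of "t / real m"] by linarith
  then have "(t / real m) ^ m \<le> exp (t / real m) ^ m"
    using t by (intro power_mono) auto
  also have "\<dots> = exp t" using m by (simp add: exp_of_nat_mult[symmetric])
  finally have "1 / exp t \<le> 1 / (t / real m) ^ m"
    using t m by (intro divide_left_mono) auto
  then have "exp (- t) \<le> (real m / r\<^sup>2) ^ m * (r\<^sup>2 - y\<^sup>2) ^ m"
    by (simp add: exp_minus inverse_eq_divide t_def power_divide power_mult_distrib mult.commute)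
  moreover have "cutoff r y = exp 1 * exp (- t)"
  proof -
    have "- (y\<^sup>2 / (r\<^sup>2 - y\<^sup>2)) = 1 + - t" using d by (simp add: t_def field_simps)
    then show ?thesis using y by (simp add: cutoff_def mult_exp_exp)
  qed
  ultimately show ?thesis by (simp add: mult.assoc)
qed

text \<open>With order of flatness \<open>k + 2\<close> the bump compensates the pole and leaves \<open>(r\<^sup>2 - y\<^sup>2)\<^sup>2\<close>, which is
quadratic in the distance to any point outside the interval.\<close>

lemma cutoff_frac_deriv_outside:
  assumes r: "r > 0" and x: "\<bar>x\<bar> \<ge> r"
  shows "(cutoff_frac r p j k has_vector_derivative 0) (at x)"
proof -
  have "compact ((\<lambda>y. poly p (complex_of_real y)) ` {-r..r})"
    by (intro compact_continuous_image continuous_intros) auto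
  then obtain A where A: "\<And>y. y \<in> {-r..r} \<Longrightarrow> cmod (poly p (of_real y)) \<le> A"
    using compact_imp_bounded bounded_iff by (metis (no_types, lifting) imageI)
  define c where "c = exp 1 * (real (k + 2) / r\<^sup>2) ^ (k + 2)"
  have A0: "A \<ge> 0" using order_trans[OF norm_ge_zero A[of 0]] r by simp
  have c0: "c \<ge> 0" by (simp add: c_def)
  have "cmod (cutoff_frac r p j k y) \<le> (A * c * (2 * r)\<^sup>2) * (y - x)\<^sup>2" for y
  proof (cases "\<bar>y\<bar> < r")
    case True
    let ?d = "r\<^sup>2 - y\<^sup>2"
    have d: "?d > 0" using square_less_if_abs_less[OF True] by simp
    have Ay: "cmod (poly p (of_real y)) \<le> A" using A[of y] True by (simp add: abs_less_iff)
    have u: "cmod (1 / (of_real y + \<i>) ^ j) \<le> 1"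
    proof -
      have "1 \<le> cmod (of_real y + \<i>)"
        using norm_of_real_plus_ii[of y] power_mono[of "cmod (of_real y + \<i>)" 1 2] by (smt (verit) power2_le_imp_le norm_ge_zero one_power2 zero_le_power2)
      then have "1 \<le> cmod (of_real y + \<i>) ^ j" by (rule one_le_power)
      then show ?thesis by (simp add: norm_divide norm_power divide_le_eq_1)
    qed
    have "cmod (cutoff_frac r p j k y) = cmod (poly p (of_real y)) * cmod (1 / (of_real y + \<i>) ^ j) * (1 / ?d ^ k) * cutoff r y"
    proof -
      have "cmod (1 / of_real ?d ^ k) = 1 / ?d ^ k" using d by (simp add: norm_divide norm_power del: of_real_diff)
      moreover have "cmod (of_real (cutoff r y)) = cutoff r y" by (simp add: cutoff_def)
      ultimately show ?thesis by (simp only: cutoff_frac_def norm_mult)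
    qed
    also have "\<dots> \<le> A * 1 * (1 / ?d ^ k) * (c * ?d ^ (k + 2))"
      using d A0 Ay u cutoff_flat[OF True, of "k + 2"] by (intro mult_mono) (auto simp: c_def cutoff_def)
    also have "\<dots> = A * c * ?d\<^sup>2" using d by (simp add: power_add power2_eq_square)
    also have "\<dots> \<le> A * c * (2 * r * \<bar>y - x\<bar>)\<^sup>2"
    proof -
      have "?d = (r + \<bar>y\<bar>) * (r - \<bar>y\<bar>)" by (simp add: algebra_simps power2_eq_square)
      also have "\<dots> \<le> (2 * r) * \<bar>y - x\<bar>" using True x by (intro mult_mono) auto
      finally have "?d\<^sup>2 \<le> (2 * r * \<bar>y - x\<bar>)\<^sup>2" using d by (intro power_mono) auto
      then show ?thesis using A0 c0 by (intro mult_left_mono) auto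
    qed
    finally show ?thesis by (simp add: power_mult_distrib mult_ac)
  qed (use A0 c0 in \<open>simp add: cutoff_frac_def cutoff_def\<close>)
  moreover have "cutoff_frac r p j k x = 0" using x by (simp add: cutoff_frac_def cutoff_def)
  ultimately show ?thesis
    by (intro has_vector_derivative_0_if_quadratic[where C = "A * c * (2 * r)\<^sup>2"]) simp
qed

lemma smooth_cutoff_frac:
  assumes r: "r > 0"
  shows "smooth (cutoff_frac r p j k)"
proof (rule smooth_coinduct[where P = "\<lambda>h. \<exists>p j k. h = cutoff_frac r p j k"])
  fix h
  assume "\<exists>p j k. h = cutoff_frac r p j k"
  then obtain p j k where h: "h = cutoff_frac r p j k" by blast
  define q where "q = cutoff_deriv_poly r p j k"
  have "(h has_vector_derivative cutoff_frac r q (Suc j) (k + 2) x) (at x)" for x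
  proof (cases "\<bar>x\<bar> < r")
    case True
    then show ?thesis unfolding h q_def by (rule cutoff_frac_deriv_inside)
  next
    case False
    then have "cutoff_frac r q (Suc j) (k + 2) x = 0" by (simp add: cutoff_frac_def cutoff_def)
    then show ?thesis unfolding h using cutoff_frac_deriv_outside[OF r, of x] False by simp
  qed
  then show "\<exists>h'. (\<exists>p j k. h' = cutoff_frac r p j k) \<and> (\<forall>x. (h has_vector_derivative h' x) (at x))"
    by blast
qed blast

lemma test_function_cay_cutoff:
  assumes r: "r > 0"
  shows "test_function (\<lambda>x. cay x ^ n * of_real (cutoff r x))"
proof -
  have "cay x = poly [:1, \<i>:] (of_real x) / (of_real x + \<i>)" for x
    by (simp add: cay_def algebra_simps)
  then have eq: "(\<lambda>x. cay x ^ n * of_real (cutoff r x)) = cutoff_frac r ([:1, \<i>:] ^ n) n 0"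
    by (simp add: cutoff_frac_def fun_eq_iff poly_power power_divide)
  have "bounded {x. cutoff_frac r ([:1, \<i>:] ^ n) n 0 x \<noteq> 0}"
    by (rule bounded_subset[of "{-r..r}"]) (auto simp: cutoff_frac_def cutoff_def abs_if split: if_splits)
  then show ?thesis
    unfolding eq using smooth_cutoff_frac[OF r] by (simp add: test_function_def)
qed

lemma cutoff_bounds: "0 \<le> cutoff r x" "cutoff r x \<le> 1"
proof -
  show "0 \<le> cutoff r x" by (simp add: cutoff_def)
  have "0 \<le> x\<^sup>2 / (r\<^sup>2 - x\<^sup>2)" if "\<bar>x\<bar> < r"
    using square_less_if_abs_less[OF that] by simp
  then show "cutoff r x \<le> 1" by (simp add: cutoff_def)
qed

lemma cutoff_scale: "r > 0 \<Longrightarrow> cutoff r (r * x) = cutoff 1 x"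
proof -
  assume r: "r > 0"
  have "r\<^sup>2 - (r * x)\<^sup>2 = r\<^sup>2 * (1 - x\<^sup>2)" by (simp add: power_mult_distrib algebra_simps)
  then have "(r * x)\<^sup>2 / (r\<^sup>2 - (r * x)\<^sup>2) = x\<^sup>2 / (1 - x\<^sup>2)" using r by (simp add: power_mult_distrib)
  moreover have "\<bar>r * x\<bar> < r \<longleftrightarrow> \<bar>x\<bar> < 1" using r by (simp add: abs_mult)
  ultimately show ?thesis by (simp add: cutoff_def)
qed

lemma cutoff_tendsto: "(\<lambda>N. cutoff (real (Suc N)) x) \<longlonglongrightarrow> 1"
proof -
  have "(\<lambda>N. (1 / real (Suc N))\<^sup>2) \<longlonglongrightarrow> 0\<^sup>2" by (intro tendsto_intros one_over_Suc_tendsto_0)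
  then have inv: "(\<lambda>N. 1 / (real (Suc N))\<^sup>2) \<longlonglongrightarrow> 0" by (simp add: power_divide)
  have "(\<lambda>N. exp (- (x\<^sup>2 * (1 / (real (Suc N))\<^sup>2) / (1 - x\<^sup>2 * (1 / (real (Suc N))\<^sup>2))))) \<longlonglongrightarrow> exp (- (x\<^sup>2 * 0 / (1 - x\<^sup>2 * 0)))"
    by (intro tendsto_intros inv) auto
  moreover have "\<forall>\<^sub>F N in sequentially. exp (- (x\<^sup>2 * (1 / (real (Suc N))\<^sup>2) / (1 - x\<^sup>2 * (1 / (real (Suc N))\<^sup>2)))) = cutoff (real (Suc N)) x"
  proof -
    obtain N0 :: nat where N0: "\<bar>x\<bar> < real N0" using reals_Archimedean2 by blast
    show ?thesis
    proof (rule eventually_sequentiallyI[of N0])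
      fix N assume "N0 \<le> N"
      then have "\<bar>x\<bar> < real (Suc N)" using N0 by simp
      moreover have "x\<^sup>2 * (1 / R\<^sup>2) / (1 - x\<^sup>2 * (1 / R\<^sup>2)) = x\<^sup>2 / (R\<^sup>2 - x\<^sup>2)" if "\<bar>x\<bar> < R" for R :: real
        using square_less_if_abs_less[OF that] that by (simp add: divide_simps)
      ultimately show "exp (- (x\<^sup>2 * (1 / (real (Suc N))\<^sup>2) / (1 - x\<^sup>2 * (1 / (real (Suc N))\<^sup>2)))) = cutoff (real (Suc N)) x"
        by (simp add: cutoff_def del: of_nat_Suc)
    qed
  qed
  ultimately show ?thesis by (simp add: tendsto_cong)
qed

definition energy :: "(real \<Rightarrow> complex) \<Rightarrow> real" where
  "energy f = (\<integral>p. (cmod (dquot f p))\<^sup>2 \<partial>plane)"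

lemma finite_energy_cutoff: "r > 0 \<Longrightarrow> finite_energy (\<lambda>x. of_real (cutoff r x))"
  using finite_energy_test_function[OF test_function_cay_cutoff[of r 0]] by simp

text \<open>The substitution \<open>x = r x'\<close>, \<open>y = r y'\<close> produces the factor \<open>r\<^sup>2\<close> from \<open>dx dy\<close> and \<open>1 / r\<^sup>2\<close> from the quotient.\<close>

lemma energy_cutoff:
  assumes r: "r > 0"
  shows "energy (\<lambda>x. of_real (cutoff r x)) = energy (\<lambda>x. of_real (cutoff 1 x))"
proof -
  let ?c = "\<lambda>r x. complex_of_real (cutoff r x)"
  have iter: "energy (?c r) = (LBINT x. (LBINT y. (cmod (dquot (?c r) (x, y)))\<^sup>2))" if "r > 0" for r
    unfolding energy_def
    by (rule lborel_pair.integral_fst'[symmetric]) (rule finite_energyD(3)[OF finite_energy_cutoff[OF that]])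
  have scale: "(cmod (dquot (?c r) (r * x, r * y)))\<^sup>2 = (cmod (dquot (?c 1) (x, y)))\<^sup>2 / r\<^sup>2" for x y
  proof -
    have "dquot (?c r) (r * x, r * y) = dquot (?c 1) (x, y) / of_real r"
      using r by (simp add: dquot_def cutoff_scale right_diff_distrib[symmetric] mult.commute del: of_real_diff)
    then show ?thesis by (simp add: norm_divide power_divide)
  qed
  have "energy (?c r) = \<bar>r\<bar> *\<^sub>R (LBINT x. (LBINT y. (cmod (dquot (?c r) (0 + r * x, y)))\<^sup>2))"
    unfolding iter[OF r] using r by (intro lborel_integral_real_affine) auto
  also have "(\<lambda>x. LBINT y. (cmod (dquot (?c r) (0 + r * x, y)))\<^sup>2)
      = (\<lambda>x. \<bar>r\<bar> *\<^sub>R (LBINT y. (cmod (dquot (?c r) (0 + r * x, 0 + r * y)))\<^sup>2))"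
    using r by (intro ext lborel_integral_real_affine) auto
  finally have "energy (?c r) = \<bar>r\<bar> *\<^sub>R (LBINT x. \<bar>r\<bar> *\<^sub>R (LBINT y. (cmod (dquot (?c 1) (x, y)))\<^sup>2 / r\<^sup>2))"
    by (simp only: add_0_left scale)
  also have "\<dots> = energy (?c 1)"
    using r by (simp add: iter power2_eq_square[of r])
  finally show ?thesis .
qed

lemma dquot_mult: "dquot (\<lambda>x. a x * b x) p = a (fst p) * dquot b p + b (snd p) * dquot a p"
  by (simp add: dquot_def add_divide_distrib[symmetric] algebra_simps)

text \<open>Dilations preserve the energy of the cut-off, so the errors \<open>cay ^ n * (cutoff - 1)\<close> need not become small in energy.
But they stay bounded in energy and tend to \<open>0\<close> pointwise, hence converge weakly to \<open>0\<close>.\<close>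

lemma energy_form_cutoff_tendsto:
  assumes f: "finite_energy f"
  shows "(\<lambda>N. energy_form f (\<lambda>x. cay x ^ n * of_real (cutoff (real (Suc N)) x))) \<longlonglongrightarrow> energy_form f (\<lambda>x. cay x ^ n)"
proof -
  define rho where "rho N = real (Suc N)" for N
  have rho: "rho N > 0" for N by (simp add: rho_def)
  let ?z = "\<lambda>x. cay x ^ n"
  let ?c = "\<lambda>N x. complex_of_real (cutoff (rho N) x)"
  let ?h = "\<lambda>N x. ?z x * ?c N x"
  let ?G = "\<lambda>N p. dquot (?h N) p - dquot ?z p"
  have h: "finite_energy (?h N)" for N
    by (rule finite_energy_test_function[OF test_function_cay_cutoff[OF rho]])
  have c: "finite_energy (?c N)" for N by (rule finite_energy_cutoff[OF rho])
  note z = finite_energy_cay[of n]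
  note [measurable] = finite_energyD(2)[OF f] finite_energyD(2)[OF h] finite_energyD(2)[OF z]
  have bound: "(cmod (?G N p))\<^sup>2 \<le> 4 * (cmod (dquot (?c N) p))\<^sup>2 + 6 * (cmod (dquot ?z p))\<^sup>2" for N p
  proof -
    have "(cmod (dquot (?h N) p))\<^sup>2 \<le> 2 * (cmod (?z (fst p) * dquot (?c N) p))\<^sup>2 + 2 * (cmod (?c N (snd p) * dquot ?z p))\<^sup>2"
      unfolding dquot_mult by (rule norm_add_square_le)
    also have "\<dots> \<le> 2 * (cmod (dquot (?c N) p))\<^sup>2 + 2 * (cmod (dquot ?z p))\<^sup>2"
      using cutoff_bounds[of "rho N" "snd p"]
      by (intro add_mono mult_left_mono power_mono) (auto simp: norm_mult norm_power mult_left_le_one_le)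
    finally have "(cmod (dquot (?h N) p))\<^sup>2 \<le> 2 * (cmod (dquot (?c N) p))\<^sup>2 + 2 * (cmod (dquot ?z p))\<^sup>2" .
    moreover have "(cmod (?G N p))\<^sup>2 \<le> 2 * (cmod (dquot (?h N) p))\<^sup>2 + 2 * (cmod (dquot ?z p))\<^sup>2"
      using norm_add_square_le[of "dquot (?h N) p" "- dquot ?z p"] by simp
    ultimately show ?thesis by linarith
  qed
  have int: "integrable plane (\<lambda>p. 4 * (cmod (dquot (?c N) p))\<^sup>2 + 6 * (cmod (dquot ?z p))\<^sup>2)" for N
    using finite_energyD(3)[OF c[of N]] finite_energyD(3)[OF z] by auto
  have G: "integrable plane (\<lambda>p. (cmod (?G N p))\<^sup>2)" for N
    by (rule Bochner_Integration.integrable_bound[OF int[of N]]) (use bound[of N] in \<open>auto intro!: AE_I2\<close>)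
  have "(\<lambda>N. \<integral>p. dquot f p * ?G N p \<partial>plane) \<longlonglongrightarrow> 0"
  proof (rule integral_mult_tendsto_0_if_L2_bounded[where K = "4 * energy (\<lambda>x. of_real (cutoff 1 x)) + 6 * energy ?z"])
    show "(\<integral>p. (cmod (?G N p))\<^sup>2 \<partial>plane) \<le> 4 * energy (\<lambda>x. of_real (cutoff 1 x)) + 6 * energy ?z" for N
    proof -
      have "(\<integral>p. (cmod (?G N p))\<^sup>2 \<partial>plane) \<le> (\<integral>p. 4 * (cmod (dquot (?c N) p))\<^sup>2 + 6 * (cmod (dquot ?z p))\<^sup>2 \<partial>plane)"
        by (rule integral_mono[OF G int bound])
      also have "\<dots> = 4 * energy (?c N) + 6 * energy ?z"
        unfolding energy_def using finite_energyD(3)[OF c[of N]] finite_energyD(3)[OF z]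
        by (subst Bochner_Integration.integral_add) auto
      also have "energy (?c N) = energy (\<lambda>x. of_real (cutoff 1 x))"
        by (rule energy_cutoff[OF rho])
      finally show ?thesis .
    qed
    show "AE p in plane. (\<lambda>N. ?G N p) \<longlonglongrightarrow> 0"
    proof (rule AE_I2, goal_cases)
      case (1 p)
      have "(\<lambda>N. ?G N p) \<longlonglongrightarrow> (?z (fst p) * of_real 1 - ?z (snd p) * of_real 1) / of_real (fst p - snd p) - dquot ?z p"
        unfolding dquot_def
        by (cases "fst p = snd p") (simp, intro tendsto_intros cutoff_tendsto[folded rho_def], simp)
      then show ?case by (simp add: dquot_def)
    qed
  qed (use finite_energyD(3)[OF f] G in auto)
  moreover have "(\<integral>p. dquot f p * ?G N p \<partial>plane) = energy_form f (?h N) - energy_form f ?z" for N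
    unfolding energy_form_def right_diff_distrib
    by (rule Bochner_Integration.integral_diff; rule integrable_dquot_mult[OF f]; fact h z)
  ultimately have "(\<lambda>N. energy_form f (?h N) - energy_form f ?z) \<longlonglongrightarrow> 0" by simp
  then have "(\<lambda>N. energy_form f (?h N)) \<longlonglongrightarrow> energy_form f ?z" by (simp add: LIM_zero_iff)
  then show ?thesis unfolding rho_def .
qed

section \<open>The operators on the modes\<close>

lemma cnj_measurable:
  assumes "f \<in> borel_measurable M"
  shows "(\<lambda>x. cnj (f x)) \<in> borel_measurable M"
  by (rule measurable_compose[OF assms borel_measurable_continuous_onI[OF continuous_on_cnj]])
    (auto intro: continuous_intros)

lemma finite_energy_cnj:
  assumes f: "finite_energy f"
  shows "finite_energy (\<lambda>x. cnj (f x))"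
proof -
  have "cmod (dquot (\<lambda>x. cnj (f x)) p) = cmod (dquot f p)" for p
    using complex_mod_cnj[of "f (fst p) - f (snd p)"]
    by (simp add: dquot_def norm_divide del: of_real_diff complex_mod_cnj)
  moreover have "integrable lborel (\<lambda>x. cnj (f x * of_real (wt x)))"
    using finite_energyD(1)[OF f] by (intro integrable_cnj) (simp add: wt_integrable_def)
  ultimately show ?thesis
    using f cnj_measurable[OF finite_energyD(2)[OF f]] by (simp add: finite_energy_def wt_integrable_def)
qed

lemma circ_coeff_cnj: "circ_coeff (\<lambda>x. cnj (f x)) k = cnj (circ_coeff f (- k))"
proof -
  have conj: "cnj (f x * cay x powi (- k) * of_real (wt x)) = cnj (f x) * cay x powi k * of_real (wt x)" for x
    by (simp add: cnj_cay power_int_minus power_int_inverse)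
  then show ?thesis
    unfolding circ_coeff_def by (simp only: Bochner_Integration.integral_cnj[symmetric] conj)
qed

lemma energy_form_cnj: "energy_form (\<lambda>x. cnj (f x)) (\<lambda>x. cnj (g x)) = cnj (energy_form f g)"
proof -
  have conj: "cnj (dquot f p * dquot g p) = dquot (\<lambda>x. cnj (f x)) p * dquot (\<lambda>x. cnj (g x)) p" for p
    by (simp add: dquot_def)
  then show ?thesis
    unfolding energy_form_def by (simp only: Bochner_Integration.integral_cnj[symmetric] conj)
qed

lemma energy_form_cnj_cay:
  assumes f: "finite_energy f"
  shows "energy_form f (\<lambda>x. cnj (cay x ^ n)) = 4 * of_real pi * of_nat n * circ_coeff f (- int n)"
  using energy_form_cnj[of "\<lambda>x. cnj (f x)" "\<lambda>x. cay x ^ n"] energy_form_cay[OF finite_energy_cnj[OF f], of n]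
  by (simp add: circ_coeff_cnj)

lemma chord_kernel_cnj_cay:
  "(LBINT y. of_real (chord_kernel j x y) * cnj (cay y ^ n))
    = 4 * of_real pi * of_real (wt x) * of_nat (j - n) * cnj (cay x ^ n)"
proof -
  have "(LBINT y. cnj (of_real (chord_kernel j x y) * cay y ^ n)) = cnj (4 * of_real pi * of_real (wt x) * of_nat (j - n) * cay x ^ n)"
    unfolding Bochner_Integration.integral_cnj chord_kernel_cay by (rule refl)
  then show ?thesis by simp
qed

lemma finite_energy_cnj_cay: "finite_energy (\<lambda>x. cnj (cay x ^ n))"
  by (rule finite_energy_cnj[OF finite_energy_cay])

definition wt_pairing :: "(real \<Rightarrow> complex) \<Rightarrow> (real \<Rightarrow> complex) \<Rightarrow> complex" where
  "wt_pairing F \<phi> = (LBINT x. F x * \<phi> x * of_real (wt x))"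

lemma wt_pairing_cay: "wt_pairing (\<lambda>x. cay x ^ n) \<phi> = circ_coeff \<phi> (int n)"
  by (simp add: wt_pairing_def circ_coeff_def mult_ac)

lemma wt_pairing_cnj_cay: "wt_pairing (\<lambda>x. cnj (cay x ^ n)) \<phi> = circ_coeff \<phi> (- int n)"
  by (simp add: wt_pairing_def circ_coeff_def mult_ac cnj_cay power_int_minus power_inverse)

text \<open>The distribution \<open>L\<^sub>+ F\<close>, expressed by the energy form.\<close>

definition plus_dist :: "nat \<Rightarrow> (real \<Rightarrow> complex) \<Rightarrow> (real \<Rightarrow> complex) \<Rightarrow> complex" where
  "plus_dist m F \<phi> = energy_form F \<phi> / (2 * pi) - 2 * of_nat m * wt_pairing F \<phi>"

text \<open>The distribution \<open>R F\<close>.\<close>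

definition chord_dist :: "nat \<Rightarrow> (real \<Rightarrow> complex) \<Rightarrow> (real \<Rightarrow> complex) \<Rightarrow> complex" where
  "chord_dist m F \<phi> =
    (LBINT x. (LBINT y. of_real (chord_kernel m x y) * F y) * \<phi> x) / (2 * pi)"

lemma chord_kernel_swap:
  assumes F: "wt_integrable F" and [measurable]: "\<phi> \<in> borel_measurable borel" and B: "\<And>x. cmod (\<phi> x) \<le> B"
  shows "integrable lborel (\<lambda>x. (LBINT y. of_real (chord_kernel m x y) * F y) * \<phi> x)" (is ?I)
    and "(LBINT x. (LBINT y. of_real (chord_kernel m x y) * F y) * \<phi> x)
      = (LBINT y. F y * (LBINT x. of_real (chord_kernel m y x) * \<phi> x))" (is ?E)
proof -
  have [measurable]: "F \<in> borel_measurable borel" using F by (rule wt_integrableD)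
  let ?h = "\<lambda>x y. of_real (chord_kernel m x y) * F y * \<phi> x"
  have B0: "B \<ge> 0" using order_trans[OF norm_ge_zero B] .
  have int: "integrable plane (\<lambda>(x, y). ?h x y)"
  proof (rule Bochner_Integration.integrable_bound)
    show "integrable plane (\<lambda>p. of_real (4 * (real m)\<^sup>2 * B) * (of_real (wt (fst p)) * (F (snd p) * of_real (wt (snd p)))))"
      (is "integrable _ ?G")
      using F by (intro integrable_mult_right integrable_plane_product integrable_of_real integrable_wt) (simp add: wt_integrable_def)
    have "chord_kernel m x y * cmod (F y) * cmod (\<phi> x) \<le> (4 * (real m)\<^sup>2 * wt x * wt y) * cmod (F y) * B" for x y
      by (intro mult_mono B chord_kernel_le) (auto simp: B0)
    then show "AE p in plane. norm (case p of (x, y) \<Rightarrow> ?h x y) \<le> norm (?G p)"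
      using B0 by (auto simp: norm_mult norm_power mult_ac)
  qed measurable
  have eq: "(LBINT y. of_real (chord_kernel m x y) * F y) * \<phi> x = (LBINT y. ?h x y)" for x
    by simp
  show ?I unfolding eq using lborel_pair.integrable_fst'[OF int] by simp
  have "(LBINT x. (LBINT y. ?h x y)) = (LBINT y. (LBINT x. ?h x y))"
    by (rule lborel_pair.Fubini_integral[OF int, symmetric])
  also have "\<dots> = (LBINT y. F y * (LBINT x. of_real (chord_kernel m y x) * \<phi> x))"
    by (subst chord_kernel_commute) (simp add: mult_ac flip: integral_mult_right_zero)
  finally show ?E unfolding eq .
qed

lemma wt_pairing_integrable:
  assumes F: "wt_integrable F" and \<phi>: "test_function \<phi>"
  shows "integrable lborel (\<lambda>x. F x * \<phi> x * of_real (wt x))"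
proof -
  obtain B where "\<And>x. cmod (\<phi> x) \<le> B" using test_function_bounded[OF \<phi>] by blast
  from wt_integrable_mult_bounded[OF F test_function_measurable[OF \<phi>] this]
  show ?thesis by (simp add: wt_integrable_def)
qed

text \<open>Complex coefficients are allowed because \<open>f_k\<close> and \<open>g_k\<close> are complex combinations of \<open>cay ^ k\<close> and its conjugate.\<close>

lemma plus_dist_lincomb:
  assumes F: "finite_energy F" and G: "finite_energy G" and \<phi>: "test_function \<phi>"
  shows "plus_dist m (\<lambda>x. a * F x + b * G x) \<phi> = a * plus_dist m F \<phi> + b * plus_dist m G \<phi>"
proof -
  note \<phi>e = finite_energy_test_function[OF \<phi>]
  have "energy_form (\<lambda>x. a * F x + b * G x) \<phi>
      = (\<integral>p. a * (dquot F p * dquot \<phi> p) + b * (dquot G p * dquot \<phi> p) \<partial>plane)"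
    unfolding energy_form_def by (simp add: dquot_add dquot_cmult algebra_simps)
  also have "\<dots> = a * energy_form F \<phi> + b * energy_form G \<phi>"
    unfolding energy_form_def using integrable_dquot_mult[OF F \<phi>e] integrable_dquot_mult[OF G \<phi>e]
    by (subst Bochner_Integration.integral_add) auto
  finally have 1: "energy_form (\<lambda>x. a * F x + b * G x) \<phi> = a * energy_form F \<phi> + b * energy_form G \<phi>" .
  have "wt_pairing (\<lambda>x. a * F x + b * G x) \<phi>
      = (LBINT x. a * (F x * \<phi> x * of_real (wt x)) + b * (G x * \<phi> x * of_real (wt x)))"
    unfolding wt_pairing_def by (simp add: algebra_simps)
  also have "\<dots> = a * wt_pairing F \<phi> + b * wt_pairing G \<phi>"
    unfolding wt_pairing_def
    using wt_pairing_integrable[OF finite_energyD(1)[OF F] \<phi>] wt_pairing_integrable[OF finite_energyD(1)[OF G] \<phi>]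
    by (subst Bochner_Integration.integral_add) auto
  finally show ?thesis
    unfolding plus_dist_def 1 by (simp add: algebra_simps add_divide_distrib)
qed

lemma chord_dist_lincomb:
  assumes F: "finite_energy F" and G: "finite_energy G" and \<phi>: "test_function \<phi>"
  shows "chord_dist m (\<lambda>x. a * F x + b * G x) \<phi> = a * chord_dist m F \<phi> + b * chord_dist m G \<phi>"
proof -
  let ?K = "\<lambda>F x. \<integral>y. of_real (chord_kernel m x y) * F y \<partial>lborel"
  note Fw = finite_energyD(1)[OF F] and Gw = finite_energyD(1)[OF G]
  obtain B where B: "\<And>x. cmod (\<phi> x) \<le> B" using test_function_bounded[OF \<phi>] by blast
  have "?K (\<lambda>x. a * F x + b * G x) x = (LBINT y. a * (of_real (chord_kernel m x y) * F y) + b * (of_real (chord_kernel m x y) * G y))" for x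
    by (simp add: algebra_simps)
  also have "\<dots> x = a * ?K F x + b * ?K G x" for x
    using chord_kernel_apply(1)[OF Fw, of m x] chord_kernel_apply(1)[OF Gw, of m x]
    by (subst Bochner_Integration.integral_add) auto
  finally have "(LBINT x. ?K (\<lambda>x. a * F x + b * G x) x * \<phi> x) = (LBINT x. a * (?K F x * \<phi> x) + b * (?K G x * \<phi> x))"
    by (simp add: algebra_simps)
  also have "\<dots> = a * (LBINT x. ?K F x * \<phi> x) + b * (LBINT x. ?K G x * \<phi> x)"
    using chord_kernel_swap(1)[OF Fw test_function_measurable[OF \<phi>] B, of m]
      chord_kernel_swap(1)[OF Gw test_function_measurable[OF \<phi>] B, of m]
    by (subst Bochner_Integration.integral_add) auto
  finally show ?thesis
    unfolding chord_dist_def by (simp add: add_divide_distrib)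
qed

text \<open>The energy form is symmetric, so it can be evaluated with the test function as the function of finite energy.\<close>

lemma plus_dist_cay:
  assumes \<phi>: "test_function \<phi>"
  shows "plus_dist m (\<lambda>x. cay x ^ k) \<phi> = 2 * (of_nat k - of_nat m) * circ_coeff \<phi> (int k)"
    and "plus_dist m (\<lambda>x. cnj (cay x ^ k)) \<phi> = 2 * (of_nat k - of_nat m) * circ_coeff \<phi> (- int k)"
  using energy_form_cay[OF finite_energy_test_function[OF \<phi>], of k]
    energy_form_cnj_cay[OF finite_energy_test_function[OF \<phi>], of k]
  by (simp_all add: plus_dist_def wt_pairing_cay wt_pairing_cnj_cay energy_form_commute[of _ \<phi>] algebra_simps
      del: complex_cnj_power)

lemma chord_dist_cay:
  "chord_dist m (\<lambda>x. cay x ^ k) \<phi> = 2 * of_nat (m - k) * circ_coeff \<phi> (int k)"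
  "chord_dist m (\<lambda>x. cnj (cay x ^ k)) \<phi> = 2 * of_nat (m - k) * circ_coeff \<phi> (- int k)"
proof -
  have *: "(LBINT x. 4 * of_real pi * of_real (wt x) * c * h x * \<phi> x) = 4 * of_real pi * c * wt_pairing h \<phi>"
    for c :: complex and h
    unfolding wt_pairing_def by (subst integral_mult_right_zero[symmetric]) (simp add: mult_ac)
  show "chord_dist m (\<lambda>x. cay x ^ k) \<phi> = 2 * of_nat (m - k) * circ_coeff \<phi> (int k)"
    unfolding chord_dist_def chord_kernel_cay * wt_pairing_cay by simp
  show "chord_dist m (\<lambda>x. cnj (cay x ^ k)) \<phi> = 2 * of_nat (m - k) * circ_coeff \<phi> (- int k)"
    unfolding chord_dist_def chord_kernel_cnj_cay * wt_pairing_cnj_cay by simp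
qed

abbreviation cut_mode :: "nat \<Rightarrow> nat \<Rightarrow> real \<Rightarrow> complex" where
  "cut_mode n N \<equiv> \<lambda>x. cay x ^ n * of_real (cutoff (real (Suc N)) x)"

lemma test_function_cut_mode: "test_function (cut_mode n N)"
  by (rule test_function_cay_cutoff) simp

lemma norm_cut_mode_le: "cmod (cut_mode n N x) \<le> 1"
  using cutoff_bounds[of "real (Suc N)" x] by (simp add: norm_mult norm_power)

lemma cut_mode_tendsto: "(\<lambda>N. cut_mode n N x) \<longlonglongrightarrow> cay x ^ n"
proof -
  have "(\<lambda>N. cut_mode n N x) \<longlonglongrightarrow> cay x ^ n * of_real 1"
    by (intro tendsto_mult tendsto_const tendsto_of_real cutoff_tendsto)
  then show ?thesis by simp
qed

lemma integral_cut_mode_tendsto: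
  assumes h: "integrable lborel h"
  shows "(\<lambda>N. LBINT x. h x * cut_mode n N x) \<longlonglongrightarrow> (LBINT x. h x * cay x ^ n)"
proof (rule integral_dominated_convergence[where w = "\<lambda>x. cmod (h x)"])
  show "AE x in lborel. (\<lambda>N. h x * cut_mode n N x) \<longlonglongrightarrow> h x * cay x ^ n"
    by (intro AE_I2 tendsto_mult tendsto_const cut_mode_tendsto)
  show "AE x in lborel. norm (h x * cut_mode n N x) \<le> cmod (h x)" for N
  proof (rule AE_I2, goal_cases)
    case (1 x)
    show ?case
      using mult_left_mono[OF norm_cut_mode_le[of x n N], of "cmod (h x)"] by (simp add: norm_mult)
  qed
  note [measurable] = borel_measurable_integrable[OF h]
  show "(\<lambda>x. h x * cut_mode n N x) \<in> borel_measurable lborel" for N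
    unfolding cutoff_def by measurable
  show "(\<lambda>x. h x * cay x ^ n) \<in> borel_measurable lborel" by measurable
qed (use h in auto)

lemma plus_dist_cut_mode_tendsto:
  assumes F: "finite_energy F"
  shows "(\<lambda>N. plus_dist m F (cut_mode n N)) \<longlonglongrightarrow> 2 * (of_nat n - of_nat m) * circ_coeff F (int n)"
proof -
  have "integrable lborel (\<lambda>x. F x * of_real (wt x))"
    using finite_energyD(1)[OF F] by (simp add: wt_integrable_def)
  from integral_cut_mode_tendsto[OF this, of n]
  have "(\<lambda>N. wt_pairing F (cut_mode n N)) \<longlonglongrightarrow> circ_coeff F (int n)"
    by (simp add: wt_pairing_def circ_coeff_def mult_ac)
  then have "(\<lambda>N. plus_dist m F (cut_mode n N)) \<longlonglongrightarrow>
      energy_form F (\<lambda>x. cay x ^ n) / (2 * pi) - 2 * of_nat m * circ_coeff F (int n)"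
    unfolding plus_dist_def by (intro tendsto_intros energy_form_cutoff_tendsto F) auto
  then show ?thesis by (simp add: energy_form_cay[OF F] algebra_simps)
qed

lemma chord_dist_cut_mode_tendsto:
  assumes F: "finite_energy F"
  shows "(\<lambda>N. chord_dist m F (cut_mode n N)) \<longlonglongrightarrow> 2 * of_nat (m - n) * circ_coeff F (int n)"
proof -
  note Fw = finite_energyD(1)[OF F]
  have K: "integrable lborel (\<lambda>x. LBINT y. of_real (chord_kernel m x y) * F y)"
    using chord_kernel_swap(1)[OF Fw, of "\<lambda>_. 1" 1 m] by simp
  have "(\<lambda>N. chord_dist m F (cut_mode n N)) \<longlonglongrightarrow>
      (LBINT x. (LBINT y. of_real (chord_kernel m x y) * F y) * cay x ^ n) / (2 * pi)"
    unfolding chord_dist_def by (intro tendsto_divide tendsto_const integral_cut_mode_tendsto K) auto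
  also have "(LBINT x. (LBINT y. of_real (chord_kernel m x y) * F y) * cay x ^ n)
     = (LBINT y. F y * (4 * of_real pi * of_real (wt y) * of_nat (m - n) * cay y ^ n))"
    by (subst chord_kernel_swap(2)[OF Fw, where B = 1]) (auto simp: norm_power chord_kernel_cay)
  also have "\<dots> = 4 * of_real pi * of_nat (m - n) * circ_coeff F (int n)"
    unfolding circ_coeff_def by (subst integral_mult_right_zero[symmetric]) (simp add: mult_ac)
  finally show ?thesis by (simp add: mult_ac)
qed

section \<open>Functions modulo null sets\<close>

abbreviation cplx :: "(real \<Rightarrow> real) \<Rightarrow> real \<Rightarrow> complex" where
  "cplx f \<equiv> \<lambda>x. complex_of_real (f x)"

text \<open>Local integrability follows from integrability against \<open>wt\<close>, which is bounded below on compact sets.\<close>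

lemma Hdot_half_iff_finite_energy:
  assumes [measurable]: "f \<in> borel_measurable borel"
  shows "ae_class f \<in> Hdot_half \<longleftrightarrow> finite_energy (cplx f)"
proof -
  have [measurable]: "f \<in> borel_measurable lebesgue"
    by (rule measurable_completion) simp
  have poisson: "poisson_integrable (ae_class f) \<longleftrightarrow> wt_integrable (cplx f)"
  proof -
    have "integrable lborel (\<lambda>x. cmod (cplx f x * of_real (wt x))) \<longleftrightarrow> integrable lborel (\<lambda>x. cplx f x * of_real (wt x))"
      by (rule integrable_norm_iff) measurable
    moreover have "cmod (cplx f x * of_real (wt x)) = \<bar>f x\<bar> / (1 + x\<^sup>2)" for x
      unfolding norm_mult norm_of_real by (simp add: wt_def)
    ultimately have "integrable lborel (\<lambda>x. \<bar>f x\<bar> / (1 + x\<^sup>2)) \<longleftrightarrow> wt_integrable (cplx f)"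
      by (simp add: wt_integrable_def)
    then show ?thesis
      unfolding poisson_integrable.abs_eq by (subst integrable_completion) auto
  qed
  have loc: "L1_loc (ae_class f)" if wt: "wt_integrable (cplx f)"
  proof -
    have "set_integrable lebesgue K f" if "compact K" for K
    proof -
      obtain M where M: "\<And>x. x \<in> K \<Longrightarrow> \<bar>x\<bar> \<le> M"
        using compact_imp_bounded[OF \<open>compact K\<close>] by (auto simp: bounded_iff)
      have [measurable]: "K \<in> sets borel" using \<open>compact K\<close> by (simp add: borel_compact)
      have "integrable lborel (\<lambda>x. indicator K x *\<^sub>R f x)"
      proof (rule Bochner_Integration.integrable_bound)
        show "integrable lborel (\<lambda>x. of_real (1 + M\<^sup>2) * (cplx f x * of_real (wt x)))" (is "integrable _ ?G")
          using wt by (auto simp: wt_integrable_def)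
        show "AE x in lborel. norm (indicator K x *\<^sub>R f x) \<le> norm (?G x)"
        proof (rule AE_I2, goal_cases)
          case (1 x)
          have "1 * \<bar>f x\<bar> \<le> ((1 + M\<^sup>2) * wt x) * \<bar>f x\<bar>" if "x \<in> K"
            using wt_ge[OF M[OF that]] one_plus_square_pos[of M]
            by (intro mult_right_mono) (auto simp: divide_le_eq mult.commute)
          then show ?case
            unfolding norm_mult norm_of_real using one_plus_square_pos[of M]
            by (cases "x \<in> K") (auto simp: mult_ac)
        qed
      qed measurable
      then show ?thesis
        unfolding set_integrable_def by (subst integrable_completion) auto
    qed
    then show ?thesis
      unfolding L1_loc.abs_eq by simp
  qed
  have norm2: "Hdot_half_norm2 (ae_class f) < \<infinity> \<longleftrightarrow> integrable plane (\<lambda>p. (cmod (dquot (cplx f) p))\<^sup>2)"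
  proof -
    let ?q = "\<lambda>p. ennreal ((cmod (dquot (cplx f) p))\<^sup>2)"
    have q: "ennreal (\<bar>f x - f y\<bar>\<^sup>2 / \<bar>x - y\<bar>\<^sup>2) = ?q (x, y)" for x y
      by (simp add: dquot_def norm_divide power_divide flip: of_real_diff)
    have "Hdot_half_norm2 (ae_class f) = ennreal (1 / (2 * pi)) * (\<integral>\<^sup>+ x. (\<integral>\<^sup>+ y. ?q (x, y) \<partial>lborel) \<partial>lborel)"
      unfolding Hdot_half_norm2.abs_eq nn_integral_completion q ..
    also have "(\<integral>\<^sup>+ x. (\<integral>\<^sup>+ y. ?q (x, y) \<partial>lborel) \<partial>lborel) = (\<integral>\<^sup>+ p. ?q p \<partial>plane)"
      by (rule lborel.nn_integral_fst) measurable
    finally show ?thesis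
      by (auto simp: ennreal_mult_less_top integrable_iff_bounded)
  qed
  show ?thesis
    unfolding Hdot_half_def finite_energy_def using poisson loc norm2 by auto
qed

lemma ae_class_eq_iff: "ae_class f = ae_class g \<longleftrightarrow> (AE x in lborel. f x = g x)"
  unfolding ae_fun.abs_eq_iff AE_completion_iff ..

lemma Hdot_half_borel_rep:
  assumes "u \<in> Hdot_half"
  obtains f where "f \<in> borel_measurable borel" "u = ae_class f" "finite_energy (cplx f)"
proof -
  have "\<exists>g. u = ae_class g" by (rule ae_fun.abs_induct) auto
  then obtain g where g: "u = ae_class g" by blast
  then have "g \<in> borel_measurable lebesgue"
    using assms by (simp add: Hdot_half_def L1_loc.abs_eq)
  then obtain f where f: "f \<in> borel_measurable lborel" "AE x in lborel. g x = f x"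
    using completion_ex_borel_measurable_real by blast
  then have "u = ae_class f" by (simp add: g ae_class_eq_iff)
  with f(1) assms show ?thesis
    using that[of f] Hdot_half_iff_finite_energy[of f] by simp
qed

lemma pairing_borel:
  assumes [measurable]: "f \<in> borel_measurable borel" "\<psi> \<in> borel_measurable borel"
  shows "pairing (ae_class f) \<psi> = (LBINT x. cplx f x * \<psi> x)"
  unfolding pairing.abs_eq by (rule integral_lebesgue_eq_lborel) measurable

lemma Lplus_eq_plus_dist:
  assumes [measurable]: "f \<in> borel_measurable borel" and f: "finite_energy (cplx f)" and \<phi>: "test_function \<phi>"
  shows "Lplus m (ae_class f) \<phi> = plus_dist m (cplx f) \<phi>"
proof -
  note [measurable] = test_function_measurable[OF \<phi>] abs_nabla_measurable[OF \<phi>]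
  have "pairing (ae_class f) (\<lambda>x. of_real (2 * real m / (1 + x\<^sup>2)) * \<phi> x)
      = (LBINT x. 2 * of_nat m * (cplx f x * \<phi> x * of_real (wt x)))"
    by (subst pairing_borel) (auto simp: wt_def mult_ac)
  also have "\<dots> = 2 * of_nat m * wt_pairing (cplx f) \<phi>"
    unfolding integral_mult_right_zero wt_pairing_def ..
  finally show ?thesis
    unfolding Lplus_def abs_nabla_dist_def plus_dist_def
    by (simp add: pairing_borel abs_nabla_pairing[OF f \<phi>])
qed

lemma norm_Q_diff: "(norm (Q m x - Q m y))\<^sup>2 = (cmod (cay x ^ m - cay y ^ m))\<^sup>2"
proof -
  have "(norm (Q m x - Q m y))\<^sup>2 = (f_k m x - f_k m y)\<^sup>2 + (g_k m x - g_k m y)\<^sup>2"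
    unfolding power2_norm_eq_inner by (simp add: Q_def inner_vec_def sum_3 power2_eq_square)
  then show ?thesis
    by (simp add: cmod_power2 f_k_def g_k_def cay_def)
qed

lemma R_borel:
  assumes [measurable]: "f \<in> borel_measurable borel"
  shows "of_real (R m (ae_class f) x) = (LBINT y. of_real (chord_kernel m x y) * cplx f y) / (2 * pi)"
proof -
  have "R m (ae_class f) x = (\<integral>y. chord_kernel m x y * f y \<partial>lebesgue) / (2 * pi)"
    unfolding R.abs_eq norm_Q_diff by (simp add: chord_kernel_def)
  also have "(\<integral>y. chord_kernel m x y * f y \<partial>lebesgue) = (LBINT y. chord_kernel m x y * f y)"
    by (rule integral_lebesgue_eq_lborel) measurable
  finally show ?thesis
    by (simp flip: integral_complex_of_real)
qed

lemma Lminus_eq_dist: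
  assumes [measurable]: "f \<in> borel_measurable borel" and f: "finite_energy (cplx f)" and \<phi>: "test_function \<phi>"
  shows "Lminus m (ae_class f) \<phi> = plus_dist m (cplx f) \<phi> + chord_dist m (cplx f) \<phi>"
proof -
  note [measurable] = test_function_measurable[OF \<phi>]
  have "(\<integral>x. of_real (R m (ae_class f) x) * \<phi> x \<partial>lebesgue) = chord_dist m (cplx f) \<phi>"
    unfolding R_borel[OF assms(1)] chord_dist_def
    by (subst integral_lebesgue_eq_lborel) auto
  then show ?thesis
    unfolding Lminus_def Lplus_eq_plus_dist[OF assms] by simp
qed

section \<open>Trigonometric sums\<close>

lemma cplx_f_k: "cplx (f_k k) = (\<lambda>x. 1 / 2 * cay x ^ k + 1 / 2 * cnj (cay x ^ k))"
  by (rule ext) (auto simp: f_k_def cay_def complex_eq_iff simp del: complex_cnj_power)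

lemma cplx_g_k: "cplx (g_k k) = (\<lambda>x. - \<i> / 2 * cay x ^ k + \<i> / 2 * cnj (cay x ^ k))"
  by (rule ext) (auto simp: g_k_def cay_def complex_eq_iff simp del: complex_cnj_power)

lemma finite_energy_f_k: "finite_energy (cplx (f_k k))"
  unfolding cplx_f_k by (intro finite_energy_add finite_energy_cmult finite_energy_cay finite_energy_cnj_cay)

lemma finite_energy_g_k: "finite_energy (cplx (g_k k))"
  unfolding cplx_g_k by (intro finite_energy_add finite_energy_cmult finite_energy_cay finite_energy_cnj_cay)

lemma f_k_measurable [measurable]: "f_k k \<in> borel_measurable borel"
  using measurable_compose[OF finite_energyD(2)[OF finite_energy_f_k[of k]] borel_measurable_Re] by simp

lemma g_k_measurable [measurable]: "g_k k \<in> borel_measurable borel"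
  using measurable_compose[OF finite_energyD(2)[OF finite_energy_g_k[of k]] borel_measurable_Re] by simp

lemma circ_coeff_lincomb:
  assumes F: "wt_integrable F" and G: "wt_integrable G"
  shows "circ_coeff (\<lambda>x. a * F x + b * G x) k = a * circ_coeff F k + b * circ_coeff G k"
proof -
  have "circ_coeff (\<lambda>x. a * F x + b * G x) k
      = (LBINT x. a * (F x * cay x powi k * of_real (wt x)) + b * (G x * cay x powi k * of_real (wt x)))"
    unfolding circ_coeff_def by (simp add: algebra_simps)
  then show ?thesis
    unfolding circ_coeff_def using wt_integrable_coeff[OF F, of k] wt_integrable_coeff[OF G, of k]
    by (subst (asm) Bochner_Integration.integral_add) auto
qed

text \<open>The squared norm of \<open>f_k\<close>, and of \<open>g_k\<close> for \<open>k > 0\<close>, with respect to \<open>wt\<close>.\<close>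

definition mode_mass :: "nat \<Rightarrow> real" where
  "mode_mass k = (if k = 0 then pi else pi / 2)"

lemma mode_mass_pos: "mode_mass k > 0"
  by (simp add: mode_mass_def)

lemma circ_coeff_cay_power: "circ_coeff (\<lambda>x. cay x ^ k) l = (if l = - int k then of_real pi else 0)"
  using circ_coeff_cay[of "int k" l] by simp

lemma circ_coeff_cnj_cay: "circ_coeff (\<lambda>x. cnj (cay x ^ k)) l = (if l = int k then of_real pi else 0)"
  unfolding circ_coeff_cnj circ_coeff_cay_power by auto

lemma circ_coeff_f_k: "circ_coeff (cplx (f_k k)) (int l) = (if l = k then of_real (mode_mass k) else 0)"
  unfolding cplx_f_k
  by (subst circ_coeff_lincomb)
    (auto simp: wt_integrable_cay finite_energyD(1)[OF finite_energy_cnj_cay] mode_mass_def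
      circ_coeff_cay_power circ_coeff_cnj_cay simp del: complex_cnj_power)

lemma circ_coeff_g_k:
  assumes "k > 0"
  shows "circ_coeff (cplx (g_k k)) (int l) = (if l = k then \<i> * of_real (mode_mass k) else 0)"
  unfolding cplx_g_k
  by (subst circ_coeff_lincomb)
    (use assms in \<open>auto simp: wt_integrable_cay finite_energyD(1)[OF finite_energy_cnj_cay] mode_mass_def
      circ_coeff_cay_power circ_coeff_cnj_cay simp del: complex_cnj_power\<close>)

text \<open>The index \<open>0\<close> is left out in the second sum because \<open>g_0 = 0\<close>.\<close>

definition trig_sum :: "nat set \<Rightarrow> (nat \<Rightarrow> real) \<Rightarrow> (nat \<Rightarrow> real) \<Rightarrow> real \<Rightarrow> real" where
  "trig_sum S a b x = (\<Sum>k\<in>S. a k * f_k k x) + (\<Sum>k\<in>S - {0}. b k * g_k k x)"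

lemma sum_coeff:
  assumes "finite S" and h: "\<And>k. k \<in> S \<Longrightarrow> finite_energy (cplx (h k))"
  shows "finite_energy (cplx (\<lambda>x. \<Sum>k\<in>S. c k * h k x)) \<and>
    circ_coeff (cplx (\<lambda>x. \<Sum>k\<in>S. c k * h k x)) l = (\<Sum>k\<in>S. of_real (c k) * circ_coeff (cplx (h k)) l)"
  using assms
proof (induction S)
  case empty
  have "finite_energy (\<lambda>_. 0)"
    using finite_energy_cmult[OF finite_energy_cay[of 0], of 0] by simp
  then show ?case by (simp add: circ_coeff_def)
next
  case (insert k S)
  let ?r = "\<lambda>x. \<Sum>k\<in>S. c k * h k x"
  have IH: "finite_energy (cplx ?r)" "circ_coeff (cplx ?r) l = (\<Sum>k\<in>S. of_real (c k) * circ_coeff (cplx (h k)) l)"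
    using insert by auto
  have k: "finite_energy (cplx (h k))" using insert by simp
  have eq: "cplx (\<lambda>x. \<Sum>k\<in>insert k S. c k * h k x) = (\<lambda>x. of_real (c k) * cplx (h k) x + 1 * cplx ?r x)"
    using insert by (simp add: fun_eq_iff)
  show ?case
    unfolding eq circ_coeff_lincomb[OF finite_energyD(1)[OF k] finite_energyD(1)[OF IH(1)]]
    using insert.hyps IH k by (auto intro: finite_energy_add finite_energy_cmult)
qed

lemma finite_energy_trig_sum: "finite S \<Longrightarrow> finite_energy (cplx (trig_sum S a b))"
  using finite_energy_add[OF conjunct1[OF sum_coeff[of S f_k a]] conjunct1[OF sum_coeff[of "S - {0}" g_k b]]]
  by (simp add: trig_sum_def[abs_def] finite_energy_f_k finite_energy_g_k)

lemma circ_coeff_trig_sum: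
  assumes S: "finite S"
  shows "circ_coeff (cplx (trig_sum S a b)) (int l) =
    (if l \<in> S then of_real (mode_mass l) * (of_real (a l) + (if l = 0 then 0 else \<i> * of_real (b l))) else 0)"
proof -
  note f = sum_coeff[where h = f_k and c = a and l = "int l", OF S finite_energy_f_k]
  note g = sum_coeff[where S = "S - {0}" and h = g_k and c = b and l = "int l", OF finite_Diff[OF S] finite_energy_g_k]
  have eq: "cplx (trig_sum S a b) = (\<lambda>x. 1 * cplx (\<lambda>x. \<Sum>k\<in>S. a k * f_k k x) x + 1 * cplx (\<lambda>x. \<Sum>k\<in>S - {0}. b k * g_k k x) x)"
    by (simp add: trig_sum_def fun_eq_iff)
  have "circ_coeff (cplx (trig_sum S a b)) (int l) =
      (\<Sum>k\<in>S. of_real (a k) * circ_coeff (cplx (f_k k)) (int l)) + (\<Sum>k\<in>S - {0}. of_real (b k) * circ_coeff (cplx (g_k k)) (int l))"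
    unfolding eq circ_coeff_lincomb[OF finite_energyD(1)[OF conjunct1[OF f]] finite_energyD(1)[OF conjunct1[OF g]]]
      conjunct2[OF f] conjunct2[OF g] by simp
  also have "(\<Sum>k\<in>S - {0}. of_real (b k) * circ_coeff (cplx (g_k k)) (int l)) = (\<Sum>k\<in>S - {0}. if l = k then of_real (b k) * (\<i> * of_real (mode_mass k)) else 0)"
    by (rule sum.cong) (auto simp: circ_coeff_g_k)
  also have "(\<Sum>k\<in>S. of_real (a k) * circ_coeff (cplx (f_k k)) (int l)) = (\<Sum>k\<in>S. if l = k then of_real (a k) * of_real (mode_mass k) else 0)"
    by (rule sum.cong) (auto simp: circ_coeff_f_k)
  finally show ?thesis
    using S by (auto simp: algebra_simps)
qed

lemma ae_class_sum:
  assumes "finite S"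
  shows "ae_class (\<lambda>x. \<Sum>k\<in>S. c k * h k x) = (\<Sum>k\<in>S. c k *\<^sub>R ae_class (h k))"
  using assms
proof induction
  case empty
  then show ?case by (simp add: zero_ae_fun_def)
next
  case (insert k S)
  have "ae_class (\<lambda>x. \<Sum>k\<in>insert k S. c k * h k x) = c k *\<^sub>R ae_class (h k) + ae_class (\<lambda>x. \<Sum>k\<in>S. c k * h k x)"
    using insert.hyps by (simp add: plus_ae_fun.abs_eq scaleR_ae_fun.abs_eq)
  then show ?case using insert by simp
qed

lemma ae_class_trig_sum:
  assumes "finite S"
  shows "ae_class (trig_sum S a b) = (\<Sum>k\<in>S. a k *\<^sub>R ae_class (f_k k)) + (\<Sum>k\<in>S - {0}. b k *\<^sub>R ae_class (g_k k))"
  using assms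
  unfolding trig_sum_def[abs_def] plus_ae_fun.abs_eq[symmetric]
  by (simp add: ae_class_sum)

definition modes :: "nat set \<Rightarrow> ae_fun set" where
  "modes S = (\<lambda>k. ae_class (f_k k)) ` S \<union> (\<lambda>k. ae_class (g_k k)) ` (S - {0})"

lemma trig_sum_in_span:
  assumes "finite S"
  shows "ae_class (trig_sum S a b) \<in> span (modes S)"
  unfolding ae_class_trig_sum[OF assms]
  by (intro span_add span_sum span_scale span_base) (auto simp: modes_def)

lemma circ_coeff_AE_0:
  assumes "AE x in lborel. F x = 0"
  shows "circ_coeff F k = 0"
  unfolding circ_coeff_def by (rule integral_eq_zero_AE) (use assms in eventually_elim, simp)

text \<open>The coefficients of a trigonometric sum are real, so both \<open>a l\<close> and \<open>b l\<close> can be read off from its \<open>l\<close>-th Fourier coefficient.\<close>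

lemma independent_modes:
  assumes S: "finite S"
  shows "independent (modes S)" and "card (modes S) = card S + card (S - {0})"
proof -
  define I where "I = Inl ` S \<union> Inr ` (S - {0})"
  define h where "h = case_sum (\<lambda>k. ae_class (f_k k)) (\<lambda>k. ae_class (g_k k))"
  have fin: "finite I" using S by (simp add: I_def)
  have sumI: "(\<Sum>i\<in>I. F i) = (\<Sum>k\<in>S. F (Inl k)) + (\<Sum>k\<in>S - {0}. F (Inr k))" for F :: "nat + nat \<Rightarrow> ae_fun"
    unfolding I_def using S by (subst sum.union_disjoint) (auto simp: sum.reindex)
  have hI: "h ` I = modes S"
    by (auto simp: I_def h_def modes_def image_Un image_image)
  have key: "r i = 0" if zero: "(\<Sum>i\<in>I. r i *\<^sub>R h i) = 0" and i: "i \<in> I" for r i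
  proof -
    let ?t = "trig_sum S (r \<circ> Inl) (r \<circ> Inr)"
    have "ae_class ?t = ae_class (\<lambda>_. 0)"
      using zero S by (simp add: sumI h_def ae_class_trig_sum zero_ae_fun_def)
    then have "AE x in lborel. cplx ?t x = 0" by (simp add: ae_class_eq_iff)
    from circ_coeff_AE_0[OF this]
    have "l \<in> S \<Longrightarrow> complex_of_real (r (Inl l)) + (if l = 0 then 0 else \<i> * of_real (r (Inr l))) = 0" for l
      using circ_coeff_trig_sum[OF S, of "r \<circ> Inl" "r \<circ> Inr" l] mode_mass_pos[of l] by auto
    then have "l \<in> S \<Longrightarrow> r (Inl l) = 0 \<and> (l \<noteq> 0 \<longrightarrow> r (Inr l) = 0)" for l
      by (fastforce simp: complex_eq_iff split: if_splits)
    then show ?thesis using i by (auto simp: I_def)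
  qed
  have inj: "inj_on h I"
  proof (rule inj_onI, rule ccontr)
    fix i j assume ij: "i \<in> I" "j \<in> I" "h i = h j" "i \<noteq> j"
    \<comment> \<open>the trivial relation between two equal members of the family\<close>
    define r where "r t = (if t = i then 1 else if t = j then -1 else 0 :: real)" for t
    have "(\<Sum>t\<in>I. r t *\<^sub>R h t) = (\<Sum>t\<in>I. (if t = i then h i else 0) + (if t = j then - h j else 0))"
      using ij by (intro sum.cong) (auto simp: r_def)
    also have "\<dots> = 0" using ij fin by (simp add: sum.distrib)
    finally have "r i = 0" using ij(1) by (rule key)
    then show False by (simp add: r_def)
  qed
  show "card (modes S) = card S + card (S - {0})"
  proof -
    have "card (modes S) = card I" using card_image[OF inj] by (simp add: hI)
    also have "\<dots> = card S + card (S - {0})"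
      unfolding I_def using S by (subst card_Un_disjoint) (auto simp: card_image)
    finally show ?thesis .
  qed
  show "independent (modes S)"
    unfolding hI[symmetric]
  proof (subst dependent_finite)
    show "\<not> (\<exists>u. (\<exists>v\<in>h ` I. u v \<noteq> 0) \<and> (\<Sum>v\<in>h ` I. u v *\<^sub>R v) = 0)"
    proof
      assume "\<exists>u. (\<exists>v\<in>h ` I. u v \<noteq> 0) \<and> (\<Sum>v\<in>h ` I. u v *\<^sub>R v) = 0"
      then obtain u i where u: "i \<in> I" "u (h i) \<noteq> 0" "(\<Sum>i\<in>I. u (h i) *\<^sub>R h i) = 0"
        by (auto simp: sum.reindex[OF inj])
      then show False using key[OF u(3,1)] by simp
    qed
  qed (use fin in auto)
qed

text \<open>Subtract the trigonometric sum with the same coefficients of nonnegative index. Those of negative index are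
conjugates of these, as the functions are real, so uniqueness applies to the difference.\<close>

lemma in_span_modes:
  assumes S: "finite S" and [measurable]: "f \<in> borel_measurable borel" and f: "finite_energy (cplx f)"
    and zero: "\<And>n. n \<notin> S \<Longrightarrow> circ_coeff (cplx f) (int n) = 0"
  shows "ae_class f \<in> span (modes S)"
proof -
  define c where "c n = circ_coeff (cplx f) (int n)" for n
  have neg: "circ_coeff (cplx h) (- k) = cnj (circ_coeff (cplx h) k)" for h k
    using circ_coeff_cnj[of "cplx h" "- k"] by simp
  define a where "a n = Re (c n) / mode_mass n" for n
  define b where "b n = Im (c n) / mode_mass n" for n
  let ?t = "trig_sum S a b"
  have c0: "Im (c 0) = 0"
    using neg[of f 0] by (simp add: c_def complex_eq_iff)
  have t: "circ_coeff (cplx ?t) (int n) = c n" for n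
  proof (cases "n \<in> S")
    case True
    then show ?thesis
      using mode_mass_pos[of n] c0 unfolding circ_coeff_trig_sum[OF S]
      by (auto simp: a_def b_def complex_eq_iff)
  next
    case False
    then show ?thesis using zero circ_coeff_trig_sum[OF S, of a b n] by (simp add: c_def)
  qed
  let ?d = "\<lambda>x. f x - ?t x"
  have d_eq: "cplx ?d = (\<lambda>x. 1 * cplx f x + (-1) * cplx ?t x)" by (simp add: fun_eq_iff)
  note te = finite_energy_trig_sum[OF S, of a b]
  have d: "finite_energy (cplx ?d)"
    unfolding d_eq by (intro finite_energy_add finite_energy_cmult f te)
  have nat0: "circ_coeff (cplx ?d) (int n) = 0" for n
    unfolding d_eq circ_coeff_lincomb[OF finite_energyD(1)[OF f] finite_energyD(1)[OF te]] t by (simp add: c_def)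
  have "circ_coeff (cplx ?d) k = 0" for k
    using nat0[of "nat k"] nat0[of "nat (- k)"] neg[of ?d "- k"] by (cases "k \<ge> 0") auto
  from AE_eq_0_if_circ_coeff_eq_0[OF d this]
  have "AE x in lborel. f x = ?t x" by eventually_elim (simp flip: of_real_diff)
  then have "ae_class f = ae_class ?t" by (simp add: ae_class_eq_iff)
  then show ?thesis using trig_sum_in_span[OF S] by simp
qed

section \<open>The nullspaces\<close>

text \<open>The common part of the two nullspace computations. The distribution \<open>T\<close> is \<open>L\<close> on complex functions, and \<open>S\<close> is the set
of frequencies at which its multiplier vanishes; the last assumption says that testing with cut-off modes detects the others.\<close>

lemma nullspace_eq_span_modes:
  assumes L: "\<And>f \<phi>. f \<in> borel_measurable borel \<Longrightarrow> finite_energy (cplx f) \<Longrightarrow> test_function \<phi> \<Longrightarrow>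
      L (ae_class f) \<phi> = T (cplx f) \<phi>"
    and T: "\<And>F G \<phi> a b. finite_energy F \<Longrightarrow> finite_energy G \<Longrightarrow> test_function \<phi> \<Longrightarrow>
      T (\<lambda>x. a * F x + b * G x) \<phi> = a * T F \<phi> + b * T G \<phi>"
    and S: "finite S"
    and null: "\<And>k \<phi>. k \<in> S \<Longrightarrow> test_function \<phi> \<Longrightarrow> T (\<lambda>x. cay x ^ k) \<phi> = 0 \<and> T (\<lambda>x. cnj (cay x ^ k)) \<phi> = 0"
    and sel: "\<And>F n. finite_energy F \<Longrightarrow> (\<And>N. T F (cut_mode n N) = 0) \<Longrightarrow> n \<notin> S \<Longrightarrow> circ_coeff F (int n) = 0"
  shows "nullspace L = span (modes S)"
proof
  show "nullspace L \<subseteq> span (modes S)"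
  proof
    fix u assume u: "u \<in> nullspace L"
    then obtain f where f: "f \<in> borel_measurable borel" "u = ae_class f" "finite_energy (cplx f)"
      using Hdot_half_borel_rep[of u] by (auto simp: nullspace_def)
    have "T (cplx f) \<phi> = 0" if "test_function \<phi>" for \<phi>
      using u L[OF f(1,3) that] that by (simp add: nullspace_def zero_dist_def f(2))
    then have "circ_coeff (cplx f) (int n) = 0" if "n \<notin> S" for n
      using sel[OF f(3) _ that] test_function_cut_mode by blast
    then show "u \<in> span (modes S)"
      unfolding f(2) by (rule in_span_modes[OF S f(1,3)])
  qed
  have in_null: "ae_class f \<in> nullspace L"
    if f: "f \<in> borel_measurable borel" "finite_energy (cplx f)" and "\<And>\<phi>. test_function \<phi> \<Longrightarrow> T (cplx f) \<phi> = 0" for f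
    using that Hdot_half_iff_finite_energy[OF f(1)] L[OF f] by (simp add: nullspace_def zero_dist_def)
  have "modes S \<subseteq> nullspace L"
  proof -
    have "ae_class (f_k k) \<in> nullspace L" "ae_class (g_k k) \<in> nullspace L" if "k \<in> S" for k
    proof (rule_tac [!] in_null)
      fix \<phi> assume \<phi>: "test_function \<phi>"
      show "T (cplx (f_k k)) \<phi> = 0" "T (cplx (g_k k)) \<phi> = 0"
        unfolding cplx_f_k cplx_g_k
        by (simp_all only: T[OF finite_energy_cay finite_energy_cnj_cay \<phi>] null[OF that \<phi>]) simp_all
    qed (auto simp: finite_energy_f_k finite_energy_g_k)
    then show ?thesis by (auto simp: modes_def)
  qed
  moreover have "subspace (nullspace L)"
  proof (rule subspaceI)
    have [simp]: "finite_energy (\<lambda>_. 0)"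
      using finite_energy_cmult[OF finite_energy_cay[of 0], of 0] by simp
    show "0 \<in> nullspace L"
      unfolding zero_ae_fun_def
    proof (rule in_null)
      fix \<phi> assume "test_function \<phi>"
      from T[OF finite_energy_cay finite_energy_cay this, of 0 0 0 0] show "T (cplx (\<lambda>_. 0)) \<phi> = 0" by simp
    qed auto
  next
    fix u v assume u: "u \<in> nullspace L" and v: "v \<in> nullspace L"
    obtain f where f: "f \<in> borel_measurable borel" "u = ae_class f" "finite_energy (cplx f)"
      using Hdot_half_borel_rep[of u] u by (auto simp: nullspace_def)
    obtain g where g: "g \<in> borel_measurable borel" "v = ae_class g" "finite_energy (cplx g)"
      using Hdot_half_borel_rep[of v] v by (auto simp: nullspace_def)
    have eq: "cplx (\<lambda>x. f x + g x) = (\<lambda>x. 1 * cplx f x + 1 * cplx g x)" by simp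
    show "u + v \<in> nullspace L"
      unfolding f(2) g(2) plus_ae_fun.abs_eq
    proof (rule in_null)
      show "finite_energy (cplx (\<lambda>x. f x + g x))"
        using finite_energy_add[OF f(3) g(3)] by simp
      fix \<phi> assume \<phi>: "test_function \<phi>"
      show "T (cplx (\<lambda>x. f x + g x)) \<phi> = 0"
        unfolding eq T[OF f(3) g(3) \<phi>]
        using u v \<phi> L[OF f(1,3) \<phi>] L[OF g(1,3) \<phi>] by (simp add: nullspace_def zero_dist_def f(2) g(2))
    qed (use f g in auto)
  next
    fix c :: real and u assume u: "u \<in> nullspace L"
    obtain f where f: "f \<in> borel_measurable borel" "u = ae_class f" "finite_energy (cplx f)"
      using Hdot_half_borel_rep[of u] u by (auto simp: nullspace_def)
    have eq: "cplx (\<lambda>x. c * f x) = (\<lambda>x. of_real c * cplx f x + 0 * cplx f x)" by simp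
    show "c *\<^sub>R u \<in> nullspace L"
      unfolding f(2) scaleR_ae_fun.abs_eq
    proof (rule in_null)
      show "finite_energy (cplx (\<lambda>x. c * f x))"
        using finite_energy_cmult[OF f(3), of "of_real c"] by simp
      fix \<phi> assume \<phi>: "test_function \<phi>"
      show "T (cplx (\<lambda>x. c * f x)) \<phi> = 0"
        unfolding eq T[OF f(3) f(3) \<phi>]
        using u \<phi> L[OF f(1,3) \<phi>] by (simp add: nullspace_def zero_dist_def f(2))
    qed (use f in auto)
  qed
  ultimately show "span (modes S) \<subseteq> nullspace L" by (rule span_minimal)
qed

lemma nullspace_Lplus: "nullspace (Lplus m) = span (modes {m})"
proof (rule nullspace_eq_span_modes[where T = "plus_dist m"])
  fix F n
  assume F: "finite_energy F" "\<And>N. plus_dist m F (cut_mode n N) = 0" and n: "n \<notin> {m}"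
  have "2 * (of_nat n - of_nat m) * circ_coeff F (int n) = 0"
    using plus_dist_cut_mode_tendsto[OF F(1), of m n] unfolding F(2) by (rule LIMSEQ_unique) (rule tendsto_const)
  then show "circ_coeff F (int n) = 0" using n by simp
qed (auto simp: Lplus_eq_plus_dist plus_dist_lincomb plus_dist_cay simp del: complex_cnj_power)

text \<open>The multiplier \<open>n - m\<close> plus the truncated difference \<open>m - n\<close> is zero exactly for \<open>n \<le> m\<close>.\<close>

lemma nullspace_Lminus: "nullspace (Lminus m) = span (modes {0..m})"
proof (rule nullspace_eq_span_modes[where T = "\<lambda>F \<phi>. plus_dist m F \<phi> + chord_dist m F \<phi>"])
  fix F n
  assume F: "finite_energy F" "\<And>N. plus_dist m F (cut_mode n N) + chord_dist m F (cut_mode n N) = 0"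
    and n: "n \<notin> {0..m}"
  have "(\<lambda>N. plus_dist m F (cut_mode n N) + chord_dist m F (cut_mode n N)) \<longlonglongrightarrow>
      2 * (of_nat n - of_nat m) * circ_coeff F (int n) + 2 * of_nat (m - n) * circ_coeff F (int n)"
    by (intro tendsto_add plus_dist_cut_mode_tendsto chord_dist_cut_mode_tendsto F)
  then have "2 * (of_nat n - of_nat m) * circ_coeff F (int n) + 2 * of_nat (m - n) * circ_coeff F (int n) = 0"
    unfolding F(2) by (rule LIMSEQ_unique) (rule tendsto_const)
  then show "circ_coeff F (int n) = 0" using n by auto
next
  fix k \<phi> assume "k \<in> {0..m}" "test_function \<phi>"
  then show "plus_dist m (\<lambda>x. cay x ^ k) \<phi> + chord_dist m (\<lambda>x. cay x ^ k) \<phi> = 0 \<and>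
      plus_dist m (\<lambda>x. cnj (cay x ^ k)) \<phi> + chord_dist m (\<lambda>x. cnj (cay x ^ k)) \<phi> = 0"
    by (simp add: plus_dist_cay chord_dist_cay of_nat_diff algebra_simps del: complex_cnj_power)
qed (auto simp: Lminus_eq_dist plus_dist_lincomb chord_dist_lincomb algebra_simps)

lemma not_integrable_if_tendsto_1:
  fixes h :: "real \<Rightarrow> real"
  assumes lim: "(h \<longlongrightarrow> 1) at_top"
  shows "\<not> integrable lborel h"
proof
  assume h: "integrable lborel h"
  have "\<forall>\<^sub>F x in at_top. h x > 1 / 2"
    by (rule order_tendstoD(1)[OF lim]) simp
  then obtain a where a: "\<And>x. x \<ge> a \<Longrightarrow> h x > 1 / 2" by (auto simp: eventually_at_top_linorder)
  have "real n / 2 \<le> (LBINT x. \<bar>h x\<bar>)" for n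
  proof -
    have "(LBINT x. indicator {a..a + real n} x / 2) \<le> (LBINT x. \<bar>h x\<bar>)"
    proof (rule integral_mono_AE')
      show "AE x in lborel. indicator {a..a + real n} x / 2 \<le> \<bar>h x\<bar>"
        using a by (intro AE_I2) (force simp: indicator_def)
    qed (use h in auto)
    then show ?thesis by simp
  qed
  moreover obtain n :: nat where "2 * (LBINT x. \<bar>h x\<bar>) < real n"
    using reals_Archimedean2 by blast
  ultimately show False by (smt (verit) field_sum_of_halves)
qed

section \<open>The resonance\<close>

text \<open>At infinity \<open>cay\<close> tends to \<open>\<i>\<close>, and \<open>\<i> ^ m\<close> is \<open>\<plusminus>\<i>\<close> for odd \<open>m\<close> and \<open>\<plusminus>1\<close> for even \<open>m\<close>, so the square of the
function tends to \<open>1\<close>.\<close>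

lemma resonance_not_L2: "ae_class (if odd m then g_k m else f_k m) \<notin> L2"
proof -
  define h where "h = (if odd m then g_k m else f_k m)"
  have [measurable]: "h \<in> borel_measurable borel" by (simp add: h_def)
  have "((\<lambda>x. (if odd m then Im (cay x ^ m) else Re (cay x ^ m))\<^sup>2) \<longlongrightarrow> (if odd m then Im (\<i> ^ m) else Re (\<i> ^ m))\<^sup>2) at_top"
  proof -
    have c: "((\<lambda>x. cay x ^ m) \<longlongrightarrow> \<i> ^ m) at_top" by (intro tendsto_power cay_tendsto)
    show ?thesis
      using tendsto_power[OF tendsto_Im[OF c], of 2] tendsto_power[OF tendsto_Re[OF c], of 2]
      by (cases "odd m") simp_all
  qed
  moreover have "(if odd m then Im (\<i> ^ m) else Re (\<i> ^ m))\<^sup>2 = 1"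
  proof (cases "odd m")
    case True
    then obtain j where "m = 2 * j + 1" by (elim oddE)
    then show ?thesis by (simp add: power_mult power2_eq_square flip: power_mult_distrib)
  next
    case False
    then obtain j where "m = 2 * j" by (elim evenE[OF iffD1[OF not_not]]) auto
    then show ?thesis by (simp add: power_mult power2_eq_square flip: power_mult_distrib)
  qed
  moreover have "(\<lambda>x. (if odd m then Im (cay x ^ m) else Re (cay x ^ m))\<^sup>2) = (\<lambda>x. (h x)\<^sup>2)"
    by (auto simp: h_def f_k_def g_k_def cay_def)
  ultimately have "((\<lambda>x. (h x)\<^sup>2) \<longlongrightarrow> 1) at_top" by simp
  from not_integrable_if_tendsto_1[OF this]
  have "\<not> integrable lebesgue (\<lambda>x. (h x)\<^sup>2)" by (subst integrable_completion) auto
  then show ?thesis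
    by (simp add: L2_def square_integrable.abs_eq h_def)
qed

theorem theorem3:
  fixes m :: nat
  assumes "m \<ge> 1"
  shows "nullspace (Lplus m) = span {ae_class (f_k m), ae_class (g_k m)} \<and>
         nullspace (Lminus m) =
           span ({ae_class (\<lambda>_. 1)} \<union> (\<lambda>k. ae_class (f_k k)) ` {1..m}
                                    \<union> (\<lambda>k. ae_class (g_k k)) ` {1..m}) \<and>
         dim (nullspace (Lplus m)) = 2 \<and>
         dim (nullspace (Lminus m)) = 2 * m + 1 \<and>
         (let \<phi> = ae_class (if odd m then g_k m else f_k m)
          in \<phi> \<in> Hdot_half - L2 \<and> zero_dist (Lplus m \<phi>) \<and> zero_dist (Lminus m \<phi>))"
proof -
  have plus: "modes {m} = {ae_class (f_k m), ae_class (g_k m)}"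
    using assms by (auto simp: modes_def)
  have "f_k 0 = (\<lambda>_. 1)" by (simp add: f_k_def fun_eq_iff)
  moreover have "{0..m} = insert 0 {1..m}" by auto
  moreover have "{0..m} - {0} = {1..m}" by auto
  ultimately have minus: "modes {0..m} = {ae_class (\<lambda>_. 1)} \<union> (\<lambda>k. ae_class (f_k k)) ` {1..m}
                                    \<union> (\<lambda>k. ae_class (g_k k)) ` {1..m}"
    by (simp add: modes_def Un_assoc)
  let ?\<phi> = "ae_class (if odd m then g_k m else f_k m)"
  have "?\<phi> \<in> modes {m}" "?\<phi> \<in> modes {0..m}"
    using assms by (auto simp: modes_def)
  then have "?\<phi> \<in> nullspace (Lplus m)" "?\<phi> \<in> nullspace (Lminus m)"
    by (auto simp: nullspace_Lplus nullspace_Lminus intro: span_base)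
  moreover have "dim (nullspace (Lplus m)) = 2"
    unfolding nullspace_Lplus dim_span dim_eq_card_independent[OF independent_modes(1)[OF finite.intros(2)[OF finite.intros(1)]]]
    using assms by (simp add: independent_modes(2))
  moreover have "dim (nullspace (Lminus m)) = 2 * m + 1"
    unfolding nullspace_Lminus dim_span dim_eq_card_independent[OF independent_modes(1)[OF finite_atLeastAtMost]]
    by (simp add: independent_modes(2))
  ultimately show ?thesis
    using resonance_not_L2[of m]
    unfolding Let_def nullspace_Lplus[of m, unfolded plus, symmetric] nullspace_Lminus[of m, unfolded minus, symmetric]
    by (simp add: nullspace_def)
qed

end
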